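(* Let $f\in\mathbb{C}[x_1,\ldots,x_n]$ be irreducible and semi-invariant of weight $m\geq1$ under an effective regular action $\mu$ of the multiplicative group $\mathbb{G}_m$ on $\mathbb{A}^n=\mathrm{Spec}(\mathbb{C}[x_1,\ldots,x_n])$. Let $\mathbf{k}=\mathbb{C}(t)$ and denote, for every integer $\ell\geq1$, by $Y_\ell$ the closed subvariety of $\mathbb{A}^n_{\mathbf{k}}$ defined by the equation $f=t^{-\ell}$. Suppose that the varieties $\widetilde{X}_{f,\ell}$ and $\widetilde{X}_{f,\ell'}$ are isomorphic for some integers $\ell,\ell'\geq1$ both coprime with $m$. Let further $\ell''\geq1$ be an integer congruent to $-\ell'$ modulo $m$. Then $Y_\ell$ is isomorphic, as a variety over $\mathbf{k}$, to $Y_{\ell'}$ or to $Y_{\ell''}$.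
   Context: $\mathbb{G}_m=\mathrm{Spec}(\mathbb{C}[t^{\pm1}])$ is the multiplicative group over $\mathbb{C}$. A polynomial $f$ is semi-invariant of weight $m$ for the action $\mu$ if $f(\mu(\lambda,x))=\lambda^m f(x)$ for all $\lambda\in\mathbb{G}_m$ and $x\in\mathbb{A}^n$. For $\ell\geq1$, $\widetilde{X}_{f,\ell}$ is the complex hypersurface of $\mathbb{A}^n\times(\mathbb{A}^1\setminus\{0\})=\mathrm{Spec}(\mathbb{C}[x_1,\ldots,x_n][t^{\pm1}])$ defined by $t^{\ell}f=1$; isomorphism of $\widetilde{X}_{f,\ell}$ and $\widetilde{X}_{f,\ell'}$ means isomorphism as abstract complex algebraic varieties. *)

theory Defs
  imports
    "HOL-Analysis.Analysis"
    "HOL-Algebra.Algebra"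
    "HOL-Algebra.Algebraic_Closure_Type"
    "HOL-Library.Poly_Mapping"
    "HOL-Computational_Algebra.Computational_Algebra"
    "HOL-Number_Theory.Cong"
begin

section \<open>Polynomial and Laurent polynomial rings\<close>

text \<open>
  The monoid algebra of the monomials in the variables \<open>x\<^sub>i\<close>, \<open>i :: 'n\<close>. The number \<open>n\<close> of
  variables is \<open>CARD('n)\<close>; the product of \<^typ>\<open>'a \<Rightarrow>\<^sub>0 'b\<close> is the convolution product.
\<close>
type_synonym ('n, 'a) mpol = "('n \<Rightarrow>\<^sub>0 nat) \<Rightarrow>\<^sub>0 'a"

text \<open>
  The ring \<open>A[t, t\<inverse>]\<close>, as the group algebra of the integers over \<open>A\<close>.
\<close>
type_synonym 'a laurent = "int \<Rightarrow>\<^sub>0 'a"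

definition mpol_const :: "'a::zero \<Rightarrow> ('n, 'a) mpol"
  where "mpol_const c = Poly_Mapping.single 0 c"

definition mpol_eval :: "'a^'n \<Rightarrow> ('n::finite, 'a::comm_semiring_1) mpol \<Rightarrow> 'a"
  where "mpol_eval x p =
    (\<Sum>\<alpha>\<in>Poly_Mapping.keys p.
       Poly_Mapping.lookup p \<alpha> * (\<Prod>i\<in>UNIV. (x $ i) ^ Poly_Mapping.lookup \<alpha> i))"

definition laurent_const :: "'a::zero \<Rightarrow> 'a laurent"
  where "laurent_const a = Poly_Mapping.single 0 a"

definition laurent_var_power :: "int \<Rightarrow> 'a::zero_neq_one laurent"
  where "laurent_var_power k = Poly_Mapping.single k 1"

definition laurent_mpol_eval :: "'a \<Rightarrow> 'a^'n \<Rightarrow> ('n::finite, 'a::field) mpol laurent \<Rightarrow> 'a"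
  where "laurent_mpol_eval t x p =
    (\<Sum>k\<in>Poly_Mapping.keys p. mpol_eval x (Poly_Mapping.lookup p k) * t powi k)"


section \<open>Actions of the multiplicative group on affine space\<close>

definition Gm :: "complex monoid"
  where "Gm = mult_of (ring_of_type_algebra :: complex ring)"

text \<open>
  An action of \<open>\<bbbG>\<^sub>m\<close> on \<open>\<bbbA>\<^sup>n\<close> is regular if \<open>(t, x) \<mapsto> \<mu> t x\<close> is a morphism of varieties
  \<open>\<bbbG>\<^sub>m \<times> \<bbbA>\<^sup>n \<rightarrow> \<bbbA>\<^sup>n\<close>, that is, if its components are elements of
  \<open>\<complex>[x\<^sub>1, \<dots>, x\<^sub>n][t, t\<inverse>]\<close>.
\<close>
definition regular_Gm_action :: "(complex \<Rightarrow> complex^'n \<Rightarrow> complex^'n::finite) \<Rightarrow> bool"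
  where "regular_Gm_action \<mu> \<longleftrightarrow>
    group_action Gm UNIV \<mu> \<and>
    (\<exists>p :: 'n \<Rightarrow> ('n, complex) mpol laurent.
       \<forall>t\<in>carrier Gm. \<forall>x i. \<mu> t x $ i = laurent_mpol_eval t x (p i))"

definition effective_Gm_action :: "(complex \<Rightarrow> complex^'n \<Rightarrow> complex^'n::finite) \<Rightarrow> bool"
  where "effective_Gm_action \<mu> \<longleftrightarrow> faithful_action Gm UNIV \<mu>"

definition semi_invariant ::
    "(complex \<Rightarrow> complex^'n \<Rightarrow> complex^'n) \<Rightarrow> nat \<Rightarrow> ('n::finite, complex) mpol \<Rightarrow> bool"
  where "semi_invariant \<mu> m f \<longleftrightarrow>
    (\<forall>t\<in>carrier Gm. \<forall>x. mpol_eval (\<mu> t x) f = t ^ m * mpol_eval x f)"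


section \<open>Ringed spaces over a field and their isomorphisms\<close>

text \<open>
  A ringed space over a field with underlying type \<open>'k\<close>: \<open>sections S U\<close> is the ring of sections
  over the open set \<open>U\<close>, \<open>restriction S U V\<close> the restriction from \<open>U\<close> to \<open>V\<close>, and \<open>scalar S U\<close>
  the structure map from the field to \<open>sections S U\<close>.
\<close>
record ('p, 's, 'k) ringed_space =
  underlying :: "'p topology"
  sections :: "'p set \<Rightarrow> 's ring"
  restriction :: "'p set \<Rightarrow> 'p set \<Rightarrow> 's \<Rightarrow> 's"
  scalar :: "'p set \<Rightarrow> 'k \<Rightarrow> 's"

definition preimage ::
    "('p, 's, 'k) ringed_space \<Rightarrow> ('p \<Rightarrow> 'q) \<Rightarrow> 'q set \<Rightarrow> 'p set"
  where "preimage S h V = {x \<in> topspace (underlying S). h x \<in> V}"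

text \<open>
  An isomorphism of ringed spaces \<open>(h, \<theta>) : S \<rightarrow> T\<close> which is linear over the field. The
  induced maps on stalks are isomorphisms of rings, hence local whenever the stalks are local
  rings; so between schemes these are exactly the isomorphisms of schemes over the field.
\<close>
definition isomorphic_over_field ::
    "('p, 's, 'k) ringed_space \<Rightarrow> ('q, 'r, 'k) ringed_space \<Rightarrow> bool"
  where "isomorphic_over_field S T \<longleftrightarrow>
    (\<exists>h \<theta>.
       homeomorphic_map (underlying S) (underlying T) h \<and>
       (\<forall>V. openin (underlying T) V \<longrightarrow>
          \<theta> V \<in> ring_iso (sections T V) (sections S (preimage S h V))) \<and>
       (\<forall>V W s. openin (underlying T) V \<and> openin (underlying T) W \<and> W \<subseteq> V \<and>
          s \<in> carrier (sections T V) \<longrightarrow>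
          \<theta> W (restriction T V W s) =
            restriction S (preimage S h V) (preimage S h W) (\<theta> V s)) \<and>
       (\<forall>V c. openin (underlying T) V \<longrightarrow>
          \<theta> V (scalar T V c) = scalar S (preimage S h V) c))"


section \<open>The spectrum of a commutative ring\<close>

definition prime_spectrum :: "('a, 'b) ring_scheme \<Rightarrow> 'a set set"
  where "prime_spectrum R = {P. primeideal P R}"

definition basic_open :: "('a, 'b) ring_scheme \<Rightarrow> 'a \<Rightarrow> 'a set set"
  where "basic_open R a = {P \<in> prime_spectrum R. a \<notin> P}"

definition zariski_topology :: "('a, 'b) ring_scheme \<Rightarrow> 'a set topology"
  where "zariski_topology R = topology_generated_by (basic_open R ` carrier R)"

text \<open>The element \<open>a / s\<close> of the localization of \<open>R\<close> at \<open>P\<close>, as an equivalence class of pairs.\<close>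
definition fraction :: "('a, 'b) ring_scheme \<Rightarrow> 'a set \<Rightarrow> 'a \<Rightarrow> 'a \<Rightarrow> ('a \<times> 'a) set"
  where "fraction R P a s =
    {(b, v). b \<in> carrier R \<and> v \<in> carrier R - P \<and>
       (\<exists>u\<in>carrier R - P. u \<otimes>\<^bsub>R\<^esub> (a \<otimes>\<^bsub>R\<^esub> v) = u \<otimes>\<^bsub>R\<^esub> (b \<otimes>\<^bsub>R\<^esub> s))}"

text \<open>
  In \<open>mult\<close> and \<open>add\<close> the classes united all coincide, because the operations on fractions
  do not depend on the representatives.
\<close>
definition localization_at :: "('a, 'b) ring_scheme \<Rightarrow> 'a set \<Rightarrow> ('a \<times> 'a) set ring"
  where "localization_at R P =
    \<lparr>carrier = {fraction R P a s | a s. a \<in> carrier R \<and> s \<in> carrier R - P},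
     monoid.mult = (\<lambda>A B. \<Union>(a, s)\<in>A. \<Union>(b, v)\<in>B. fraction R P (a \<otimes>\<^bsub>R\<^esub> b) (s \<otimes>\<^bsub>R\<^esub> v)),
     one = fraction R P \<one>\<^bsub>R\<^esub> \<one>\<^bsub>R\<^esub>,
     ring.zero = fraction R P \<zero>\<^bsub>R\<^esub> \<one>\<^bsub>R\<^esub>,
     add = (\<lambda>A B. \<Union>(a, s)\<in>A. \<Union>(b, v)\<in>B.
       fraction R P ((a \<otimes>\<^bsub>R\<^esub> v) \<oplus>\<^bsub>R\<^esub> (b \<otimes>\<^bsub>R\<^esub> s)) (s \<otimes>\<^bsub>R\<^esub> v))\<rparr>"

text \<open>Sections over \<open>U\<close>: families of germs which are locally given by a single fraction.\<close>
definition structure_sheaf ::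
    "('a, 'b) ring_scheme \<Rightarrow> 'a set set \<Rightarrow> ('a set \<Rightarrow> ('a \<times> 'a) set) ring"
  where "structure_sheaf R U =
    \<lparr>carrier = {\<sigma> \<in> (\<Pi>\<^sub>E P\<in>U. carrier (localization_at R P)).
       \<forall>P\<in>U. \<exists>V a s. openin (zariski_topology R) V \<and> P \<in> V \<and> V \<subseteq> U \<and>
         a \<in> carrier R \<and> s \<in> carrier R \<and> (\<forall>Q\<in>V. s \<notin> Q \<and> \<sigma> Q = fraction R Q a s)},
     monoid.mult = (\<lambda>\<sigma> \<tau>. \<lambda>P\<in>U. \<sigma> P \<otimes>\<^bsub>localization_at R P\<^esub> \<tau> P),
     one = (\<lambda>P\<in>U. \<one>\<^bsub>localization_at R P\<^esub>),
     ring.zero = (\<lambda>P\<in>U. \<zero>\<^bsub>localization_at R P\<^esub>),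
     add = (\<lambda>\<sigma> \<tau>. \<lambda>P\<in>U. \<sigma> P \<oplus>\<^bsub>localization_at R P\<^esub> \<tau> P)\<rparr>"

text \<open>The spectrum of the algebra \<open>R\<close> over a field with structure map \<open>\<iota>\<close>.\<close>
definition Spec ::
    "('a, 'b) ring_scheme \<Rightarrow> ('k \<Rightarrow> 'a) \<Rightarrow>
      ('a set, 'a set \<Rightarrow> ('a \<times> 'a) set, 'k) ringed_space"
  where "Spec R \<iota> =
    \<lparr>underlying = zariski_topology R,
     sections = structure_sheaf R,
     restriction = (\<lambda>U V \<sigma>. restrict \<sigma> V),
     scalar = (\<lambda>U c. \<lambda>P\<in>U. fraction R P (\<iota> c) \<one>\<^bsub>R\<^esub>)\<rparr>"

text \<open>
  The closed subscheme of \<open>Spec A\<close> with equation \<open>g = 0\<close>, for the algebra \<open>A\<close> on the type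
  \<open>'a\<close> with structure map \<open>\<iota>\<close>.
\<close>
definition zero_locus ::
    "('k \<Rightarrow> 'a) \<Rightarrow> 'a::comm_ring_1 \<Rightarrow>
      ('a set set, 'a set set \<Rightarrow> ('a set \<times> 'a set) set, 'k) ringed_space"
  where "zero_locus \<iota> g =
    (let A = ring_of_type_algebra; I = PIdl\<^bsub>A\<^esub> g in Spec (A Quot I) (\<lambda>c. I +>\<^bsub>A\<^esub> \<iota> c))"


section \<open>The varieties attached to a polynomial\<close>

text \<open>The hypersurface \<open>t\<^sup>l f = 1\<close> in \<open>Spec (\<complex>[x\<^sub>1, \<dots>, x\<^sub>n][t, t\<inverse>])\<close>.\<close>
definition X_tilde ::
    "('n, complex) mpol \<Rightarrow> nat \<Rightarrow>
      (('n, complex) mpol laurent set set,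
       ('n, complex) mpol laurent set set \<Rightarrow>
         (('n, complex) mpol laurent set \<times> ('n, complex) mpol laurent set) set,
       complex) ringed_space"
  where "X_tilde f l =
    zero_locus (\<lambda>c. laurent_const (mpol_const c))
      (laurent_var_power (int l) * laurent_const f - 1)"

type_synonym rational_function = "complex poly fract"

definition rf_const :: "complex \<Rightarrow> rational_function"
  where "rf_const c = Fract [:c:] 1"

definition rf_var :: rational_function
  where "rf_var = Fract [:0, 1:] 1"

text \<open>The hypersurface \<open>f = t\<^sup>-\<^sup>l\<close> in affine space over \<open>\<complex>(t)\<close>.\<close>
definition Y_variety ::
    "('n, complex) mpol \<Rightarrow> nat \<Rightarrow>
      (('n, rational_function) mpol set set,
       ('n, rational_function) mpol set set \<Rightarrow>
         (('n, rational_function) mpol set \<times> ('n, rational_function) mpol set) set,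
       rational_function) ringed_space"
  where "Y_variety f l =
    zero_locus mpol_const
      (Poly_Mapping.map rf_const f - mpol_const (inverse rf_var ^ l))"

end

theory Submission
  imports Defs
begin

text \<open>
  Let \<open>A\<^sub>l = \<complex>[x][t, t\<inverse>] / (t\<^sup>l f - 1)\<close> be the coordinate ring of the hypersurface. The coordinate
  \<open>t\<close> makes the hypersurface a family over the punctured line, and the variety \<open>f = t\<^sup>-\<^sup>l\<close> over
  \<open>\<complex>(t)\<close> is its generic fibre. The theorem holds because an isomorphism between two such
  hypersurfaces has to respect these families up to a change of parameter
  \<open>t \<mapsto> a t\<close> or \<open>t \<mapsto> a t\<inverse>\<close>.

  To see this, one determines the units of \<open>A\<^sub>l\<close>. The torus acts on the hypersurface by
  \<open>s \<cdot> (t, x) = (s\<^sup>-\<^sup>m t, \<mu>(s\<^sup>l, x))\<close>, and so \<open>A\<^sub>l\<close> is graded by the integers. Because \<open>l\<close> and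
  \<open>m\<close> are coprime, the \<open>l\<close>-th roots of unity in the torus act by all the deck transformations
  \<open>t \<mapsto> \<zeta> t\<close> of the covering \<open>(t, x) \<mapsto> x\<close> of the set \<open>f \<noteq> 0\<close>. A homogeneous element is therefore
  of the form \<open>b(x) t\<^sup>e\<close> (\<open>homogeneous_form\<close>). Products of nonzero elements of this form are nonzero,
  so \<open>A\<^sub>l\<close> is a domain (\<open>vanishing_ideal_prime\<close>) and its units are homogeneous. In a unit
  \<open>b(x) t\<^sup>e\<close> the polynomial \<open>b\<close> divides a power of \<open>f\<close>. As \<open>f\<close> is irreducible and polynomial
  rings are factorial (\<open>mpol_factorial\<close>), \<open>b\<close> is a power of \<open>f\<close> up to a constant, and the unit
  is \<open>c t\<^sup>j\<close> (\<open>units_on_hypersurface\<close>). An isomorphism \<open>A\<^sub>l\<^sub>' \<rightarrow> A\<^sub>l\<close> thus sends \<open>t\<close> to some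
  \<open>a t\<^sup>j\<close>, and \<open>j = \<plusminus>1\<close> because the inverse has the same form (\<open>coordinates_of_isomorphism\<close>).

  It follows that the families \<open>f = t\<^sup>-\<^sup>l\<close> and \<open>f = (a t\<^sup>j)\<^sup>-\<^sup>l\<^sup>'\<close> are isomorphic over the
  punctured line. The point \<open>c t\<^sup>n\<close> of the torus over \<open>\<complex>(t)\<close> multiplies \<open>f\<close> by
  \<open>c\<^sup>m t\<^sup>m\<^sup>n\<close>. For suitable \<open>c\<close> and \<open>n\<close> it turns the second family into \<open>f = t\<^sup>-\<^sup>l\<^sup>'\<close> if
  \<open>j = 1\<close>, and into \<open>f = t\<^sup>-\<^sup>l\<^sup>'\<^sup>'\<close> if \<open>j = -1\<close>, since \<open>m\<close> divides \<open>l' + l''\<close>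
  (\<open>Y_isomorphic_after_rescaling\<close>). All maps involved are Laurent polynomials in \<open>t\<close>. Identities
  between them can be checked at complex points, because \<open>t\<^sup>l f - 1\<close> generates the vanishing ideal of
  the hypersurface (\<open>vanishes_iff_dvd\<close>), and then hold over \<open>\<complex>(t)\<close>
  (\<open>Y_isomorphic_if_families\<close>).

  The passage between ringed spaces and rings rests on two facts: isomorphic rings have isomorphic
  spectra (\<open>Spec_isomorphic\<close>), and a domain is the ring of global sections on its
  spectrum (\<open>global_section_iso\<close>).
\<close>

section \<open>Homomorphisms out of polynomial rings\<close>

(* The bare names coeff, monom, degree and lead_coeff mean those of univariate polynomials. *)
hide_const (open) up_ring.coeff up_ring.monom Polynomials.degree Poly_Mapping.degree Polynomials.lead_coeff

abbreviation keys where "keys \<equiv> Poly_Mapping.keys"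
abbreviation lookup where "lookup \<equiv> Poly_Mapping.lookup"
abbreviation single where "single \<equiv> Poly_Mapping.single"
abbreviation leval where "leval \<equiv> laurent_mpol_eval"

text \<open>
  The composites of evaluations, substitutions and base changes below go between rings given by
  types, so a homomorphism is a plain function here, without carriers.
\<close>
locale ring_morphism =
  fixes h :: "'a::comm_ring_1 \<Rightarrow> 'b::comm_ring_1"
  assumes add: "h (a + b) = h a + h b"
    and mult: "h (a * b) = h a * h b"
    and one: "h 1 = 1"
begin

lemma zero: "h 0 = 0"
  using add[of 0 0] by simp

lemma uminus: "h (- a) = - h a"
  using add[of a "- a"] zero by (simp add: eq_neg_iff_add_eq_0 add.commute)

lemma diff: "h (a - b) = h a - h b"
  using add[of a "- b"] by (simp add: uminus)

lemma sum: "h (\<Sum>i\<in>I. F i) = (\<Sum>i\<in>I. h (F i))"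
  by (induction I rule: infinite_finite_induct) (simp_all add: zero add)

lemma prod: "h (\<Prod>i\<in>I. F i) = (\<Prod>i\<in>I. h (F i))"
  by (induction I rule: infinite_finite_induct) (simp_all add: one mult)

lemma power: "h (a ^ n) = h a ^ n"
  by (induction n) (simp_all add: one mult)

lemma dvd: "a dvd b \<Longrightarrow> h a dvd h b"
  by (auto simp: dvd_def mult)

end

lemma ring_morphism_comp:
  "ring_morphism h \<Longrightarrow> ring_morphism g \<Longrightarrow> ring_morphism (\<lambda>a. g (h a))"
  by (simp add: ring_morphism_def)

lemma ring_morphism_id: "ring_morphism (\<lambda>a. a)"
  by (simp add: ring_morphism_def)

definition pm_eval :: "('a::zero \<Rightarrow> 'b::comm_ring_1) \<Rightarrow> ('k \<Rightarrow> 'b) \<Rightarrow> ('k \<Rightarrow>\<^sub>0 'a) \<Rightarrow> 'b"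
  where "pm_eval c M p = (\<Sum>k\<in>keys p. c (lookup p k) * M k)"

lemma poly_mapping_sum_single:
  "(\<Sum>k\<in>keys p. single k (lookup p k)) = p"
proof (rule poly_mapping_eqI)
  fix j
  have "lookup (\<Sum>k\<in>keys p. single k (lookup p k)) j
    = (\<Sum>k\<in>keys p. if j = k then lookup p k else 0)"
    unfolding lookup_sum by (rule sum.cong) (auto simp: lookup_single when_def)
  also have "\<dots> = lookup p j"
    by (auto simp: sum.delta' in_keys_iff)
  finally show "lookup (\<Sum>k\<in>keys p. single k (lookup p k)) j
    = lookup p j" .
qed

lemma pm_eval_superset:
  assumes "c 0 = 0" "finite K" "keys p \<subseteq> K"
  shows "pm_eval c M p = (\<Sum>k\<in>K. c (lookup p k) * M k)"
  unfolding pm_eval_def using assms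
  by (intro sum.mono_neutral_left) (auto simp: in_keys_iff)

lemma pm_eval_single: "c 0 = 0 \<Longrightarrow> pm_eval c M (single k a) = c a * M k"
  by (auto simp: pm_eval_def)

lemma pm_eval_morphism:
  assumes "ring_morphism c" and M0: "M 0 = 1" and M: "\<And>a b. M (a + b) = M a * M b"
  shows "ring_morphism (pm_eval c M)"
proof -
  interpret c: ring_morphism c by fact
  have add: "pm_eval c M (p + q) = pm_eval c M p + pm_eval c M q" for p q
  proof -
    let ?K = "keys p \<union> keys q"
    have "pm_eval c M (p + q) = (\<Sum>k\<in>?K. c (lookup (p + q) k) * M k)"
      by (rule pm_eval_superset) (auto simp: c.zero keys_add)
    also have "\<dots> = (\<Sum>k\<in>?K. c (lookup p k) * M k) + (\<Sum>k\<in>?K. c (lookup q k) * M k)"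
      by (simp add: lookup_add c.add distrib_right sum.distrib)
    also have "\<dots> = pm_eval c M p + pm_eval c M q"
      by (simp add: pm_eval_superset[of c ?K] c.zero)
    finally show ?thesis .
  qed
  have z: "pm_eval c M 0 = 0" by (simp add: pm_eval_def)
  have sum: "pm_eval c M (\<Sum>i\<in>I. F i) = (\<Sum>i\<in>I. pm_eval c M (F i))" for I and F :: "'z \<Rightarrow> _"
    by (induction I rule: infinite_finite_induct) (simp_all add: z add)
  have sgl: "pm_eval c M (single k a * single j b)
     = (c a * M k) * (c b * M j)" for k a j b
    by (simp add: mult_single pm_eval_single c.zero c.mult M mult_ac)
  have "pm_eval c M (p * q) = pm_eval c M p * pm_eval c M q" for p q
  proof -
    have "pm_eval c M (p * q) =
      pm_eval c M ((\<Sum>k\<in>keys p. single k (lookup p k)) *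
        (\<Sum>k\<in>keys q. single k (lookup q k)))"
      by (simp only: poly_mapping_sum_single)
    also have "\<dots> = pm_eval c M p * pm_eval c M q"
      by (simp only: sum_product sum sgl) (simp only: pm_eval_def sum_product)
    finally show ?thesis .
  qed
  moreover have "pm_eval c M 1 = 1"
    using pm_eval_single[of c M 0 1] by (simp add: c.zero c.one M0)
  ultimately show ?thesis using add by unfold_locales auto
qed

text \<open>
  A homomorphism out of a monoid algebra is determined by its values on scalars and on the monoid.
  Evaluation at a point, substitution and base change are all of this form, and equalities between
  such maps reduce to equalities on generators.
\<close>
lemma ring_morphism_eq_pm_eval:
  assumes "ring_morphism (h :: ('k::comm_monoid_add \<Rightarrow>\<^sub>0 'a::comm_ring_1) \<Rightarrow> 'b::comm_ring_1)"
  shows "h p = pm_eval (\<lambda>a. h (single 0 a)) (\<lambda>k. h (single k 1)) p"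
proof -
  interpret ring_morphism h by fact
  have "h p = h (\<Sum>k\<in>keys p. single 0 (lookup p k) * single k 1)"
    by (simp add: mult_single poly_mapping_sum_single)
  thus ?thesis by (simp add: sum mult pm_eval_def)
qed

lemma ring_morphism_single0:
  "ring_morphism (\<lambda>a. single (0::'k::comm_monoid_add) (a::'a::comm_ring_1))"
  by unfold_locales (simp_all add: single_add mult_single)

definition mvar :: "'n \<Rightarrow> ('n, 'a::comm_ring_1) mpol"
  where "mvar i = single (single i 1) 1"

definition monomial_at :: "('n::finite \<Rightarrow> 'b::comm_ring_1) \<Rightarrow> ('n \<Rightarrow>\<^sub>0 nat) \<Rightarrow> 'b"
  where "monomial_at G \<alpha> = (\<Prod>i\<in>UNIV. G i ^ lookup \<alpha> i)"

lemma monomial_at_0: "monomial_at G 0 = 1"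
  by (simp add: monomial_at_def)

lemma monomial_at_add: "monomial_at G (a + b) = monomial_at G a * monomial_at G b"
  by (simp add: monomial_at_def lookup_add power_add prod.distrib)

lemma monomial_at_single: "monomial_at G (single i n) = G i ^ n"
proof -
  have "monomial_at G (single i n) = (\<Prod>j\<in>UNIV. if i = j then G j ^ n else 1)"
    unfolding monomial_at_def by (rule prod.cong) (auto simp: lookup_single)
  thus ?thesis by simp
qed

text \<open>
  The exponents form the free commutative monoid on the variables, so that a multiplicative
  function of the exponent is determined by its values on the variables.
\<close>
lemma eq_monomial_at:
  fixes M :: "('n::finite \<Rightarrow>\<^sub>0 nat) \<Rightarrow> 'b::comm_ring_1"
  assumes M0: "M 0 = 1" and M: "\<And>a b. M (a + b) = M a * M b"
  shows "M \<alpha> = monomial_at (\<lambda>i. M (single i 1)) \<alpha>"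
proof -
  have pw: "M (single i n) = M (single i 1) ^ n" for i n
  proof (induction n)
    case (Suc n)
    have "single i (Suc n) = single i 1 + single i n"
      by (simp add: single_add[symmetric])
    thus ?case using Suc by (simp add: M)
  qed (simp add: M0)
  have s: "M (\<Sum>i\<in>I. F i) = (\<Prod>i\<in>I. M (F i))" if "finite I" for I and F :: "'n \<Rightarrow> _"
    using that by (induction I rule: finite_induct) (simp_all add: M0 M)
  have \<alpha>: "\<alpha> = (\<Sum>i\<in>UNIV. single i (lookup \<alpha> i))"
  proof (rule poly_mapping_eqI)
    fix j
    have "lookup (\<Sum>i\<in>UNIV. single i (lookup \<alpha> i)) j
      = (\<Sum>i\<in>UNIV. if j = i then lookup \<alpha> i else 0)"
      unfolding lookup_sum by (rule sum.cong) (auto simp: lookup_single when_def)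
    thus "lookup \<alpha> j = lookup (\<Sum>i\<in>UNIV. single i (lookup \<alpha> i)) j"
      by simp
  qed
  have "M \<alpha> = (\<Prod>i\<in>UNIV. M (single i (lookup \<alpha> i)))"
    by (subst \<alpha>, subst s) auto
  also have "\<dots> = (\<Prod>i\<in>UNIV. M (single i 1) ^ lookup \<alpha> i)"
    by (rule prod.cong[OF refl], rule pw)
  finally show ?thesis by (simp only: monomial_at_def)
qed

definition msubst :: "('a::comm_ring_1 \<Rightarrow> 'b::comm_ring_1) \<Rightarrow> ('n::finite \<Rightarrow> 'b) \<Rightarrow> ('n, 'a) mpol \<Rightarrow> 'b"
  where "msubst c G = pm_eval c (monomial_at G)"

lemma msubst_morphism: "ring_morphism c \<Longrightarrow> ring_morphism (msubst c G)"
  unfolding msubst_def by (intro pm_eval_morphism) (auto simp: monomial_at_0 monomial_at_add)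

lemma msubst_const: "ring_morphism c \<Longrightarrow> msubst c G (mpol_const a) = c a"
  by (simp add: msubst_def mpol_const_def pm_eval_single monomial_at_0 ring_morphism.zero)

lemma msubst_mvar: "ring_morphism c \<Longrightarrow> msubst c G (mvar i) = G i"
  by (simp add: msubst_def mvar_def pm_eval_single monomial_at_single ring_morphism.zero ring_morphism.one)

lemma ring_morphism_eq_msubst:
  fixes h :: "('n::finite, 'a::comm_ring_1) mpol \<Rightarrow> 'b::comm_ring_1"
  assumes "ring_morphism h"
  shows "h p = msubst (\<lambda>a. h (mpol_const a)) (\<lambda>i. h (mvar i)) p"
proof -
  interpret ring_morphism h by fact
  have "h p = pm_eval (\<lambda>a. h (mpol_const a)) (\<lambda>k. h (single k 1)) p"
    unfolding mpol_const_def by (rule ring_morphism_eq_pm_eval) fact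
  also have "(\<lambda>k. h (single k 1)) = monomial_at (\<lambda>i. h (mvar i))"
    unfolding mvar_def
    by (rule ext, rule eq_monomial_at) (simp_all add: one mult[symmetric] mult_single)
  finally show ?thesis unfolding msubst_def .
qed

lemma mpol_const_morphism: "ring_morphism (mpol_const :: 'a::comm_ring_1 \<Rightarrow> ('n, 'a) mpol)"
  using ring_morphism_single0 unfolding mpol_const_def[abs_def] .

lemma laurent_const_morphism: "ring_morphism (laurent_const :: 'a::comm_ring_1 \<Rightarrow> 'a laurent)"
  using ring_morphism_single0 unfolding laurent_const_def[abs_def] .

lemma mpol_eval_eq: "mpol_eval x = msubst (\<lambda>a. a) (($) x)"
  by (rule ext) (simp add: mpol_eval_def msubst_def pm_eval_def monomial_at_def)

lemma mpol_eval_morphism: "ring_morphism (mpol_eval (x :: 'a::comm_ring_1 ^ 'n::finite))"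
  unfolding mpol_eval_eq by (rule msubst_morphism[OF ring_morphism_id])

lemma mpol_eval_const [simp]: "mpol_eval (x :: 'a::comm_ring_1 ^ 'n::finite) (mpol_const c) = c"
  unfolding mpol_eval_eq by (simp add: msubst_const ring_morphism_id)

lemma mpol_eval_mvar [simp]: "mpol_eval (x :: 'a::comm_ring_1 ^ 'n::finite) (mvar i) = x $ i"
  unfolding mpol_eval_eq by (simp add: msubst_mvar ring_morphism_id)

lemma leval_eq:
  "leval t x = pm_eval (mpol_eval x) (\<lambda>k. t powi k)"
  by (rule ext) (simp add: laurent_mpol_eval_def pm_eval_def)

lemma leval_morphism:
  "t \<noteq> 0 \<Longrightarrow> ring_morphism (leval (t::'a::field) (x :: 'a ^ 'n::finite))"
  unfolding leval_eq
  by (intro pm_eval_morphism mpol_eval_morphism) (auto simp: power_int_add)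

lemma leval_const [simp]:
  "leval (t::'a::field) (x :: 'a ^ 'n::finite) (laurent_const p) = mpol_eval x p"
  unfolding leval_eq laurent_const_def
  by (simp add: pm_eval_single ring_morphism.zero[OF mpol_eval_morphism])

lemma leval_var [simp]:
  "leval (t::'a::field) (x :: 'a ^ 'n::finite) (laurent_var_power k) = t powi k"
  unfolding leval_eq laurent_var_power_def
  by (simp add: pm_eval_single ring_morphism.zero[OF mpol_eval_morphism] ring_morphism.one[OF mpol_eval_morphism])

section \<open>Unique factorization in univariate polynomial rings\<close>

text \<open>
  The polynomials in some of the variables form a subring of the ring of all polynomials, not a
  type, and the induction on the number of variables needs unique factorization for each of these
  subrings. All notions are therefore relative to a subset \<open>S\<close>.
\<close>
definition dvd_in :: "'a::comm_ring_1 set \<Rightarrow> 'a \<Rightarrow> 'a \<Rightarrow> bool"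
  where "dvd_in S a b \<longleftrightarrow> (\<exists>c\<in>S. b = a * c)"

definition unit_in :: "'a::comm_ring_1 set \<Rightarrow> 'a \<Rightarrow> bool"
  where "unit_in S u \<longleftrightarrow> u \<in> S \<and> dvd_in S u 1"

definition prime_in :: "'a::comm_ring_1 set \<Rightarrow> 'a \<Rightarrow> bool"
  where "prime_in S p \<longleftrightarrow> p \<in> S \<and> p \<noteq> 0 \<and> \<not> unit_in S p \<and>
    (\<forall>a\<in>S. \<forall>b\<in>S. dvd_in S p (a * b) \<longrightarrow> dvd_in S p a \<or> dvd_in S p b)"

text \<open>
  The number of prime factors is recorded because removing a prime has to make an induction
  decrease.
\<close>
inductive prime_product :: "'a::comm_ring_1 set \<Rightarrow> nat \<Rightarrow> 'a \<Rightarrow> bool" for S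
  where unit: "unit_in S u \<Longrightarrow> prime_product S 0 u"
  | step: "prime_in S p \<Longrightarrow> prime_product S n a \<Longrightarrow> prime_product S (Suc n) (p * a)"

locale subdomain =
  fixes S :: "'a::comm_ring_1 set"
  assumes zero_in: "0 \<in> S" and one_in: "1 \<in> S"
    and add_in: "a \<in> S \<Longrightarrow> b \<in> S \<Longrightarrow> a + b \<in> S"
    and uminus_in: "a \<in> S \<Longrightarrow> - a \<in> S"
    and mult_in: "a \<in> S \<Longrightarrow> b \<in> S \<Longrightarrow> a * b \<in> S"
    and no_zero_divs: "a \<in> S \<Longrightarrow> b \<in> S \<Longrightarrow> a * b = 0 \<Longrightarrow> a = 0 \<or> b = 0"
begin

lemma diff_in: "a \<in> S \<Longrightarrow> b \<in> S \<Longrightarrow> a - b \<in> S"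
  using add_in[OF _ uminus_in, of a b] by simp

lemma sum_in: "(\<And>i. i \<in> I \<Longrightarrow> F i \<in> S) \<Longrightarrow> (\<Sum>i\<in>I. F i) \<in> S"
  by (induction I rule: infinite_finite_induct) (auto simp: zero_in add_in)

lemma cancel: "a \<in> S \<Longrightarrow> b \<in> S \<Longrightarrow> c \<in> S \<Longrightarrow> c \<noteq> 0 \<Longrightarrow> c * a = c * b \<Longrightarrow> a = b"
  using no_zero_divs[of c "a - b"] diff_in[of a b] by (auto simp: algebra_simps)

lemma unit_in_mult: "unit_in S u \<Longrightarrow> unit_in S v \<Longrightarrow> unit_in S (u * v)"
proof -
  assume "unit_in S u" "unit_in S v"
  then obtain a b where "u \<in> S" "v \<in> S" "a \<in> S" "b \<in> S" "1 = u * a" "1 = v * b"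
    unfolding unit_in_def dvd_in_def by blast
  moreover from this have "1 = (u * v) * (a * b)"
    by (metis mult.assoc mult.left_commute mult.right_neutral)
  ultimately show ?thesis unfolding unit_in_def dvd_in_def using mult_in by blast
qed

lemma prime_product_in: "prime_product S n a \<Longrightarrow> a \<in> S"
  by (induction rule: prime_product.induct) (auto simp: unit_in_def prime_in_def mult_in)

lemma prime_product_unit_mult:
  "prime_product S n a \<Longrightarrow> unit_in S u \<Longrightarrow> prime_product S n (u * a)"
proof (induction rule: prime_product.induct)
  case (unit v)
  then show ?case by (simp add: prime_product.unit unit_in_mult)
next
  case (step p n a)
  then show ?case using prime_product.step[of S p n "u * a"] by (simp add: mult_ac)
qed

lemma prime_product_mult:
  "prime_product S n a \<Longrightarrow> prime_product S k b \<Longrightarrow> \<exists>j. prime_product S j (a * b)"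
proof (induction rule: prime_product.induct)
  case (unit v)
  then show ?case using prime_product_unit_mult by blast
next
  case (step p n a)
  then obtain j where "prime_product S j (a * b)" by blast
  then show ?case using prime_product.step[of S p j "a * b"] step.hyps by (auto simp: mult_ac)
qed

text \<open>
  Prime factorizations are unique as far as their length is concerned: a prime divisor is
  associated to one of the listed primes, and cancelling it shortens the list by one.
\<close>
lemma prime_product_remove_prime:
  assumes "prime_product S n a" "prime_in S q" "b \<in> S" "a = q * b"
  shows "\<exists>k. n = Suc k \<and> prime_product S k b"
  using assms
proof (induction arbitrary: b rule: prime_product.induct)
  case (unit u)
  then obtain c where c: "c \<in> S" "1 = u * c" by (auto simp: unit_in_def dvd_in_def)
  with unit have "1 = q * (b * c)" by (simp add: mult_ac)
  moreover have "q \<in> S" using unit by (auto simp: prime_in_def)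
  ultimately have "unit_in S q" using c unit mult_in by (auto simp: unit_in_def dvd_in_def)
  with unit show ?case by (auto simp: prime_in_def)
next
  case (step p n a)
  have pq: "p \<in> S" "q \<in> S" "p \<noteq> 0" "q \<noteq> 0"
    using step.hyps(1) step.prems(1) by (auto simp: prime_in_def)
  have aS: "a \<in> S" using step.hyps(2) prime_product_in by blast
  have "dvd_in S q (p * a)" using step.prems(2,3) by (auto simp: dvd_in_def)
  then consider "dvd_in S q a" | "dvd_in S q p"
    using step.prems(1) pq aS unfolding prime_in_def by blast
  then show ?case
  proof cases
    case 1
    then obtain a' where a': "a' \<in> S" "a = q * a'" by (auto simp: dvd_in_def)
    with step.IH[of a'] step.prems obtain k where k: "n = Suc k" "prime_product S k a'" by blast
    have "q * b = q * (p * a')" using step.prems a' by (simp add: mult_ac)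
    then have "b = p * a'" using cancel[of b "p * a'" q] pq a' step.prems mult_in by blast
    then show ?thesis using k step.hyps prime_product.step by blast
  next
    case 2
    then obtain w where w: "w \<in> S" "p = q * w" by (auto simp: dvd_in_def)
    then have "dvd_in S p (q * w)" by (metis dvd_in_def mult.right_neutral one_in)
    then consider "dvd_in S p q" | "dvd_in S p w" using step.hyps pq w unfolding prime_in_def by blast
    then have "dvd_in S w 1"
    proof cases
      case 1
      then obtain z where z: "z \<in> S" "q = p * z" by (auto simp: dvd_in_def)
      have "q * 1 = q * (w * z)" using z w by (simp add: mult_ac)
      then have "1 = w * z" using cancel[of 1 "w * z" q] pq z w one_in mult_in by blast
      then show ?thesis using z by (auto simp: dvd_in_def)
    next
      case 2
      then obtain z where z: "z \<in> S" "w = p * z" by (auto simp: dvd_in_def)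
      have "p * 1 = p * (q * z)" using z w by (simp add: mult_ac)
      then have "1 = q * z" using cancel[of 1 "q * z" p] pq z w one_in mult_in by blast
      then have "unit_in S q" using z pq by (auto simp: dvd_in_def unit_in_def)
      then show ?thesis using step.prems by (auto simp: prime_in_def)
    qed
    then have "unit_in S w" using w by (simp add: unit_in_def)
    moreover have "q * b = q * (w * a)" using step.prems w by (simp add: mult_ac)
    then have "b = w * a" using cancel[of b "w * a" q] pq w aS step.prems mult_in by blast
    ultimately show ?thesis using step.hyps prime_product_unit_mult by blast
  qed
qed

end

locale factorial_subdomain = subdomain +
  assumes factorization: "a \<in> S \<Longrightarrow> a \<noteq> 0 \<Longrightarrow> \<exists>n. prime_product S n a"

definition polys_over :: "'a::comm_ring_1 set \<Rightarrow> 'a poly set"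
  where "polys_over S = {p. \<forall>n. coeff p n \<in> S}"

context subdomain
begin

lemma degree_mult_polys_over:
  assumes "p \<in> polys_over S" "q \<in> polys_over S" "p \<noteq> 0" "q \<noteq> 0"
  shows "degree (p * q) = degree p + degree q" "p * q \<noteq> 0"
    "lead_coeff (p * q) = lead_coeff p * lead_coeff q"
proof -
  have "coeff (p * q) (degree p + degree q) = lead_coeff p * lead_coeff q"
    by (rule coeff_mult_degree_sum)
  moreover have "lead_coeff p * lead_coeff q \<noteq> 0"
    using assms no_zero_divs[of "lead_coeff p" "lead_coeff q"] by (auto simp: polys_over_def)
  ultimately have nz: "coeff (p * q) (degree p + degree q) \<noteq> 0" by simp
  show d: "degree (p * q) = degree p + degree q"
    by (intro antisym degree_mult_le le_degree nz)
  show "p * q \<noteq> 0" using nz by auto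
  show "lead_coeff (p * q) = lead_coeff p * lead_coeff q" unfolding d by (rule coeff_mult_degree_sum)
qed

lemma polys_over_subdomain: "subdomain (polys_over S)"
proof
  show "a * b \<in> polys_over S" if "a \<in> polys_over S" "b \<in> polys_over S" for a b
    using that by (auto simp: polys_over_def coeff_mult intro!: sum_in mult_in)
  show "a = 0 \<or> b = 0" if "a \<in> polys_over S" "b \<in> polys_over S" "a * b = 0" for a b
    using degree_mult_polys_over[of a b] that by auto
  show "1 \<in> polys_over S" by (auto simp: polys_over_def coeff_1 zero_in one_in)
qed (auto simp: polys_over_def zero_in add_in uminus_in)

interpretation P: subdomain "polys_over S"
  by (rule polys_over_subdomain)

lemma const_in_polys_over [simp]: "[:c:] \<in> polys_over S \<longleftrightarrow> c \<in> S"
  by (auto simp: polys_over_def coeff_pCons zero_in split: nat.splits)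

lemma monom_in_polys_over: "c \<in> S \<Longrightarrow> monom c n \<in> polys_over S"
  by (auto simp: polys_over_def zero_in)

lemma lead_coeff_in: "p \<in> polys_over S \<Longrightarrow> lead_coeff p \<in> S"
  by (simp add: polys_over_def)

lemma const_dvd_in_polys_over:
  "c \<in> S \<Longrightarrow> dvd_in (polys_over S) [:c:] g \<longleftrightarrow> (\<forall>n. dvd_in S c (coeff g n))"
proof
  assume "dvd_in (polys_over S) [:c:] g"
  then show "\<forall>n. dvd_in S c (coeff g n)" by (auto simp: dvd_in_def polys_over_def)
next
  assume c: "c \<in> S" and "\<forall>n. dvd_in S c (coeff g n)"
  then obtain d where d: "\<And>n. d n \<in> S" "\<And>n. coeff g n = c * d n"
    unfolding dvd_in_def by metis
  define e where "e = Abs_poly (\<lambda>n. if coeff g n = 0 then 0 else d n)"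
  have e: "coeff e n = (if coeff g n = 0 then 0 else d n)" for n
    unfolding e_def by (subst coeff_Abs_poly[of "degree g"]) (auto simp: coeff_eq_0)
  have "coeff g n = coeff ([:c:] * e) n" for n
    using d(2)[of n] by (cases "coeff g n = 0") (simp_all add: e)
  hence "g = [:c:] * e" by (rule poly_eqI)
  moreover have "e \<in> polys_over S" unfolding polys_over_def mem_Collect_eq e using d(1) zero_in by simp
  ultimately show "dvd_in (polys_over S) [:c:] g" by (auto simp: dvd_in_def)
qed

lemma unit_in_polys_over_const: "unit_in S u \<Longrightarrow> unit_in (polys_over S) [:u:]"
proof -
  assume "unit_in S u"
  then obtain v where "u \<in> S" "v \<in> S" "1 = u * v" by (auto simp: unit_in_def dvd_in_def)
  then show ?thesis unfolding unit_in_def dvd_in_def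
    by (auto intro!: bexI[of _ "[:v:]"])
qed

lemma dvd_in_add: "dvd_in S c a \<Longrightarrow> dvd_in S c b \<Longrightarrow> dvd_in S c (a + b)"
  unfolding dvd_in_def by (metis add_in distrib_left)

lemma dvd_in_uminus: "dvd_in S c a \<Longrightarrow> dvd_in S c (- a)"
  unfolding dvd_in_def by (metis uminus_in mult_minus_right)

lemma dvd_in_sum: "(\<And>i. i \<in> I \<Longrightarrow> dvd_in S c (F i)) \<Longrightarrow> dvd_in S c (\<Sum>i\<in>I. F i)"
proof (induction I rule: infinite_finite_induct)
  case (insert i I) then show ?case by (auto intro: dvd_in_add)
qed (auto simp: dvd_in_def zero_in intro!: bexI[of _ 0])

lemma dvd_in_mult_right: "dvd_in S c a \<Longrightarrow> b \<in> S \<Longrightarrow> dvd_in S c (a * b)"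
  unfolding dvd_in_def by (metis mult_in mult.assoc)

lemma dvd_in_mult_left: "dvd_in S c a \<Longrightarrow> b \<in> S \<Longrightarrow> dvd_in S c (b * a)"
  using dvd_in_mult_right by (metis mult.commute)

text \<open>
  Gauss's lemma. If a prime \<open>p\<close> divides neither \<open>g\<close> nor \<open>h\<close>, take in each the
  first coefficient that it does not divide; of the products that make up the corresponding coefficient
  of \<open>g h\<close>, all but one are divisible by \<open>p\<close>.
\<close>
lemma prime_in_polys_over_const:
  assumes p: "prime_in S p"
  shows "prime_in (polys_over S) [:p:]"
proof -
  have pS: "p \<in> S" "p \<noteq> 0" using p by (auto simp: prime_in_def)
  have nu: "\<not> unit_in (polys_over S) [:p:]"
  proof
    assume "unit_in (polys_over S) [:p:]"
    hence "dvd_in S p (coeff 1 0)" using const_dvd_in_polys_over[OF pS(1), of 1] unfolding unit_in_def by blast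
    hence "unit_in S p" using pS by (simp add: unit_in_def)
    thus False using p by (simp add: prime_in_def)
  qed
  have pr: "dvd_in (polys_over S) [:p:] g \<or> dvd_in (polys_over S) [:p:] h"
    if gh: "g \<in> polys_over S" "h \<in> polys_over S" "dvd_in (polys_over S) [:p:] (g * h)" for g h
  proof (rule ccontr)
    assume "\<not> ?thesis"
    then have ex: "\<exists>i. \<not> dvd_in S p (coeff g i)" "\<exists>j. \<not> dvd_in S p (coeff h j)"
      using const_dvd_in_polys_over[OF pS(1)] by auto
    define i where "i = (LEAST i. \<not> dvd_in S p (coeff g i))"
    define j where "j = (LEAST j. \<not> dvd_in S p (coeff h j))"
    have i: "\<not> dvd_in S p (coeff g i)" unfolding i_def using ex(1) by (rule LeastI_ex)
    have j: "\<not> dvd_in S p (coeff h j)" unfolding j_def using ex(2) by (rule LeastI_ex)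
    have i': "dvd_in S p (coeff g k)" if "k < i" for k using not_less_Least that unfolding i_def by blast
    have j': "dvd_in S p (coeff h k)" if "k < j" for k using not_less_Least that unfolding j_def by blast
    have cS: "coeff g k \<in> S" "coeff h k \<in> S" for k using gh by (auto simp: polys_over_def)
    have "coeff (g * h) (i + j) = (\<Sum>k\<le>i + j. coeff g k * coeff h (i + j - k))" by (rule coeff_mult)
    also have "\<dots> = coeff g i * coeff h j + (\<Sum>k\<in>{..i + j} - {i}. coeff g k * coeff h (i + j - k))"
      by (subst sum.remove[of _ i]) auto
    finally have eq: "coeff g i * coeff h j =
      coeff (g * h) (i + j) + - (\<Sum>k\<in>{..i + j} - {i}. coeff g k * coeff h (i + j - k))" by simp
    have "dvd_in S p (\<Sum>k\<in>{..i + j} - {i}. coeff g k * coeff h (i + j - k))"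
    proof (rule dvd_in_sum)
      fix k assume k: "k \<in> {..i + j} - {i}"
      show "dvd_in S p (coeff g k * coeff h (i + j - k))"
      proof (cases "k < i")
        case True thus ?thesis using i' cS dvd_in_mult_right by blast
      next
        case False
        hence "i + j - k < j" using k by auto
        thus ?thesis using j' cS dvd_in_mult_left by blast
      qed
    qed
    moreover have "dvd_in S p (coeff (g * h) (i + j))"
      using gh(3) const_dvd_in_polys_over[OF pS(1)] by blast
    ultimately have "dvd_in S p (coeff g i * coeff h j)"
      unfolding eq by (intro dvd_in_add dvd_in_uminus)
    thus False using p i j cS unfolding prime_in_def by blast
  qed
  show ?thesis unfolding prime_in_def using nu pr pS by auto
qed

text \<open>
  Division with remainder over the fraction field, with the denominators cleared.
\<close>
lemma pseudo_division:
  assumes "r \<in> polys_over S" "r \<noteq> 0" "g \<in> polys_over S"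
  shows "\<exists>c\<in>S. \<exists>q\<in>polys_over S. c \<noteq> 0 \<and> ([:c:] * g - q * r = 0 \<or> degree ([:c:] * g - q * r) < degree r)"
  using assms(3)
proof (induction "degree g" arbitrary: g rule: less_induct)
  case less
  note r = assms(1,2)
  show ?case
  proof (cases "g = 0 \<or> degree g < degree r")
    case True
    thus ?thesis by (intro bexI[of _ 1] bexI[of _ 0]) (auto simp: one_in zero_in polys_over_def one_pCons[symmetric])
  next
    case False
    define k where "k = degree g - degree r"
    define a where "a = lead_coeff r"
    have a: "a \<in> S" "a \<noteq> 0" using r lead_coeff_in by (auto simp: a_def)
    define M where "M = monom (lead_coeff g) k"
    have M: "M \<in> polys_over S" using less.prems lead_coeff_in monom_in_polys_over by (auto simp: M_def)
    define g' where "g' = [:a:] * g - M * r"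
    have g'S: "g' \<in> polys_over S" unfolding g'_def
      using a M r less.prems by (intro P.diff_in P.mult_in) auto
    have "degree g' \<le> degree g"
      unfolding g'_def
    proof (rule degree_diff_le)
      show "degree ([:a:] * g) \<le> degree g" by (simp add: degree_smult_le)
      have "degree (M * r) \<le> k + degree r"
        using degree_mult_le[of M r] degree_monom_le[of "lead_coeff g" k] by (simp add: M_def)
      thus "degree (M * r) \<le> degree g" using False by (simp add: k_def)
    qed
    moreover have "coeff g' (degree g) = 0"
    proof -
      have "coeff (M * r) (degree g) = lead_coeff g * coeff r (degree g - k)"
        using False by (simp add: M_def coeff_monom_mult k_def)
      also have "degree g - k = degree r" using False by (simp add: k_def)
      finally show ?thesis by (simp add: g'_def a_def)
    qed
    ultimately have d: "g' = 0 \<or> degree g' < degree g" using eq_zero_or_degree_less by blast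
    show ?thesis
    proof (cases "g' = 0")
      case True
      thus ?thesis using a M unfolding g'_def by blast
    next
      case False
      with d less.hyps[of g'] g'S obtain c q where cq: "c \<in> S" "q \<in> polys_over S" "c \<noteq> 0"
        "[:c:] * g' - q * r = 0 \<or> degree ([:c:] * g' - q * r) < degree r" by blast
      have eq: "[:c:] * g' - q * r = [:c * a:] * g - ([:c:] * M + q) * r"
        by (simp add: g'_def algebra_simps smult_diff_right)
      have "c * a \<noteq> 0" using cq a no_zero_divs by blast
      moreover have "c * a \<in> S" using cq a mult_in by blast
      moreover have "[:c:] * M + q \<in> polys_over S" using cq M by (intro P.add_in P.mult_in) auto
      ultimately show ?thesis using cq(4) unfolding eq by blast
    qed
  qed
qed

end

context factorial_subdomain
begin

interpretation P: subdomain "polys_over S"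
  by (rule polys_over_subdomain)

abbreviation primitive :: "'a poly \<Rightarrow> bool"
  where "primitive f \<equiv> (\<forall>p. prime_in S p \<longrightarrow> \<not> dvd_in (polys_over S) [:p:] f)"

text \<open>
  The primes of a constant \<open>e\<close> stay prime in the polynomial ring and do not divide the
  primitive polynomial \<open>f\<close>, so they can be cancelled one after the other from \<open>e h = f w\<close>.
\<close>
lemma primitive_dvd_const_mult:
  assumes f: "f \<in> polys_over S" "primitive f" and "h \<in> polys_over S" "e \<in> S" "e \<noteq> 0"
    and "dvd_in (polys_over S) f ([:e:] * h)"
  shows "dvd_in (polys_over S) f h"
proof -
  obtain n where "prime_product S n e" using factorization assms by blast
  thus ?thesis using assms(6)
  proof (induction rule: prime_product.induct)
    case (unit u)
    then obtain v w where v: "v \<in> S" "1 = u * v" and w: "w \<in> polys_over S" "[:u:] * h = f * w"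
      by (auto simp: unit_in_def dvd_in_def)
    have "h = [:u * v:] * h" using v by simp
    also have "\<dots> = [:v:] * ([:u:] * h)" by (simp add: mult.commute)
    also have "\<dots> = f * ([:v:] * w)" unfolding w by (simp add: mult_ac)
    finally show ?case using v w unfolding dvd_in_def by (metis P.mult_in const_in_polys_over)
  next
    case (step p n a)
    have pS: "p \<in> S" "p \<noteq> 0" using step by (auto simp: prime_in_def)
    have a: "a \<in> S" using step prime_product_in by blast
    from step.prems obtain w where w: "w \<in> polys_over S" "[:p * a:] * h = f * w"
      by (auto simp: dvd_in_def)
    have "f * w = [:p:] * ([:a:] * h)" using w(2) by (simp add: mult.commute)
    hence "dvd_in (polys_over S) [:p:] (f * w)"
      unfolding dvd_in_def using a assms(3) P.mult_in const_in_polys_over by blast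
    hence "dvd_in (polys_over S) [:p:] w"
      using prime_in_polys_over_const[OF step.hyps(1)] f w(1) step.hyps(1) unfolding prime_in_def by blast
    then obtain w' where w': "w' \<in> polys_over S" "w = [:p:] * w'" by (auto simp: dvd_in_def)
    have "[:p:] * ([:a:] * h) = [:p:] * (f * w')" using w w' by (simp add: mult_ac)
    hence "[:a:] * h = f * w'"
      using P.cancel[of "[:a:] * h" "f * w'" "[:p:]"] pS a w' f assms(3) P.mult_in const_in_polys_over
      by (metis pCons_eq_0_iff)
    thus ?case using step.IH w' by (auto simp: dvd_in_def)
  qed
qed

text \<open>
  Each prime factor of the constant divides one of the two factors on the right, from which it can
  be cancelled. So a factorization of \<open>f\<close> up to a constant comes from a factorization of \<open>f\<close>.
\<close>
lemma cancel_const_in_product: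
  assumes "c \<in> S" "c \<noteq> 0" "f \<in> polys_over S" "q \<in> polys_over S" "r \<in> polys_over S" "[:c:] * f = q * r"
  shows "\<exists>e\<in>S. \<exists>e'\<in>S. \<exists>q'\<in>polys_over S. \<exists>r'\<in>polys_over S.
    e \<noteq> 0 \<and> e' \<noteq> 0 \<and> q = [:e:] * q' \<and> r = [:e':] * r' \<and> f = q' * r'"
proof -
  obtain n where "prime_product S n c" using factorization assms by blast
  thus ?thesis using assms(4-)
  proof (induction arbitrary: q r rule: prime_product.induct)
    case (unit u)
    then obtain v where v: "v \<in> S" "1 = u * v" "u \<in> S" by (auto simp: unit_in_def dvd_in_def)
    have nz: "u \<noteq> 0" using v by auto
    have "f = [:u * v:] * f" using v by simp
    also have "\<dots> = [:v:] * ([:u:] * f)" by (simp add: mult.commute)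
    also have "\<dots> = ([:v:] * q) * r" unfolding unit by (simp add: mult_ac)
    finally have "f = ([:v:] * q) * r" .
    moreover have "q = [:u:] * ([:v:] * q)" using v by (simp add: mult_ac)
    moreover have "[:v:] * q \<in> polys_over S" using v unit by (intro P.mult_in) auto
    moreover have "r = [:1:] * r" by simp
    ultimately show ?case using v unit nz one_in by (metis zero_neq_one)
  next
    case (step p n a)
    have pS: "p \<in> S" "p \<noteq> 0" using step by (auto simp: prime_in_def)
    have a: "a \<in> S" using step prime_product_in by blast
    have e: "q * r = [:p:] * ([:a:] * f)" using step.prems by (simp add: mult.commute)
    hence "dvd_in (polys_over S) [:p:] (q * r)"
      unfolding dvd_in_def using a assms(3) P.mult_in const_in_polys_over by blast
    then consider "dvd_in (polys_over S) [:p:] q" | "dvd_in (polys_over S) [:p:] r"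
      using prime_in_polys_over_const[OF step.hyps(1)] step.prems unfolding prime_in_def by blast
    then show ?case
    proof cases
      case 1
      then obtain w where w: "w \<in> polys_over S" "q = [:p:] * w" by (auto simp: dvd_in_def)
      have "[:p:] * ([:a:] * f) = [:p:] * (w * r)" using e w by (simp only: mult_ac)
      hence "[:a:] * f = w * r"
        using P.cancel[of "[:a:] * f" "w * r" "[:p:]"] pS a w assms(3) step.prems P.mult_in const_in_polys_over
        by (metis pCons_eq_0_iff)
      from step.IH[OF w(1) step.prems(2) this] obtain d d' q' r' where
        *: "d \<in> S" "d' \<in> S" "q' \<in> polys_over S" "r' \<in> polys_over S" "d \<noteq> 0" "d' \<noteq> 0"
        "w = [:d:] * q'" "r = [:d':] * r'" "f = q' * r'" by blast
      have "q = [:p * d:] * q'" using w * by (simp add: mult_ac)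
      moreover have "p * d \<in> S" "p * d \<noteq> 0" using pS * mult_in no_zero_divs by blast+
      ultimately show ?thesis using * by blast
    next
      case 2
      then obtain w where w: "w \<in> polys_over S" "r = [:p:] * w" by (auto simp: dvd_in_def)
      have "[:p:] * ([:a:] * f) = [:p:] * (q * w)" using e w by (simp only: mult_ac)
      hence "[:a:] * f = q * w"
        using P.cancel[of "[:a:] * f" "q * w" "[:p:]"] pS a w assms(3) step.prems P.mult_in const_in_polys_over
        by (metis pCons_eq_0_iff)
      from step.IH[OF step.prems(1) w(1) this] obtain d d' q' r' where
        *: "d \<in> S" "d' \<in> S" "q' \<in> polys_over S" "r' \<in> polys_over S" "d \<noteq> 0" "d' \<noteq> 0"
        "q = [:d:] * q'" "w = [:d':] * r'" "f = q' * r'" by blast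
      have "r = [:p * d':] * r'" using w * by (simp add: mult_ac)
      moreover have "p * d' \<in> S" "p * d' \<noteq> 0" using pS * mult_in no_zero_divs by blast+
      ultimately show ?thesis using * by blast
    qed
  qed
qed

lemma degree_0_const: "p \<in> polys_over S \<Longrightarrow> degree p = 0 \<Longrightarrow> \<exists>c\<in>S. p = [:c:]"
  by (metis degree_0_id const_in_polys_over)

text \<open>
  Let \<open>f\<close> divide \<open>g h\<close>. Over the fraction field the ideal of \<open>f\<close> and \<open>g\<close> is
  generated by its element \<open>r\<close> of least degree; up to constants, \<open>r\<close> divides \<open>f\<close> and
  \<open>g\<close>. As \<open>f\<close> has no proper factorization, \<open>r\<close> is up to constants either \<open>1\<close>, and then
  \<open>f\<close> divides a constant multiple of \<open>h\<close>, or \<open>f\<close>, and then \<open>f\<close> divides a constant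
  multiple of \<open>g\<close>. The constants are removed by the lemma on primitive polynomials.
\<close>
lemma primitive_irreducible_prime:
  assumes f: "f \<in> polys_over S" "primitive f" and deg: "degree f \<ge> 1"
    and irr: "\<And>a b. a \<in> polys_over S \<Longrightarrow> b \<in> polys_over S \<Longrightarrow> f = a * b \<Longrightarrow> degree a = 0 \<or> degree b = 0"
  shows "prime_in (polys_over S) f"
proof -
  have f0: "f \<noteq> 0" using deg by auto
  have nu: "\<not> unit_in (polys_over S) f"
  proof
    assume "unit_in (polys_over S) f"
    then obtain v where v: "v \<in> polys_over S" "1 = f * v" by (auto simp: unit_in_def dvd_in_def)
    hence "v \<noteq> 0" by auto
    with degree_mult_polys_over(1)[OF f(1) v(1) f0] v deg have "degree (1::'a poly) \<ge> 1" by simp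
    thus False by simp
  qed
  have pr: "dvd_in (polys_over S) f g \<or> dvd_in (polys_over S) f h"
    if gh: "g \<in> polys_over S" "h \<in> polys_over S" "dvd_in (polys_over S) f (g * h)" for g h
  proof -
    obtain fh where fh: "fh \<in> polys_over S" "g * h = f * fh" using gh by (auto simp: dvd_in_def)
    define J where "J = {a * f + b * g | a b. a \<in> polys_over S \<and> b \<in> polys_over S}"
    have J_diff: "u * y - q * z \<in> J" if "y \<in> J" "z \<in> J" "q \<in> polys_over S" "u \<in> polys_over S" for u y z q
    proof -
      obtain a b a' b' where "a \<in> polys_over S" "b \<in> polys_over S" "a' \<in> polys_over S" "b' \<in> polys_over S"
        "y = a * f + b * g" "z = a' * f + b' * g" using \<open>y \<in> J\<close> \<open>z \<in> J\<close> by (auto simp: J_def)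
      moreover from this have "u * y - q * z = (u * a - q * a') * f + (u * b - q * b') * g"
        by (simp add: algebra_simps)
      moreover have "u * a - q * a' \<in> polys_over S" "u * b - q * b' \<in> polys_over S"
        using calculation that by (auto intro!: P.diff_in P.mult_in)
      ultimately show ?thesis unfolding J_def by blast
    qed
    have JS: "J \<subseteq> polys_over S" using f gh by (auto simp: J_def intro!: P.add_in P.mult_in)
    have "f = 1 * f + 0 * g" "g = 0 * f + 1 * g" by simp_all
    hence fJ: "f \<in> J" and gJ: "g \<in> J" unfolding J_def using P.one_in P.zero_in by blast+
    \<comment> \<open>The element of least degree is a greatest common divisor of \<open>f\<close> and \<open>g\<close> over the fraction field.\<close>
    obtain r where r: "r \<in> J" "r \<noteq> 0" and rmin: "\<And>y. y \<in> J \<Longrightarrow> y \<noteq> 0 \<Longrightarrow> degree r \<le> degree y"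
      using ex_has_least_nat[of "\<lambda>y. y \<in> J \<and> y \<noteq> 0" f degree] fJ f0 by blast
    have rS: "r \<in> polys_over S" using r JS by blast
    have mult: "\<exists>c\<in>S. \<exists>q\<in>polys_over S. c \<noteq> 0 \<and> [:c:] * y = q * r" if yJ: "y \<in> J" for y
    proof -
      obtain c q where cq: "c \<in> S" "q \<in> polys_over S" "c \<noteq> 0"
        "[:c:] * y - q * r = 0 \<or> degree ([:c:] * y - q * r) < degree r"
        using pseudo_division[OF rS r(2) subsetD[OF JS yJ]] by (elim bexE conjE) (rule that)
      have "[:c:] * y - q * r \<in> J" using J_diff[OF yJ r(1) cq(2), of "[:c:]"] cq(1) by simp
      hence "[:c:] * y - q * r = 0" using cq(4) rmin leD by blast
      thus ?thesis using cq by (auto)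
    qed
    obtain c q where cq: "c \<in> S" "q \<in> polys_over S" "c \<noteq> 0" "[:c:] * f = q * r" using mult[OF fJ] by blast
    obtain c2 q2 where cq2: "c2 \<in> S" "q2 \<in> polys_over S" "c2 \<noteq> 0" "[:c2:] * g = q2 * r" using mult[OF gJ] by blast
    from cancel_const_in_product[OF cq(1,3) f(1) cq(2) rS cq(4)] obtain e e' q' r' where
      *: "e \<in> S" "e' \<in> S" "q' \<in> polys_over S" "r' \<in> polys_over S" "e \<noteq> 0" "e' \<noteq> 0"
        "q = [:e:] * q'" "r = [:e':] * r'" "f = q' * r'" by blast
    from irr[OF *(3,4,9)] show ?thesis
    proof
      \<comment> \<open>Here the greatest common divisor is a constant.\<close>
      assume "degree r' = 0"
      then obtain \<rho> where \<rho>: "\<rho> \<in> S" "r' = [:\<rho>:]" using degree_0_const * by blast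
      have r\<rho>: "r = [:e' * \<rho>:]" using * \<rho> by simp
      obtain a b where ab: "a \<in> polys_over S" "b \<in> polys_over S" "r = a * f + b * g"
        using r by (auto simp: J_def)
      have "[:e' * \<rho>:] * h = (a * f + b * g) * h" using r\<rho> ab by simp
      also have "\<dots> = a * f * h + b * (g * h)" by (simp add: algebra_simps)
      also have "\<dots> = f * (a * h + b * fh)" unfolding fh by (simp add: algebra_simps)
      finally have "dvd_in (polys_over S) f ([:e' * \<rho>:] * h)"
        unfolding dvd_in_def using ab gh fh by (auto intro!: bexI[of _ "a * h + b * fh"] P.add_in P.mult_in)
      moreover have "e' * \<rho> \<in> S" "e' * \<rho> \<noteq> 0" using * \<rho> mult_in r\<rho> r by auto
      ultimately show ?thesis using primitive_dvd_const_mult[OF f gh(2)] by blast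
    next
      \<comment> \<open>Here the greatest common divisor is \<open>f\<close> up to a constant.\<close>
      assume "degree q' = 0"
      then obtain \<kappa> where \<kappa>: "\<kappa> \<in> S" "q' = [:\<kappa>:]" using degree_0_const * by blast
      have "\<kappa> \<noteq> 0" using \<kappa> * f0 by auto
      have "[:\<kappa> * c2:] * g = [:\<kappa>:] * ([:c2:] * g)" by (simp add: mult.commute)
      also have "\<dots> = f * ([:e':] * q2)" unfolding cq2 * \<kappa> by (simp add: mult_ac)
      finally have "dvd_in (polys_over S) f ([:\<kappa> * c2:] * g)"
        unfolding dvd_in_def using * cq2 by (metis P.mult_in const_in_polys_over)
      moreover have "\<kappa> * c2 \<in> S" "\<kappa> * c2 \<noteq> 0" using \<kappa> cq2 mult_in no_zero_divs \<open>\<kappa> \<noteq> 0\<close> by blast+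
      ultimately show ?thesis using primitive_dvd_const_mult[OF f gh(1)] by blast
    qed
  qed
  show ?thesis unfolding prime_in_def using f f0 nu pr by blast
qed

lemma prime_product_polys_over_const:
  "prime_product S n a \<Longrightarrow> prime_product (polys_over S) n [:a:]"
proof (induction rule: prime_product.induct)
  case (unit u)
  then show ?case by (simp add: prime_product.unit unit_in_polys_over_const)
next
  case (step p n a)
  then show ?case
    using prime_product.step[of "polys_over S" "[:p:]" n "[:a:]"] prime_in_polys_over_const
    by (simp add: mult.commute)
qed

text \<open>
  A polynomial of positive degree is either primitive, and then splits into polynomials of smaller
  degree or is prime, or a prime constant can be split off. The latter ends after finitely many
  steps because the leading coefficient loses a prime factor each time.
\<close>
lemma factorization_polys_over:
  "g \<in> polys_over S \<Longrightarrow> g \<noteq> 0 \<Longrightarrow> \<exists>n. prime_product (polys_over S) n g"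
proof (induction "degree g" arbitrary: g rule: less_induct)
  case less
  show ?case
  proof (cases "degree g = 0")
    case True
    then obtain c where "c \<in> S" "g = [:c:]" using degree_0_const less by blast
    thus ?thesis using factorization prime_product_polys_over_const less.prems by fastforce
  next
    case False
    have "\<exists>n. prime_product (polys_over S) n h"
      if "prime_product S k (lead_coeff h)" "h \<in> polys_over S" "degree h = degree g" for k h
      using that
    proof (induction k arbitrary: h rule: less_induct)
      case (less k)
      have h0: "h \<noteq> 0" using less.prems False by auto
      show ?case
      proof (cases "primitive h")
        case False
        then obtain p where p: "prime_in S p" "dvd_in (polys_over S) [:p:] h" by blast
        then obtain h' where h': "h' \<in> polys_over S" "h = [:p:] * h'" by (auto simp: dvd_in_def)
        have pS: "p \<in> S" "p \<noteq> 0" using p by (auto simp: prime_in_def)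
        have h'0: "h' \<noteq> 0" using h' h0 by auto
        have p0: "[:p:] \<in> polys_over S" "[:p:] \<noteq> 0" using pS by auto
        have "lead_coeff h = p * lead_coeff h'" "degree h' = degree g"
          using degree_mult_polys_over[OF p0(1) h'(1) p0(2) h'0] less.prems h' by simp_all
        with prime_product_remove_prime[OF less.prems(1) p(1) lead_coeff_in[OF h'(1)]]
        obtain j where "k = Suc j" "prime_product S j (lead_coeff h')" "degree h' = degree g" by blast
        with less.IH[of j h'] h' obtain n where "prime_product (polys_over S) n h'" by auto
        thus ?thesis using prime_product.step[OF prime_in_polys_over_const[OF p(1)]] h' by blast
      next
        case True
        show ?thesis
        proof (cases "\<forall>a\<in>polys_over S. \<forall>b\<in>polys_over S. h = a * b \<longrightarrow> degree a = 0 \<or> degree b = 0")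
          case irr: True
          have "prime_in (polys_over S) h"
            using primitive_irreducible_prime[OF less.prems(2) True] less.prems \<open>degree g \<noteq> 0\<close> irr
            by auto
          hence "prime_product (polys_over S) 1 (h * 1)"
            using prime_product.step[of "polys_over S" h 0 1] prime_product.unit[of "polys_over S" 1]
            by (simp add: unit_in_def dvd_in_def P.one_in)
          thus ?thesis by auto
        next
          case red: False
          then obtain a b where ab: "a \<in> polys_over S" "b \<in> polys_over S" "h = a * b"
            "degree a \<noteq> 0" "degree b \<noteq> 0" by blast
          have nz: "a \<noteq> 0" "b \<noteq> 0" using ab h0 by auto
          have "degree h = degree a + degree b" using degree_mult_polys_over(1)[OF ab(1,2) nz] ab by simp
          hence "degree a < degree g" "degree b < degree g" using ab less.prems by auto
          thus ?thesis using \<open>\<And>g'. degree g' < degree g \<Longrightarrow> g' \<in> polys_over S \<Longrightarrow> g' \<noteq> 0 \<Longrightarrow> \<exists>n. prime_product (polys_over S) n g'\<close>[of a]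
            \<open>\<And>g'. degree g' < degree g \<Longrightarrow> g' \<in> polys_over S \<Longrightarrow> g' \<noteq> 0 \<Longrightarrow> \<exists>n. prime_product (polys_over S) n g'\<close>[of b]
            ab nz P.prime_product_mult by metis
        qed
      qed
    qed
    moreover obtain k where "prime_product S k (lead_coeff g)"
      using factorization[of "lead_coeff g"] less.prems lead_coeff_in by fastforce
    ultimately show ?thesis using less.prems by blast
  qed
qed

theorem factorial_polys_over: "factorial_subdomain (polys_over S)"
  by (intro factorial_subdomain.intro polys_over_subdomain factorial_subdomain_axioms.intro
      factorization_polys_over)

end

lemma factorial_subdomain_image:
  assumes "ring_morphism h" "factorial_subdomain S" and inj: "\<And>a. a \<in> S \<Longrightarrow> h a = 0 \<Longrightarrow> a = 0"
  shows "factorial_subdomain (h ` S)"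
proof -
  interpret h: ring_morphism h by fact
  interpret factorial_subdomain S by fact
  have eq: "h a = h b \<longleftrightarrow> a = b" if "a \<in> S" "b \<in> S" for a b
    using inj[of "a - b"] that diff_in by (auto simp: h.diff)
  have dv: "dvd_in (h ` S) (h a) (h b) \<longleftrightarrow> dvd_in S a b" if "a \<in> S" "b \<in> S" for a b
    using that by (auto simp: dvd_in_def h.mult[symmetric] eq mult_in)
  have un: "unit_in (h ` S) (h a) \<longleftrightarrow> unit_in S a" if "a \<in> S" for a
    using dv[OF that one_in] that by (auto simp: unit_in_def h.one)
  have pr: "prime_in (h ` S) (h a)" if "prime_in S a" for a
    using that unfolding prime_in_def
    by (auto simp: un dv h.mult[symmetric] mult_in dest: inj)
  have pp: "prime_product (h ` S) n (h a)" if "prime_product S n a" for n a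
    using that
  proof (induction rule: prime_product.induct)
    case (unit u)
    then show ?case using un by (auto intro!: prime_product.unit simp: unit_in_def)
  next
    case (step p n a)
    then show ?case using pr by (auto intro!: prime_product.step simp: h.mult)
  qed
  show ?thesis
  proof
    show "0 \<in> h ` S" using zero_in h.zero by force
    show "1 \<in> h ` S" using one_in h.one by force
    show "a + b \<in> h ` S" if "a \<in> h ` S" "b \<in> h ` S" for a b
      using that add_in by (auto simp: h.add[symmetric])
    show "- a \<in> h ` S" if "a \<in> h ` S" for a
      using that uminus_in by (auto simp: h.uminus[symmetric])
    show "a * b \<in> h ` S" if "a \<in> h ` S" "b \<in> h ` S" for a b
      using that mult_in by (auto simp: h.mult[symmetric])
    show "a = 0 \<or> b = 0" if "a \<in> h ` S" "b \<in> h ` S" "a * b = 0" for a b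
    proof -
      obtain x y where xy: "x \<in> S" "y \<in> S" "a = h x" "b = h y" using \<open>a \<in> h ` S\<close> \<open>b \<in> h ` S\<close> by blast
      have "h (x * y) = 0" using xy \<open>a * b = 0\<close> by (simp add: h.mult)
      hence "x * y = 0" using inj mult_in xy by blast
      hence "x = 0 \<or> y = 0" using no_zero_divs xy by blast
      thus ?thesis using xy h.zero by blast
    qed
    show "\<exists>n. prime_product (h ` S) n a" if "a \<in> h ` S" "a \<noteq> 0" for a
      using that factorization pp h.zero by (metis imageE)
  qed
qed

section \<open>Unique factorization and values of polynomials in several variables\<close>

text \<open>
  The polynomials in the variables from \<open>A\<close>. Adding a variable to \<open>A\<close> amounts to taking
  univariate polynomials over this subring and evaluating them at the new variable.
\<close>
definition mpols_in :: "'n set \<Rightarrow> ('n, 'a::comm_ring_1) mpol set"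
  where "mpols_in A = {p. \<forall>\<alpha>\<in>keys p. keys \<alpha> \<subseteq> A}"

lemma mpols_in_mult: "p \<in> mpols_in A \<Longrightarrow> q \<in> mpols_in A \<Longrightarrow> p * q \<in> mpols_in A"
proof -
  assume p: "p \<in> mpols_in A" and q: "q \<in> mpols_in A"
  have "keys \<alpha> \<subseteq> A" if \<alpha>: "\<alpha> \<in> keys (p * q)" for \<alpha>
  proof -
    obtain a b where "a \<in> keys p" "b \<in> keys q" "\<alpha> = a + b"
      using \<alpha> keys_mult[of p q] by blast
    thus ?thesis using p q Poly_Mapping.keys_add[of a b] by (fastforce simp: mpols_in_def)
  qed
  thus ?thesis by (simp add: mpols_in_def)
qed

lemma mpols_in_add: "p \<in> mpols_in A \<Longrightarrow> q \<in> mpols_in A \<Longrightarrow> p + q \<in> mpols_in A"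
  using Poly_Mapping.keys_add[of p q] by (fastforce simp: mpols_in_def)

lemma mpols_in_sum: "(\<And>i. i \<in> I \<Longrightarrow> F i \<in> mpols_in A) \<Longrightarrow> (\<Sum>i\<in>I. F i) \<in> mpols_in A"
proof (induction I rule: infinite_finite_induct)
  case (insert i I)
  thus ?case by (simp add: mpols_in_add)
qed (simp_all add: mpols_in_def)

lemma mvar_power: "mvar i ^ k = single (single i k) 1"
proof (induction k)
  case (Suc k)
  have "single i (Suc k) = single i 1 + single i k"
    by (simp add: single_add[symmetric])
  thus ?case using Suc by (simp add: mvar_def mult_single)
qed simp

lemma mvar_power_in: "i \<in> A \<Longrightarrow> mvar i ^ k \<in> mpols_in A"
  by (auto simp: mvar_power mpols_in_def split: if_splits)

lemma mpols_in_insert: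
  assumes "i \<notin> A"
  shows "mpols_in (insert i A) = (\<lambda>P. poly P (mvar i)) ` polys_over (mpols_in A :: ('n, 'a::comm_ring_1) mpol set)"
proof (intro equalityI subsetI)
  fix p :: "('n, 'a) mpol" assume p: "p \<in> mpols_in (insert i A)"
  define \<beta> where "\<beta> \<alpha> = Poly_Mapping.update i 0 \<alpha>" for \<alpha> :: "'n \<Rightarrow>\<^sub>0 nat"
  define P where "P = (\<Sum>\<alpha>\<in>keys p.
    monom (single (\<beta> \<alpha>) (lookup p \<alpha>)) (lookup \<alpha> i))"
  have \<beta>: "\<beta> \<alpha> + single i (lookup \<alpha> i) = \<alpha>" for \<alpha>
    by (rule poly_mapping_eqI) (auto simp: \<beta>_def lookup_add lookup_update lookup_single when_def)
  have "poly P (mvar i) = (\<Sum>\<alpha>\<in>keys p.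
      single (\<beta> \<alpha>) (lookup p \<alpha>) * mvar i ^ lookup \<alpha> i)"
    by (simp add: P_def poly_sum poly_monom)
  also have "\<dots> = p" by (simp add: mvar_power mult_single \<beta> poly_mapping_sum_single)
  finally have "p = poly P (mvar i)" by simp
  moreover have "P \<in> polys_over (mpols_in A)"
  proof -
    have "keys (\<beta> \<alpha>) \<subseteq> A" if "\<alpha> \<in> keys p" for \<alpha>
      using p that by (auto simp: mpols_in_def \<beta>_def keys_update)
    hence "single (\<beta> \<alpha>) c \<in> mpols_in A" if "\<alpha> \<in> keys p" for \<alpha> and c :: 'a
      using that by (auto simp: mpols_in_def)
    moreover have "0 \<in> mpols_in A" by (simp add: mpols_in_def)
    ultimately show ?thesis by (auto simp: P_def polys_over_def coeff_sum intro!: mpols_in_sum)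
  qed
  ultimately show "p \<in> (\<lambda>P. poly P (mvar i)) ` polys_over (mpols_in A)" by blast
next
  fix p :: "('n, 'a) mpol" assume "p \<in> (\<lambda>P. poly P (mvar i)) ` polys_over (mpols_in A)"
  then obtain P where P: "p = poly P (mvar i)" "P \<in> polys_over (mpols_in A)" by blast
  have "coeff P k \<in> mpols_in (insert i A)" for k using P by (auto simp: polys_over_def mpols_in_def)
  thus "p \<in> mpols_in (insert i A)"
    by (auto simp: P poly_altdef intro!: mpols_in_sum mpols_in_mult mvar_power_in)
qed

lemma mpol_eval_cong:
  fixes x y :: "'a::comm_ring_1 ^ 'n::finite"
  assumes "p \<in> mpols_in A" "\<And>j. j \<in> A \<Longrightarrow> x $ j = y $ j"
  shows "mpol_eval x p = mpol_eval y p"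
  unfolding mpol_eval_def
proof (intro sum.cong refl arg_cong2[where f="(*)"] prod.cong)
  fix \<alpha> j assume "\<alpha> \<in> keys p"
  hence "keys \<alpha> \<subseteq> A" using assms(1) by (simp add: mpols_in_def)
  hence "j \<in> A \<or> lookup \<alpha> j = 0" by (auto simp: in_keys_iff)
  thus "x $ j ^ lookup \<alpha> j = y $ j ^ lookup \<alpha> j" using assms by auto
qed

text \<open>
  Choose the old coordinates so that the leading coefficient does not vanish; what remains is a
  nonzero polynomial in the new coordinate, which has finitely many zeros.
\<close>
lemma mpol_eval_poly_mvar_nonzero:
  fixes P :: "('n::finite, 'a::field_char_0) mpol poly"
  assumes "i \<notin> A" and P: "P \<in> polys_over (mpols_in A)" "P \<noteq> 0"
    and A: "\<And>p. p \<in> mpols_in A \<Longrightarrow> p \<noteq> 0 \<Longrightarrow> \<exists>x::'a^'n. mpol_eval x p \<noteq> 0"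
  shows "\<exists>x. mpol_eval x (poly P (mvar i)) \<noteq> 0"
proof -
  have "lead_coeff P \<in> mpols_in A" "lead_coeff P \<noteq> 0" using P by (auto simp: polys_over_def)
  then obtain x :: "'a^'n" where x: "mpol_eval x (lead_coeff P) \<noteq> 0" using A by blast
  interpret ex: ring_morphism "mpol_eval x" by (rule mpol_eval_morphism)
  define R where "R = map_poly (mpol_eval x) P"
  have "coeff R (degree P) \<noteq> 0" using x by (simp add: R_def coeff_map_poly ex.zero)
  hence "R \<noteq> 0" by auto
  then obtain z where z: "poly R z \<noteq> 0" using poly_all_0_iff_0 by blast
  define y where "y = (\<chi> j. if j = i then z else x $ j)"
  interpret ey: ring_morphism "mpol_eval y" by (rule mpol_eval_morphism)
  have c: "mpol_eval y (coeff P k) = mpol_eval x (coeff P k)" for k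
    by (rule mpol_eval_cong[of _ A]) (use P assms(1) in \<open>auto simp: y_def polys_over_def\<close>)
  have "mpol_eval y (poly P (mvar i)) = (\<Sum>k\<le>degree P. mpol_eval x (coeff P k) * z ^ k)"
    by (simp add: poly_altdef ey.sum ey.mult ey.power c) (simp add: y_def)
  also have "\<dots> = (\<Sum>k\<le>degree R. coeff R k * z ^ k)"
  proof (rule sum.mono_neutral_cong_right)
    have "degree R \<le> degree P" by (rule degree_le) (auto simp: R_def coeff_map_poly ex.zero coeff_eq_0)
    thus "{..degree R} \<subseteq> {..degree P}" by auto
    show "\<forall>k\<in>{..degree P} - {..degree R}. mpol_eval x (coeff P k) * z ^ k = 0"
    proof
      fix k assume "k \<in> {..degree P} - {..degree R}"
      hence "coeff R k = 0" by (intro coeff_eq_0) auto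
      thus "mpol_eval x (coeff P k) * z ^ k = 0" by (simp add: R_def coeff_map_poly ex.zero)
    qed
  qed (auto simp: R_def coeff_map_poly ex.zero)
  also have "\<dots> = poly R z" by (simp add: poly_altdef)
  finally have "mpol_eval y (poly P (mvar i)) \<noteq> 0" using z by simp
  thus ?thesis by blast
qed

lemma factorial_subdomain_field: "factorial_subdomain (UNIV :: 'a::field set)"
proof
  fix a :: 'a assume "a \<noteq> 0"
  hence "unit_in UNIV a" by (auto simp: unit_in_def dvd_in_def intro!: exI[of _ "inverse a"])
  thus "\<exists>n. prime_product UNIV n a" using prime_product.unit by blast
qed auto

lemma mpols_in_empty: "mpols_in {} = range (mpol_const :: 'a::comm_ring_1 \<Rightarrow> ('n, 'a) mpol)"
proof (intro equalityI subsetI)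
  fix p :: "('n, 'a) mpol" assume "p \<in> mpols_in {}"
  hence "keys p \<subseteq> {0}" by (auto simp: mpols_in_def)
  hence "p = mpol_const (lookup p 0)"
    by (intro poly_mapping_eqI) (auto simp: mpol_const_def lookup_single when_def in_keys_iff)
  thus "p \<in> range mpol_const" by blast
qed (auto simp: mpols_in_def mpol_const_def split: if_splits)

lemma ring_morphism_poly: "ring_morphism (\<lambda>P. poly P x)"
  by unfold_locales auto

text \<open>
  Both assertions are proved in one induction, because the second one is what makes evaluation at
  the new variable injective, and hence transfers unique factorization to the bigger subring.
\<close>
lemma mpols_in_factorial:
  assumes "finite A"
  shows "factorial_subdomain (mpols_in A :: ('n::finite, 'a::field_char_0) mpol set) \<and>
    (\<forall>p\<in>mpols_in A. p \<noteq> 0 \<longrightarrow> (\<exists>x::'a^'n. mpol_eval x p \<noteq> 0))"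
  using assms
proof (induction A rule: finite_induct)
  case empty
  have c0: "c = 0" if "mpol_const c = (0 :: ('n, 'a) mpol)" for c
    using that by (metis lookup_single_eq lookup_zero mpol_const_def)
  show ?case unfolding mpols_in_empty
    using factorial_subdomain_image[OF mpol_const_morphism factorial_subdomain_field c0]
    by (auto simp: ring_morphism.zero[OF mpol_const_morphism])
next
  case (insert i A)
  have nz: "\<exists>x. mpol_eval x (poly P (mvar i)) \<noteq> 0" if "P \<in> polys_over (mpols_in A)" "P \<noteq> 0"
    for P :: "('n, 'a) mpol poly"
    using mpol_eval_poly_mvar_nonzero[OF insert.hyps(2) that] insert.IH by blast
  have inj: "P = 0" if "P \<in> polys_over (mpols_in A)" "poly P (mvar i) = 0"
    for P :: "('n, 'a) mpol poly"
    using nz[OF that(1)] that(2) ring_morphism.zero[OF mpol_eval_morphism] by metis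
  have "factorial_subdomain (polys_over (mpols_in A :: ('n, 'a) mpol set))"
    using insert.IH factorial_subdomain.factorial_polys_over by blast
  hence "factorial_subdomain (mpols_in (insert i A) :: ('n, 'a) mpol set)"
    unfolding mpols_in_insert[OF insert.hyps(2)] using inj
    by (intro factorial_subdomain_image ring_morphism_poly) auto
  thus ?case unfolding mpols_in_insert[OF insert.hyps(2)] using nz by fastforce
qed

theorem mpol_factorial: "factorial_subdomain (UNIV :: ('n::finite, 'a::field_char_0) mpol set)"
proof -
  have "mpols_in UNIV = (UNIV :: ('n, 'a) mpol set)" by (auto simp: mpols_in_def)
  thus ?thesis using mpols_in_factorial[of "UNIV :: 'n set", where 'a = 'a] by simp
qed

lemma mpol_eval_nonzero:
  assumes "p \<noteq> (0 :: ('n::finite, 'a::field_char_0) mpol)" obtains x where "mpol_eval x p \<noteq> 0"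
  using mpols_in_factorial[of "UNIV :: 'n set"] assms by (auto simp: mpols_in_def)

lemma mpol_no_zero_divisors:
  "p * q = 0 \<Longrightarrow> p = 0 \<or> q = (0 :: ('n::finite, 'a::field_char_0) mpol)"
  using subdomain.no_zero_divs[OF factorial_subdomain.axioms(1)[OF mpol_factorial]] by blast

lemma mpol_irreducible_prime:
  fixes f :: "('n::finite, 'a::field_char_0) mpol"
  assumes f: "Factorial_Ring.irreducible f" and "f dvd a * b"
  shows "f dvd a \<or> f dvd b"
proof -
  interpret factorial_subdomain "UNIV :: ('n, 'a) mpol set" by (rule mpol_factorial)
  have dv: "dvd_in UNIV = ((dvd) :: ('n, 'a) mpol \<Rightarrow> _)" by (auto simp: fun_eq_iff dvd_in_def dvd_def)
  from f have f0: "f \<noteq> 0" "\<not> f dvd 1" by (auto simp: Factorial_Ring.irreducible_def)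
  obtain n where "prime_product UNIV n f" using factorization f0 by blast
  thus ?thesis
  proof cases
    case unit
    thus ?thesis using f0 by (simp add: unit_in_def dv)
  next
    case (step p k q)
    have p: "\<not> p dvd 1" "\<And>a b. p dvd a * b \<Longrightarrow> p dvd a \<or> p dvd b"
      using step by (auto simp: prime_in_def dv unit_in_def)
    have "p dvd 1 \<or> q dvd 1" using f step by (auto simp: Factorial_Ring.irreducible_def)
    then obtain r where r: "1 = q * r" using p by (auto simp: dvd_def)
    have "f * r = p" using step r by (simp add: mult.assoc)
    hence "f dvd c \<longleftrightarrow> p dvd c" for c using step by (metis dvd_mult_left dvd_triv_left)
    thus ?thesis using p assms(2) by simp
  qed
qed

text \<open>
  On the line through two points a unit restricts to a unit of the univariate polynomial ring,
  which is constant.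
\<close>
lemma mpol_unit_const:
  fixes p :: "('n::finite, 'a::field_char_0) mpol"
  assumes "p * q = 1"
  shows "mpol_eval x p = mpol_eval y p"
proof -
  \<comment> \<open>Restriction to the line through the two points.\<close>
  define h :: "('n, 'a) mpol \<Rightarrow> 'a poly" where "h = msubst (\<lambda>c. [:c:]) (\<lambda>i. [:x $ i, y $ i - x $ i:])"
  have c: "ring_morphism (\<lambda>c::'a. [:c:])" by unfold_locales auto
  interpret h: ring_morphism h unfolding h_def by (rule msubst_morphism[OF c])
  have ev: "poly (h p) z = mpol_eval (\<chi> i. x $ i + z * (y $ i - x $ i)) p" for z p
  proof -
    have "poly (h p) z = msubst (\<lambda>a. poly (h (mpol_const a)) z) (\<lambda>i. poly (h (mvar i)) z) p"
      by (rule ring_morphism_eq_msubst[OF ring_morphism_comp[OF h.ring_morphism_axioms ring_morphism_poly]])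
    moreover have "(\<lambda>i. poly (h (mvar i)) z) = ($) (\<chi> i. x $ i + z * (y $ i - x $ i))"
      by (rule ext) (simp add: h_def msubst_mvar[OF c])
    moreover have "(\<lambda>a. poly (h (mpol_const a)) z) = (\<lambda>a. a)"
      by (rule ext) (simp add: h_def msubst_const[OF c])
    ultimately show ?thesis unfolding mpol_eval_eq by (simp only:)
  qed
  have "h p * h q = 1" using assms by (simp add: h.mult[symmetric] h.one)
  hence "h p dvd 1" by (metis dvd_triv_left)
  then obtain c where "h p = [:c:]" by (metis is_unit_polyE)
  hence "poly (h p) 0 = poly (h p) 1" by simp
  thus ?thesis unfolding ev by (simp add: vec_eq_iff)
qed

lemma divisor_of_irreducible_power:
  fixes f :: "('n::finite, 'a::field_char_0) mpol"
  assumes f: "Factorial_Ring.irreducible f" and "b * b' = f ^ N"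
  shows "\<exists>c k. \<forall>x. mpol_eval x b = c * mpol_eval x f ^ k"
  using assms(2)
proof (induction N arbitrary: b b')
  case 0
  hence "mpol_eval x b = mpol_eval 0 b" for x using mpol_unit_const by (metis power_0)
  thus ?case by (metis mult.right_neutral power_0)
next
  case (Suc N)
  have f0: "f \<noteq> 0" using f by (auto simp: Factorial_Ring.irreducible_def)
  have canc: "f * u = f * v \<Longrightarrow> u = v" for u v
    using mpol_no_zero_divisors[of f "u - v"] f0 by (auto simp: algebra_simps)
  have "f dvd b * b'" using Suc.prems by simp
  from mpol_irreducible_prime[OF f this] show ?case
  proof
    assume "f dvd b"
    then obtain d where d: "b = f * d" by (auto simp: dvd_def)
    have "d * b' = f ^ N" using Suc.prems d canc by (simp add: mult.assoc)
    then obtain c k where ck: "\<And>x. mpol_eval x d = c * mpol_eval x f ^ k" using Suc.IH by blast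
    have "mpol_eval x b = c * mpol_eval x f ^ Suc k" for x
      by (simp add: d ck ring_morphism.mult[OF mpol_eval_morphism])
    thus ?thesis by blast
  next
    assume "f dvd b'"
    then obtain d where d: "b' = f * d" by (auto simp: dvd_def)
    have "b * d = f ^ N" using Suc.prems d canc by (simp add: mult.left_commute)
    thus ?thesis using Suc.IH by blast
  qed
qed

section \<open>The vanishing ideal of the hypersurface\<close>

definition hypersurface_eq :: "('n, complex) mpol \<Rightarrow> nat \<Rightarrow> ('n, complex) mpol laurent"
  where "hypersurface_eq f l = laurent_var_power (int l) * laurent_const f - 1"

definition on_hypersurface :: "('n::finite, complex) mpol \<Rightarrow> nat \<Rightarrow> complex \<Rightarrow> complex^'n \<Rightarrow> bool"
  where "on_hypersurface f l t x \<longleftrightarrow> t \<noteq> 0 \<and> t ^ l * mpol_eval x f = 1"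

lemma laurent_var_power_add: "laurent_var_power (a + b) = laurent_var_power a * (laurent_var_power b :: 'a::comm_ring_1 laurent)"
  by (simp add: laurent_var_power_def mult_single)

lemma laurent_var_power_0: "laurent_var_power 0 = (1 :: 'a::comm_ring_1 laurent)"
  by (simp add: laurent_var_power_def)

lemma laurent_var_power_mult: "laurent_var_power (a * int n) = (laurent_var_power a :: 'a::comm_ring_1 laurent) ^ n"
  by (induction n) (simp_all add: laurent_var_power_0 laurent_var_power_add algebra_simps)

lemma laurent_sum_terms:
  "(\<Sum>k\<in>keys u. laurent_const (lookup u k) * laurent_var_power k) = (u :: 'a::comm_ring_1 laurent)"
  by (simp add: laurent_const_def laurent_var_power_def mult_single poly_mapping_sum_single)

lemma dvd_power_diff: "(d :: 'a::comm_ring_1) dvd a - b \<Longrightarrow> d dvd a ^ n - b ^ n"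
proof (induction n)
  case (Suc n)
  have "a ^ Suc n - b ^ Suc n = a * (a ^ n - b ^ n) + (a - b) * b ^ n" by (simp add: algebra_simps)
  thus ?case using Suc by (metis dvd_add dvd_mult dvd_mult2)
qed simp

text \<open>
  On the hypersurface \<open>f\<close> is the inverse of \<open>t\<^sup>l\<close>, so negative powers of \<open>t\<^sup>l\<close> can be
  traded for powers of \<open>f\<close>.
\<close>
lemma inverse_power_cong_hypersurface:
  "hypersurface_eq f l dvd laurent_var_power (- int l * int n) - laurent_const (f ^ n)"
proof -
  interpret c: ring_morphism "laurent_const :: ('a, complex) mpol \<Rightarrow> _" by (rule laurent_const_morphism)
  have "laurent_var_power (- int l) - laurent_const f = hypersurface_eq f l * (- laurent_var_power (- int l))"
    by (simp add: hypersurface_eq_def algebra_simps laurent_var_power_add[symmetric] laurent_var_power_0)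
  hence "hypersurface_eq f l dvd laurent_var_power (- int l) - laurent_const f" by simp
  from dvd_power_diff[OF this, of n] show ?thesis
    by (simp only: laurent_var_power_mult c.power)
qed

text \<open>
  The normal form of a function on the hypersurface: after multiplication with a power of
  \<open>t\<^sup>-\<^sup>l\<close> it is a combination of \<open>1, t, \<dots>, t\<^sup>l\<^sup>-\<^sup>1\<close> with coefficients in the polynomial
  ring. The terms of this combination are the eigencomponents for \<open>t \<mapsto> \<zeta> t\<close> with \<open>\<zeta>\<^sup>l = 1\<close>.
\<close>
definition reduces_to :: "('n, complex) mpol \<Rightarrow> nat \<Rightarrow> ('n, complex) mpol laurent \<Rightarrow> nat \<Rightarrow> (nat \<Rightarrow> ('n, complex) mpol) \<Rightarrow> bool"
  where "reduces_to f l u N p \<longleftrightarrow> hypersurface_eq f l dvd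
    u * laurent_var_power (- int l * int N) - (\<Sum>i<l. laurent_const (p i) * laurent_var_power (int i))"

lemma reduces_to_raise:
  assumes "reduces_to f l u N p"
  shows "reduces_to f l u (N + M) (\<lambda>i. p i * f ^ M)"
proof -
  interpret c: ring_morphism "laurent_const :: ('a, complex) mpol \<Rightarrow> _" by (rule laurent_const_morphism)
  let ?s = "\<Sum>i<l. laurent_const (p i) * laurent_var_power (int i)"
  have v: "laurent_var_power (- int l * int (N + M)) =
     laurent_var_power (- int l * int N) * (laurent_var_power (- int l * int M) :: ('a, complex) mpol laurent)"
    by (simp add: laurent_var_power_add[symmetric] algebra_simps)
  have s: "(\<Sum>i<l. laurent_const (p i * f ^ M) * laurent_var_power (int i)) = ?s * laurent_const (f ^ M)"
    unfolding c.mult sum_distrib_right by (rule sum.cong) (simp_all add: mult_ac)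
  have "u * laurent_var_power (- int l * int (N + M)) - ?s * laurent_const (f ^ M)
     = (u * laurent_var_power (- int l * int N) - ?s) * laurent_var_power (- int l * int M)
       + ?s * (laurent_var_power (- int l * int M) - laurent_const (f ^ M))"
    unfolding v by (simp add: algebra_simps)
  moreover have "hypersurface_eq f l dvd \<dots>"
    by (intro dvd_add dvd_mult2 dvd_mult inverse_power_cong_hypersurface assms[unfolded reduces_to_def])
  ultimately show ?thesis unfolding reduces_to_def s by simp
qed

lemma reduces_to_add:
  assumes "reduces_to f l u N p" "reduces_to f l v M q"
  shows "\<exists>N p. reduces_to f l (u + v) N p"
proof -
  interpret c: ring_morphism "laurent_const :: ('a, complex) mpol \<Rightarrow> _" by (rule laurent_const_morphism)
  have "reduces_to f l u (N + M) (\<lambda>i. p i * f ^ M)" "reduces_to f l v (N + M) (\<lambda>i. q i * f ^ N)"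
    using reduces_to_raise[OF assms(1), of M] reduces_to_raise[OF assms(2), of N] by (simp_all add: add.commute)
  hence "reduces_to f l (u + v) (N + M) (\<lambda>i. p i * f ^ M + q i * f ^ N)"
    unfolding reduces_to_def c.add distrib_right sum.distrib
    using dvd_add[of "hypersurface_eq f l"] by (metis (no_types, lifting) add_diff_add)
  thus ?thesis by blast
qed

text \<open>
  For a single term \<open>c t\<^sup>k\<close>, division of \<open>k\<close> by \<open>l\<close> gives the exponent of \<open>t\<close>
  that survives; the factor \<open>t\<^sup>-\<^sup>l\<^sup>N\<close> makes the quotient nonpositive, so that it turns into a
  power of \<open>f\<close>.
\<close>
lemma reduction:
  fixes u :: "('n, complex) mpol laurent"
  assumes l: "l \<ge> 1"
  shows "\<exists>N p. reduces_to f l u N p"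
proof -
  interpret c: ring_morphism "laurent_const :: ('n, complex) mpol \<Rightarrow> _" by (rule laurent_const_morphism)
  have one: "\<exists>N p. reduces_to f l (laurent_const c * laurent_var_power k) N p" for c k
  proof -
    define N where "N = nat \<bar>k\<bar>"
    define r where "r = nat (k mod int l)"
    have r: "int r = k mod int l" "r < l" using l by (auto simp: r_def nat_less_iff)
    have "k div int l \<le> \<bar>k\<bar>"
    proof (cases "k div int l \<le> 0")
      case False
      hence "1 * (k div int l) \<le> int l * (k div int l)" using l by (intro mult_right_mono) auto
      moreover have "int l * (k div int l) \<le> k" using l mult_div_mod_eq[of "int l" k] pos_mod_sign[of "int l" k] by linarith
      ultimately show ?thesis by linarith
    qed simp
    then obtain M where M: "int M = int N - k div int l"
      by (metis N_def abs_ge_zero diff_ge_0_iff_ge int_nat_eq zero_le_imp_eq_int)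
    have e: "k + (- int l * int N) = int r + (- int l * int M)"
    proof -
      have "k = int l * (k div int l) + int r" using r by simp
      thus ?thesis unfolding M by (simp add: algebra_simps)
    qed
    let ?p = "\<lambda>i. if i = r then c * f ^ M else 0"
    have "(\<Sum>i<l. laurent_const (?p i) * laurent_var_power (int i)) =
      (\<Sum>i<l. if i = r then laurent_const (c * f ^ M) * laurent_var_power (int i) else 0)"
      by (rule sum.cong) (auto simp: c.zero)
    also have "\<dots> = laurent_const (c * f ^ M) * laurent_var_power (int r)" using r by simp
    finally have s: "(\<Sum>i<l. laurent_const (?p i) * laurent_var_power (int i)) =
       laurent_const c * laurent_var_power (int r) * laurent_const (f ^ M)" by (simp add: c.mult mult_ac)
    have "laurent_const c * laurent_var_power k * laurent_var_power (- int l * int N) =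
      laurent_const c * laurent_var_power (int r) * laurent_var_power (- int l * int M)"
      by (simp only: mult.assoc laurent_var_power_add[symmetric] e)
    hence "laurent_const c * laurent_var_power k * laurent_var_power (- int l * int N) -
       laurent_const c * laurent_var_power (int r) * laurent_const (f ^ M) =
       laurent_const c * laurent_var_power (int r) * (laurent_var_power (- int l * int M) - laurent_const (f ^ M))"
      by (simp add: algebra_simps)
    hence "reduces_to f l (laurent_const c * laurent_var_power k) N ?p"
      unfolding reduces_to_def s using inverse_power_cong_hypersurface[of f l M] by (metis dvd_mult)
    thus ?thesis by blast
  qed
  have z: "reduces_to f l 0 0 (\<lambda>_. 0)" by (simp add: reduces_to_def c.zero)
  have "\<exists>N p. reduces_to f l (\<Sum>k\<in>K. laurent_const (lookup u k) * laurent_var_power k) N p"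
    if "finite K" for K
    using that
  proof (induction K rule: finite_induct)
    case empty thus ?case using z by auto
  next
    case (insert k K)
    thus ?case using one[of "lookup u k" k] reduces_to_add by (metis (no_types, lifting) sum.insert)
  qed
  from this[of "keys u"] show ?thesis by (simp add: laurent_sum_terms)
qed

lemma hypersurface_eq_eval:
  assumes "t \<noteq> 0"
  shows "leval t x (hypersurface_eq f l) = t ^ l * mpol_eval x f - 1"
proof -
  interpret ring_morphism "leval t x" by (rule leval_morphism[OF assms])
  show ?thesis by (simp add: hypersurface_eq_def diff mult one)
qed

lemma dvd_imp_vanishes:
  assumes "hypersurface_eq f l dvd u" "on_hypersurface f l t x"
  shows "leval t x u = 0"
proof -
  have t: "t \<noteq> 0" using assms by (simp add: on_hypersurface_def)
  interpret ring_morphism "leval t x" by (rule leval_morphism[OF t])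
  show ?thesis using dvd[OF assms(1)] assms(2) by (simp add: hypersurface_eq_eval[OF t] on_hypersurface_def)
qed

lemma reduces_to_eval:
  assumes "reduces_to f l u N p" "on_hypersurface f l t x"
  shows "leval t x u * t powi (- int l * int N) = (\<Sum>i<l. mpol_eval x (p i) * t ^ i)"
proof -
  have t: "t \<noteq> 0" using assms by (simp add: on_hypersurface_def)
  interpret ring_morphism "leval t x" by (rule leval_morphism[OF t])
  show ?thesis using dvd_imp_vanishes[OF assms(1)[unfolded reduces_to_def] assms(2)]
    by (simp add: diff mult sum)
qed

lemma vanishes_at_roots:
  assumes "l \<ge> 1" "c \<noteq> 0" "\<And>t::complex. t ^ l = c \<Longrightarrow> (\<Sum>i<l. a i * t ^ i) = 0" "i < l"
  shows "a i = 0"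
proof (rule ccontr)
  assume ai: "a i \<noteq> 0"
  define R where "R = (\<Sum>i<l. monom (a i) i)"
  have cR: "coeff R i = (if i < l then a i else 0)" for i
    by (auto simp: R_def coeff_sum)
  have R0: "R \<noteq> 0" using cR[of i] ai assms by auto
  have "degree R \<le> l - 1" by (rule degree_le) (auto simp: cR)
  have "{z. z ^ l = c} \<subseteq> {z. poly R z = 0}"
    using assms by (auto simp: R_def poly_sum poly_monom)
  hence "card {z. z ^ l = c} \<le> card {z. poly R z = 0}"
    by (intro card_mono poly_roots_finite R0)
  also have "\<dots> \<le> degree R" using card_poly_roots_bound[OF R0] .
  finally have "card {z. z ^ l = c} \<le> degree R" .
  moreover have "card {z. z ^ l = c} = l" using card_nth_roots[OF assms(2), of l] assms(1) by linarith
  ultimately show False using \<open>degree R \<le> l - 1\<close> assms(1) by linarith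
qed

lemma complex_root_exists:
  assumes "l \<ge> 1" "(c::complex) \<noteq> 0"
  obtains t where "t ^ l = c" "t \<noteq> 0"
proof -
  have "{z. z ^ l = c} \<noteq> {}" using card_nth_roots[OF assms(2), of l] assms by (metis card.empty not_one_le_zero less_le_trans zero_less_one)
  then obtain t where "t ^ l = c" by blast
  moreover from this have "t \<noteq> 0" using assms by (auto simp: power_0_left)
  ultimately show ?thesis using that by blast
qed

lemma on_hypersurface_root:
  assumes "l \<ge> 1"
  shows "on_hypersurface f l t x \<longleftrightarrow> mpol_eval x f \<noteq> 0 \<and> t ^ l = inverse (mpol_eval x f)"
proof
  assume "on_hypersurface f l t x"
  hence "mpol_eval x f * t ^ l = 1" by (simp add: on_hypersurface_def mult.commute)
  thus "mpol_eval x f \<noteq> 0 \<and> t ^ l = inverse (mpol_eval x f)"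
    using inverse_unique by (metis mult_zero_left zero_neq_one)
next
  assume *: "mpol_eval x f \<noteq> 0 \<and> t ^ l = inverse (mpol_eval x f)"
  have "t \<noteq> 0" using * assms by (cases "t = 0") (auto simp: power_0_left)
  thus "on_hypersurface f l t x" using * by (simp add: on_hypersurface_def)
qed

lemma on_hypersurface_exists:
  assumes "l \<ge> 1" "mpol_eval x f \<noteq> 0"
  obtains t where "on_hypersurface f l t x"
proof -
  have "inverse (mpol_eval x f) \<noteq> 0" using assms by simp
  from complex_root_exists[OF assms(1) this] obtain t where "t ^ l = inverse (mpol_eval x f)" by metis
  hence "on_hypersurface f l t x" using assms(2) by (simp add: on_hypersurface_root[OF assms(1)])
  thus ?thesis by (rule that)
qed

lemma mpol_eq_0_if_vanishes_off:
  assumes "f \<noteq> 0" "\<And>x. mpol_eval x f \<noteq> 0 \<Longrightarrow> mpol_eval x p = 0"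
  shows "p = (0 :: ('n::finite, complex) mpol)"
proof -
  have "mpol_eval x (p * f) = 0" for x
    using assms(2)[of x] by (auto simp: ring_morphism.mult[OF mpol_eval_morphism])
  hence "p * f = 0" using mpol_eval_nonzero by metis
  thus ?thesis using mpol_no_zero_divisors assms(1) by blast
qed

text \<open>
  The equation generates the full vanishing ideal. Over each \<open>x\<close> with \<open>f(x) \<noteq> 0\<close> there are
  \<open>l\<close> points of the hypersurface, so a function in normal form which vanishes at all of them has
  vanishing coefficients. This replaces the Nullstellensatz: identities in the coordinate ring can
  be checked at complex points.
\<close>
theorem vanishes_iff_dvd:
  assumes l: "l \<ge> 1" and f: "f \<noteq> 0"
  shows "hypersurface_eq f l dvd u \<longleftrightarrow> (\<forall>t x. on_hypersurface f l t x \<longrightarrow> leval t x u = 0)"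
proof
  assume van: "\<forall>t x. on_hypersurface f l t x \<longrightarrow> leval t x u = 0"
  obtain N p where red: "reduces_to f l u N p" using reduction[OF l] by blast
  have "p i = 0" if "i < l" for i
  proof (rule mpol_eq_0_if_vanishes_off[OF f])
    fix x assume x: "mpol_eval x f \<noteq> 0"
    show "mpol_eval x (p i) = 0"
    proof (rule vanishes_at_roots[OF l, where a="\<lambda>i. mpol_eval x (p i)"])
      show "inverse (mpol_eval x f) \<noteq> 0" using x by simp
      fix t assume "t ^ l = inverse (mpol_eval x f)"
      hence "on_hypersurface f l t x" using x on_hypersurface_root[OF l] by blast
      from reduces_to_eval[OF red this] van this show "(\<Sum>i<l. mpol_eval x (p i) * t ^ i) = 0" by auto
    qed fact
  qed
  hence "(\<Sum>i<l. laurent_const (p i) * laurent_var_power (int i)) = 0"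
    by (simp add: ring_morphism.zero[OF laurent_const_morphism])
  hence "hypersurface_eq f l dvd u * laurent_var_power (- int l * int N)"
    using red by (simp add: reduces_to_def)
  hence "hypersurface_eq f l dvd u * laurent_var_power (- int l * int N) * laurent_var_power (int l * int N)"
    by (rule dvd_mult2)
  also have "u * laurent_var_power (- int l * int N) * laurent_var_power (int l * int N) = u"
    by (simp add: mult.assoc laurent_var_power_add[symmetric] laurent_var_power_0)
  finally show "hypersurface_eq f l dvd u" .
qed (auto dest: dvd_imp_vanishes)

section \<open>Laurent polynomials in one variable\<close>

text \<open>
  A Laurent polynomial \<open>\<Sum> a\<^sub>k s\<^sup>k\<close> with exponents at least \<open>-N\<close>, multiplied by \<open>s\<^sup>N\<close>.
\<close>
definition shifted_poly :: "int set \<Rightarrow> nat \<Rightarrow> (int \<Rightarrow> complex) \<Rightarrow> complex poly"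
  where "shifted_poly K N a = (\<Sum>k\<in>K. monom (a k) (nat (k + int N)))"

lemma shifted_poly_props:
  assumes K: "finite K" "\<And>k. k \<in> K \<Longrightarrow> - int N \<le> k"
  shows "k \<in> K \<Longrightarrow> coeff (shifted_poly K N a) (nat (k + int N)) = a k"
    and "s \<noteq> 0 \<Longrightarrow> poly (shifted_poly K N a) s = s ^ N * (\<Sum>k\<in>K. a k * s powi k)"
proof -
  assume k: "k \<in> K"
  have "coeff (shifted_poly K N a) (nat (k + int N)) = (\<Sum>j\<in>K. if j = k then a j else 0)"
    unfolding shifted_poly_def coeff_sum
  proof (rule sum.cong)
    fix j assume "j \<in> K"
    hence "nat (j + int N) = nat (k + int N) \<longleftrightarrow> j = k" using K(2)[of j] K(2)[OF k] by linarith
    thus "coeff (monom (a j) (nat (j + int N))) (nat (k + int N)) = (if j = k then a j else 0)" by simp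
  qed simp
  thus "coeff (shifted_poly K N a) (nat (k + int N)) = a k" using K k by simp
next
  assume s: "s \<noteq> 0"
  have "s ^ nat (k + int N) = s ^ N * s powi k" if "k \<in> K" for k
  proof -
    have "s ^ nat (k + int N) = s powi (k + int N)" using K(2)[OF that] by (simp add: power_int_def)
    thus ?thesis using s by (simp add: power_int_add mult.commute)
  qed
  thus "poly (shifted_poly K N a) s = s ^ N * (\<Sum>k\<in>K. a k * s powi k)"
    unfolding shifted_poly_def poly_sum poly_monom sum_distrib_left by (intro sum.cong) (auto simp: mult_ac)
qed

lemma int_set_lower_bound: "finite (K :: int set) \<Longrightarrow> \<exists>N. \<forall>k\<in>K. - int N \<le> k"
proof (induction K rule: finite_induct)
  case (insert k K)
  then obtain N where "\<forall>k\<in>K. - int N \<le> k" by blast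
  hence "\<forall>j\<in>insert k K. - int (max N (nat \<bar>k\<bar>)) \<le> j" by fastforce
  thus ?case by blast
qed auto

lemma poly_eq_if_eq_nonzero:
  assumes "\<And>s::complex. s \<noteq> 0 \<Longrightarrow> poly p s = poly q s"
  shows "p = q"
proof (rule ccontr)
  assume "p \<noteq> q"
  hence "finite {s. poly (p - q) s = 0}" by (intro poly_roots_finite) simp
  moreover have "- {0} \<subseteq> {s. poly (p - q) s = 0}" using assms by auto
  ultimately have "finite (- {0::complex})" by (rule finite_subset[rotated])
  thus False by (simp add: infinite_UNIV_char_0)
qed

lemma laurent_sum_zero:
  assumes K: "finite K" and "\<And>s::complex. s \<noteq> 0 \<Longrightarrow> (\<Sum>k\<in>K. a k * s powi k) = 0" and k: "k \<in> K"
  shows "a k = 0"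
proof -
  obtain N where N: "\<And>k. k \<in> K \<Longrightarrow> - int N \<le> k" using int_set_lower_bound[OF K] by blast
  have "shifted_poly K N a = 0"
    by (rule poly_eq_if_eq_nonzero) (simp add: shifted_poly_props(2)[OF K N] assms(2))
  thus ?thesis using shifted_poly_props(1)[OF K N k, of a] by simp
qed

lemma divisor_of_monomial:
  "p * q = monom c n \<Longrightarrow> c \<noteq> 0 \<Longrightarrow> \<exists>d i. p = monom (d::'a::field) i"
proof (induction n arbitrary: p q)
  case 0
  hence "p dvd [:c:]" by (metis dvd_triv_left monom_0)
  hence "p dvd 1" using \<open>c \<noteq> 0\<close> by (metis dvd_trans is_unit_triv)
  thus ?case by (metis is_unit_polyE monom_0)
next
  case (Suc n)
  have X: "monom c (Suc n) = pCons 0 (monom c n)" by (simp add: monom_Suc)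
  have "coeff p 0 * coeff q 0 = 0" using arg_cong[OF Suc.prems(1), of "\<lambda>r. coeff r 0"] by (simp add: X coeff_mult)
  then consider "coeff p 0 = 0" | "coeff q 0 = 0" by auto
  thus ?case
  proof cases
    case 1
    obtain p' where p': "p = pCons 0 p'" using 1 by (metis pCons_cases coeff_pCons_0)
    have "p' * q = monom c n" using Suc.prems(1) by (simp add: p' X)
    then obtain d i where "p' = monom d i" using Suc by blast
    thus ?thesis using p' by (metis monom_Suc)
  next
    case 2
    obtain q' where q': "q = pCons 0 q'" using 2 by (metis pCons_cases coeff_pCons_0)
    have "p * q' = monom c n" using Suc.prems(1) by (simp add: q' X)
    thus ?thesis using Suc by blast
  qed
qed

text \<open>
  A unit of the ring of Laurent polynomials is a monomial.
\<close>
lemma laurent_product_one: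
  assumes K: "finite K" and J: "finite J"
    and eq: "\<And>s::complex. s \<noteq> 0 \<Longrightarrow> (\<Sum>k\<in>K. a k * s powi k) * (\<Sum>k\<in>J. b k * s powi k) = 1"
    and k: "k \<in> K" "k' \<in> K" "a k \<noteq> 0" "a k' \<noteq> 0"
  shows "k = k'"
proof -
  obtain N where N: "\<And>k. k \<in> K \<Longrightarrow> - int N \<le> k" using int_set_lower_bound[OF K] by blast
  obtain M where M: "\<And>k. k \<in> J \<Longrightarrow> - int M \<le> k" using int_set_lower_bound[OF J] by blast
  have "shifted_poly K N a * shifted_poly J M b = monom 1 (N + M)"
  proof (rule poly_eq_if_eq_nonzero)
    fix s :: complex assume s: "s \<noteq> 0"
    have "poly (shifted_poly K N a * shifted_poly J M b) s = s ^ N * s ^ M * ((\<Sum>k\<in>K. a k * s powi k) * (\<Sum>k\<in>J. b k * s powi k))"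
      by (simp add: shifted_poly_props(2)[OF K N s] shifted_poly_props(2)[OF J M s])
    thus "poly (shifted_poly K N a * shifted_poly J M b) s = poly (monom 1 (N + M)) s"
      by (simp add: eq[OF s] poly_monom power_add)
  qed
  then obtain d i where di: "shifted_poly K N a = monom d i" using divisor_of_monomial by (metis zero_neq_one)
  have "nat (k + int N) = i" "nat (k' + int N) = i"
    using shifted_poly_props(1)[OF K N, of k a] shifted_poly_props(1)[OF K N, of k' a] k
    by (auto simp: di split: if_splits)
  thus ?thesis using N[OF k(1)] N[OF k(2)] by linarith
qed

lemma laurent_product_zero:
  assumes K: "finite K" and J: "finite J"
    and eq: "\<And>s::complex. s \<noteq> 0 \<Longrightarrow> (\<Sum>k\<in>K. a k * s powi k) * (\<Sum>k\<in>J. b k * s powi k) = 0"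
    and k: "k \<in> K" "a k \<noteq> 0" and j: "j \<in> J" "b j \<noteq> 0"
  shows False
proof -
  obtain N where N: "\<And>k. k \<in> K \<Longrightarrow> - int N \<le> k" using int_set_lower_bound[OF K] by blast
  obtain M where M: "\<And>k. k \<in> J \<Longrightarrow> - int M \<le> k" using int_set_lower_bound[OF J] by blast
  have "shifted_poly K N a * shifted_poly J M b = 0"
  proof (rule poly_eq_if_eq_nonzero)
    fix s :: complex assume s: "s \<noteq> 0"
    have "poly (shifted_poly K N a * shifted_poly J M b) s = s ^ N * s ^ M * ((\<Sum>k\<in>K. a k * s powi k) * (\<Sum>k\<in>J. b k * s powi k))"
      by (simp add: shifted_poly_props(2)[OF K N s] shifted_poly_props(2)[OF J M s])
    thus "poly (shifted_poly K N a * shifted_poly J M b) s = poly 0 s"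
      by (simp add: eq[OF s])
  qed
  hence "shifted_poly K N a = 0 \<or> shifted_poly J M b = 0" by simp
  thus False using shifted_poly_props(1)[OF K N k(1), of a] shifted_poly_props(1)[OF J M j(1), of b] k j by auto
qed

section \<open>The grading by weights and the units of the coordinate ring\<close>

lemma carrier_Gm: "carrier Gm = - {0}"
  by (auto simp: Gm_def ring_of_type_algebra_def)

lemma mult_Gm: "s \<otimes>\<^bsub>Gm\<^esub> t = s * t"
  by (simp add: Gm_def ring_of_type_algebra_def)

lemma one_Gm: "\<one>\<^bsub>Gm\<^esub> = 1"
  by (simp add: Gm_def ring_of_type_algebra_def)

text \<open>
  The functions of \<open>(s, t, x)\<close> given by elements of \<open>\<complex>[x][t, t\<inverse>][s, s\<inverse>]\<close>. Closure
  under sums and products shows that functions obtained from the action are of this kind, without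
  writing the elements down.
\<close>
definition laurent_expandable :: "(complex \<Rightarrow> complex \<Rightarrow> complex^'n \<Rightarrow> complex) \<Rightarrow> bool"
  where "laurent_expandable G \<longleftrightarrow> (\<exists>q :: ('n::finite, complex) mpol laurent laurent.
    \<forall>s t x. s \<noteq> 0 \<longrightarrow> t \<noteq> 0 \<longrightarrow> G s t x = pm_eval (leval t x) (\<lambda>k. s powi k) q)"

lemma laurent_family_eval_morphism:
  "s \<noteq> 0 \<Longrightarrow> t \<noteq> 0 \<Longrightarrow> ring_morphism (pm_eval (leval t (x :: complex^'n::finite)) (\<lambda>k. s powi k))"
  by (intro pm_eval_morphism leval_morphism) (auto simp: power_int_add)

lemma laurent_expandable_const: "laurent_expandable (\<lambda>s t x. leval t x u)"
  unfolding laurent_expandable_def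
  by (intro exI[of _ "laurent_const u"])
    (auto simp: laurent_const_def pm_eval_single ring_morphism.zero[OF leval_morphism])

lemma laurent_expandable_power_int: "laurent_expandable (\<lambda>s t x. s powi k)"
  unfolding laurent_expandable_def
  by (intro exI[of _ "laurent_var_power k"])
    (auto simp: laurent_var_power_def pm_eval_single ring_morphism.zero[OF leval_morphism]
      ring_morphism.one[OF leval_morphism])

lemma laurent_expandable_mult:
  assumes "laurent_expandable G" "laurent_expandable H"
  shows "laurent_expandable (\<lambda>s t x. G s t x * H s t x)"
proof -
  obtain q r where "\<And>s t x. s \<noteq> 0 \<Longrightarrow> t \<noteq> 0 \<Longrightarrow> G s t x = pm_eval (leval t x) (\<lambda>k. s powi k) q"
    "\<And>s t x. s \<noteq> 0 \<Longrightarrow> t \<noteq> 0 \<Longrightarrow> H s t x = pm_eval (leval t x) (\<lambda>k. s powi k) r"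
    using assms unfolding laurent_expandable_def by metis
  thus ?thesis unfolding laurent_expandable_def
    by (intro exI[of _ "q * r"]) (simp add: ring_morphism.mult[OF laurent_family_eval_morphism])
qed

lemma laurent_expandable_add:
  assumes "laurent_expandable G" "laurent_expandable H"
  shows "laurent_expandable (\<lambda>s t x. G s t x + H s t x)"
proof -
  obtain q r where "\<And>s t x. s \<noteq> 0 \<Longrightarrow> t \<noteq> 0 \<Longrightarrow> G s t x = pm_eval (leval t x) (\<lambda>k. s powi k) q"
    "\<And>s t x. s \<noteq> 0 \<Longrightarrow> t \<noteq> 0 \<Longrightarrow> H s t x = pm_eval (leval t x) (\<lambda>k. s powi k) r"
    using assms unfolding laurent_expandable_def by metis
  thus ?thesis unfolding laurent_expandable_def
    by (intro exI[of _ "q + r"]) (simp add: ring_morphism.add[OF laurent_family_eval_morphism])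
qed

lemma laurent_expandable_mpol: "laurent_expandable (\<lambda>s t x. mpol_eval x p)"
  using laurent_expandable_const[of "laurent_const p"] by simp

lemma laurent_expandable_scalar: "laurent_expandable (\<lambda>s t x. c)"
  using laurent_expandable_mpol[of "mpol_const c"] by simp

lemma laurent_expandable_t: "laurent_expandable (\<lambda>s t x. t powi k)"
  using laurent_expandable_const[of "laurent_var_power k"] by simp

lemma laurent_expandable_sum:
  "(\<And>i. i \<in> I \<Longrightarrow> laurent_expandable (G i)) \<Longrightarrow> laurent_expandable (\<lambda>s t x. \<Sum>i\<in>I. G i s t x)"
  by (induction I rule: infinite_finite_induct)
    (simp_all add: laurent_expandable_scalar laurent_expandable_add)

lemma laurent_expandable_prod:
  "(\<And>i. i \<in> I \<Longrightarrow> laurent_expandable (G i)) \<Longrightarrow> laurent_expandable (\<lambda>s t x. \<Prod>i\<in>I. G i s t x)"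
  by (induction I rule: infinite_finite_induct)
    (simp_all add: laurent_expandable_scalar laurent_expandable_mult)

lemma laurent_expandable_power:
  "laurent_expandable G \<Longrightarrow> laurent_expandable (\<lambda>s t x. G s t x ^ n)"
  by (induction n) (simp_all add: laurent_expandable_scalar laurent_expandable_mult)

locale semi_invariant_polynomial =
  fixes f :: "('n::finite, complex) mpol" and \<mu> :: "complex \<Rightarrow> complex^'n \<Rightarrow> complex^'n" and m :: nat
  assumes irreducible: "Factorial_Ring.irreducible f"
    and regular: "regular_Gm_action \<mu>"
    and m: "m \<ge> 1"
    and semi_inv: "semi_invariant \<mu> m f"
begin

lemma f_nonzero: "f \<noteq> 0"
  using irreducible by (auto simp: Factorial_Ring.irreducible_def)

lemma action_mult: "s \<noteq> 0 \<Longrightarrow> t \<noteq> 0 \<Longrightarrow> \<mu> (s * t) x = \<mu> s (\<mu> t x)"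
  using group_action.composition_rule[of Gm UNIV \<mu> x s t] regular
  by (simp add: regular_Gm_action_def carrier_Gm mult_Gm)

lemma action_one: "\<mu> 1 x = x"
  using group_action.id_eq_one[of Gm UNIV \<mu>] regular
  by (simp add: regular_Gm_action_def one_Gm restrict_def) metis

lemma action_inverse: "s \<noteq> 0 \<Longrightarrow> \<mu> (inverse s) (\<mu> s x) = x" "s \<noteq> 0 \<Longrightarrow> \<mu> s (\<mu> (inverse s) x) = x"
  by (simp_all add: action_mult[symmetric] action_one)

lemma eval_action: "s \<noteq> 0 \<Longrightarrow> mpol_eval (\<mu> s x) f = s ^ m * mpol_eval x f"
  using semi_inv by (simp add: semi_invariant_def carrier_Gm)

lemma action_components:
  obtains p :: "'n \<Rightarrow> ('n, complex) mpol laurent"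
  where "\<And>s x i. s \<noteq> 0 \<Longrightarrow> \<mu> s x $ i = leval s x (p i)"
  using regular that unfolding regular_Gm_action_def carrier_Gm by blast

text \<open>
  The action of \<open>s\<close> on the hypersurface is \<open>(t, x) \<mapsto> (s\<^sup>-\<^sup>m t, \<mu>(s\<^sup>l, x))\<close>. The weights are
  chosen such that \<open>t\<^sup>l f(x)\<close> is invariant.
\<close>
abbreviation translate_t :: "complex \<Rightarrow> complex \<Rightarrow> complex"
  where "translate_t s t \<equiv> s powi (- int m) * t"

lemma on_hypersurface_translate:
  assumes "s \<noteq> 0" "on_hypersurface f l t x"
  shows "on_hypersurface f l (translate_t s t) (\<mu> (s ^ l) x)"
proof -
  have "(translate_t s t) ^ l * mpol_eval (\<mu> (s ^ l) x) f
      = (s powi (- int m)) ^ l * (s ^ l) ^ m * (t ^ l * mpol_eval x f)"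
    using assms by (simp add: eval_action power_mult_distrib)
  also have "(s powi (- int m)) ^ l * (s ^ l) ^ m = 1"
    using assms by (simp add: power_int_minus power_inverse power_mult[symmetric] mult.commute)
  finally show ?thesis using assms by (simp add: on_hypersurface_def)
qed

lemma laurent_expandable_translate:
  "laurent_expandable (\<lambda>s t x. leval (translate_t s t) (\<mu> (s ^ l) x) u)"
proof -
  obtain p :: "'n \<Rightarrow> ('n, complex) mpol laurent"
    where p: "\<And>s x i. s \<noteq> 0 \<Longrightarrow> \<mu> s x $ i = leval s x (p i)" using action_components by blast
  define G where "G i s x = (\<Sum>k\<in>keys (p i). mpol_eval x (lookup (p i) k) * s powi (int l * k))"
    for i s x
  have G: "laurent_expandable (\<lambda>s t x. G i s x)" for i
    unfolding G_def by (intro laurent_expandable_sum laurent_expandable_mult laurent_expandable_mpol laurent_expandable_power_int)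
  have \<mu>: "\<mu> (s ^ l) x $ i = G i s x" if "s \<noteq> 0" for s x i
    using that by (simp add: p laurent_mpol_eval_def G_def power_int_mult)
  have "laurent_expandable (\<lambda>s t x. \<Sum>k\<in>keys u.
     (\<Sum>\<alpha>\<in>keys (lookup u k). lookup (lookup u k) \<alpha> *
       (\<Prod>i\<in>UNIV. G i s x ^ lookup \<alpha> i)) * (s powi (- int m * k) * t powi k))"
    by (intro laurent_expandable_sum laurent_expandable_mult laurent_expandable_prod laurent_expandable_power
        laurent_expandable_scalar laurent_expandable_power_int laurent_expandable_t G)
  moreover have "leval (translate_t s t) (\<mu> (s ^ l) x) u = (\<Sum>k\<in>keys u.
     (\<Sum>\<alpha>\<in>keys (lookup u k). lookup (lookup u k) \<alpha> *
       (\<Prod>i\<in>UNIV. G i s x ^ lookup \<alpha> i)) * (s powi (- int m * k) * t powi k))"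
    if "s \<noteq> 0" "t \<noteq> 0" for s t x
    unfolding laurent_mpol_eval_def mpol_eval_def \<mu>[OF that(1)] power_int_mult_distrib
      power_int_mult[symmetric] by (rule refl)
  ultimately show ?thesis unfolding laurent_expandable_def by simp
qed

text \<open>
  \<open>q\<close> lists the homogeneous components of \<open>u\<close> for the grading given by the action: the
  component of weight \<open>k\<close> is the coefficient of \<open>s\<^sup>k\<close> in the translate of \<open>u\<close> by \<open>s\<close>.
\<close>
definition weight_components :: "nat \<Rightarrow> ('n, complex) mpol laurent \<Rightarrow> ('n, complex) mpol laurent laurent \<Rightarrow> bool"
  where "weight_components l u q \<longleftrightarrow> (\<forall>s t x. s \<noteq> 0 \<longrightarrow> t \<noteq> 0 \<longrightarrow>
    leval (translate_t s t) (\<mu> (s ^ l) x) u = (\<Sum>k\<in>keys q. leval t x (lookup q k) * s powi k))"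

lemma weight_components_exist: "\<exists>q. weight_components l u q"
  using laurent_expandable_translate[of l u]
  unfolding laurent_expandable_def pm_eval_def weight_components_def .

lemma weight_components_translate:
  "weight_components l u q \<Longrightarrow> s \<noteq> 0 \<Longrightarrow> t \<noteq> 0 \<Longrightarrow>
    leval (translate_t s t) (\<mu> (s ^ l) x) u = (\<Sum>k\<in>keys q. leval t x (lookup q k) * s powi k)"
  unfolding weight_components_def by blast

lemma weight_components_sum:
  "weight_components l u q \<Longrightarrow> t \<noteq> 0 \<Longrightarrow> leval t x u = (\<Sum>k\<in>keys q. leval t x (lookup q k))"
  using weight_components_translate[of l u q 1 t x] by (simp add: action_one)

text \<open>
  Translate by \<open>s\<close> and then by \<open>r\<close>, which is translation by \<open>r s\<close>, and compare the
  coefficients of the powers of \<open>r\<close>.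
\<close>
lemma weight_component_homogeneous:
  assumes wc: "weight_components l u q" and s: "s \<noteq> 0" "t \<noteq> 0"
  shows "leval (translate_t s t) (\<mu> (s ^ l) x) (lookup q k) = s powi k * leval t x (lookup q k)"
proof (cases "k \<in> keys q")
  case True
  note q = weight_components_translate[OF wc]
  define a where "a k = leval (translate_t s t) (\<mu> (s ^ l) x) (lookup q k)
     - s powi k * leval t x (lookup q k)" for k
  have t': "translate_t s t \<noteq> 0" using s by simp
  have "(\<Sum>k\<in>keys q. a k * r powi k) = 0" if r: "r \<noteq> 0" for r
  proof -
    have "translate_t r (translate_t s t) = translate_t (r * s) t"
      by (simp add: power_int_mult_distrib mult.assoc)
    moreover have "\<mu> (r ^ l) (\<mu> (s ^ l) x) = \<mu> ((r * s) ^ l) x"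
      using r s by (simp add: action_mult power_mult_distrib)
    ultimately have "leval (translate_t r (translate_t s t)) (\<mu> (r ^ l) (\<mu> (s ^ l) x)) u =
      leval (translate_t (r * s) t) (\<mu> ((r * s) ^ l) x) u" by (simp only:)
    moreover have "leval (translate_t (r * s) t) (\<mu> ((r * s) ^ l) x) u =
      (\<Sum>k\<in>keys q. leval t x (lookup q k) * (r * s) powi k)"
      by (rule q) (use r s in auto)
    ultimately have "(\<Sum>k\<in>keys q. leval (translate_t s t) (\<mu> (s ^ l) x) (lookup q k) * r powi k)
      = (\<Sum>k\<in>keys q. leval t x (lookup q k) * (r * s) powi k)"
      using q[OF r t', of "\<mu> (s ^ l) x"] by (simp only:)
    thus ?thesis unfolding a_def left_diff_distrib sum_subtractf by (simp add: power_int_mult_distrib mult_ac)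
  qed
  from laurent_sum_zero[OF _ this True] show ?thesis by (simp add: a_def)
next
  case False
  hence "lookup q k = 0" by (simp add: in_keys_iff)
  thus ?thesis using s by (simp add: ring_morphism.zero[OF leval_morphism])
qed

text \<open>
  This is the step that uses \<open>gcd(l, m) = 1\<close>. An \<open>l\<close>-th root of unity \<open>\<zeta>\<close> in the
  torus acts on the hypersurface by \<open>(t, x) \<mapsto> (\<zeta>\<^sup>-\<^sup>m t, x)\<close>, and \<open>\<zeta>\<^sup>-\<^sup>m\<close> is again primitive if
  \<open>\<zeta>\<close> is. So a homogeneous function is an eigenvector for all \<open>t \<mapsto> \<zeta> t\<close>, and only one
  coefficient of its normal form is nonzero.
\<close>
lemma homogeneous_form:
  assumes l: "l \<ge> 1" "coprime l m"
    and u: "\<And>s t x. s \<noteq> 0 \<Longrightarrow> on_hypersurface f l t x \<Longrightarrow>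
      leval (translate_t s t) (\<mu> (s ^ l) x) u = s powi k * leval t x u"
  shows "\<exists>b e. \<forall>t x. on_hypersurface f l t x \<longrightarrow> leval t x u = mpol_eval x b * t powi e"
proof -
  obtain N p where red: "reduces_to f l u N p" using reduction[OF l(1)] by blast
  \<comment> \<open>A primitive root of unity, as a point of the torus; it fixes the coordinate \<open>x\<close>.\<close>
  define \<zeta> where "\<zeta> = exp (2 * of_real pi * \<i> * of_nat 1 / of_nat l)"
  have \<zeta>: "\<zeta> ^ l = 1" "\<zeta> \<noteq> 0"
    using complex_root_unity[of l 1] l by (auto simp: \<zeta>_def)
  have \<zeta>1: "int l dvd j" if "\<zeta> powi j = 1" for j
  proof -
    have "\<zeta> powi j = \<zeta> ^ nat (j mod int l)"
    proof -
      have "\<zeta> powi j = \<zeta> powi (int l * (j div int l) + j mod int l)" by simp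
      also have "\<dots> = \<zeta> powi (int l * (j div int l)) * \<zeta> powi (j mod int l)"
        by (rule power_int_add) (use \<zeta>(2) in simp)
      also have "\<zeta> powi (int l * (j div int l)) = (\<zeta> ^ l) powi (j div int l)"
        by (simp add: power_int_mult)
      also have "(\<zeta> ^ l) powi (j div int l) * \<zeta> powi (j mod int l) = \<zeta> ^ nat (j mod int l)" using \<zeta> l by (simp add: power_int_def)
      finally show ?thesis .
    qed
    also have "\<dots> = exp (2 * of_real pi * \<i> * of_nat (nat (j mod int l)) / of_nat l)"
      by (simp add: \<zeta>_def exp_of_nat_mult[symmetric] mult_ac)
    finally have "exp (2 * of_real pi * \<i> * of_nat (nat (j mod int l)) / of_nat l) = 1" using that by simp
    hence "l dvd nat (j mod int l)" using complex_root_unity_eq_1[of l "nat (j mod int l)"] l by simp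
    moreover have "nat (j mod int l) < l" using l by (simp add: nat_less_iff)
    ultimately have "nat (j mod int l) = 0" by (metis dvd_imp_le not_le zero_less_iff_neq_zero)
    hence "j mod int l = 0" using l by (simp add: nat_eq_iff)
    thus ?thesis by (simp add: dvd_eq_mod_eq_0)
  qed
  \<comment> \<open>Comparison of the normal forms of a function and of its translate by the root of unity.\<close>
  have pz: "mpol_eval x (p i) * (\<zeta> powi (- int m * int i) - \<zeta> powi k) = 0"
    if x: "mpol_eval x f \<noteq> 0" and i: "i < l" for x i
  proof (rule vanishes_at_roots[OF l(1) _ _ i, where a = "\<lambda>i. mpol_eval x (p i) * (\<zeta> powi (- int m * int i) - \<zeta> powi k)"])
    show "inverse (mpol_eval x f) \<noteq> 0" using x by simp
    fix t assume "t ^ l = inverse (mpol_eval x f)"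
    hence on: "on_hypersurface f l t x" using x on_hypersurface_root[OF l(1)] by blast
    hence t: "t \<noteq> 0" by (simp add: on_hypersurface_def)
    have on': "on_hypersurface f l (translate_t \<zeta> t) x"
      using on_hypersurface_translate[OF \<zeta>(2) on] by (simp add: \<zeta> action_one)
    have "(translate_t \<zeta> t) powi (- int l * int N) = (\<zeta> ^ l) powi (int m * int N) * t powi (- int l * int N)"
      by (simp add: power_int_mult_distrib power_int_mult[symmetric] flip: power_int_of_nat) (simp add: mult_ac)
    hence tN: "(translate_t \<zeta> t) powi (- int l * int N) = t powi (- int l * int N)" by (simp add: \<zeta>)
    have "(\<Sum>i<l. mpol_eval x (p i) * (translate_t \<zeta> t) ^ i)
       = \<zeta> powi k * leval t x u * t powi (- int l * int N)"
      using reduces_to_eval[OF red on'] u[OF \<zeta>(2) on] tN by (simp add: \<zeta> action_one)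
    also have "\<dots> = \<zeta> powi k * (\<Sum>i<l. mpol_eval x (p i) * t ^ i)"
      using reduces_to_eval[OF red on] by simp
    finally have "(\<Sum>i<l. mpol_eval x (p i) * (translate_t \<zeta> t) ^ i) - \<zeta> powi k * (\<Sum>i<l. mpol_eval x (p i) * t ^ i) = 0"
      by simp
    moreover have e: "(translate_t \<zeta> t) ^ i = \<zeta> powi (- int m * int i) * t ^ i" for i
      using power_int_mult[of \<zeta> "- int m" "int i"] by (simp add: power_mult_distrib)
    ultimately show "(\<Sum>i<l. mpol_eval x (p i) * (\<zeta> powi (- int m * int i) - \<zeta> powi k) * t ^ i) = 0"
      unfolding e sum_distrib_left sum_subtractf[symmetric] by (simp only: algebra_simps)
  qed
  have ex: "\<exists>i0. \<forall>i<l. i \<noteq> i0 \<longrightarrow> (\<forall>x. mpol_eval x f \<noteq> 0 \<longrightarrow> mpol_eval x (p i) = 0)"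
  proof (rule ccontr)
    assume no: "\<not> ?thesis"
    have cong: "int l dvd int m * int i + k" if "i < l" "mpol_eval x f \<noteq> 0" "mpol_eval x (p i) \<noteq> 0" for i x
    proof -
      have "\<zeta> powi (- int m * int i) = \<zeta> powi k" using pz[OF that(2,1)] that(3) by simp
      hence "\<zeta> powi (int m * int i + k) = \<zeta> powi (int m * int i) * \<zeta> powi (- int m * int i)"
        using \<zeta>(2) by (simp add: power_int_add)
      also have "\<dots> = 1" using \<zeta>(2) by (simp add: power_int_add[symmetric])
      finally show ?thesis by (rule \<zeta>1)
    qed
    obtain i x where i: "i < l" "mpol_eval x f \<noteq> 0" "mpol_eval x (p i) \<noteq> 0" using no by blast
    obtain i' x' where i': "i' < l" "i' \<noteq> i" "mpol_eval x' f \<noteq> 0" "mpol_eval x' (p i') \<noteq> 0" using no by blast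
    have "int l dvd (int m * int i + k) - (int m * int i' + k)"
      using cong i i' by (intro dvd_diff) auto
    hence "int l dvd (int i - int i') * int m" by (simp add: algebra_simps)
    hence "int l dvd int i - int i'" using l(2) by (simp add: coprime_dvd_mult_left_iff)
    moreover have "\<bar>int i - int i'\<bar> < int l" using i(1) i'(1) by linarith
    ultimately show False using i'(2) dvd_imp_le_int[of "int i - int i'" "int l"] by linarith
  qed
  then obtain i0 where i0: "\<And>i x. i < l \<Longrightarrow> i \<noteq> i0 \<Longrightarrow> mpol_eval x f \<noteq> 0 \<Longrightarrow> mpol_eval x (p i) = 0" by blast
  define b where "b = (if i0 < l then p i0 else 0)"
  have "leval t x u = mpol_eval x b * t powi (int i0 + int l * int N)"
    if on: "on_hypersurface f l t x" for t x
  proof -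
    have t: "t \<noteq> 0" and x: "mpol_eval x f \<noteq> 0" using on by (auto simp: on_hypersurface_def)
    have "(\<Sum>i<l. mpol_eval x (p i) * t ^ i) = (\<Sum>i<l. if i = i0 then mpol_eval x (p i0) * t ^ i0 else 0)"
      by (rule sum.cong) (auto simp: i0 x)
    also have "\<dots> = mpol_eval x b * t ^ i0"
      by (auto simp: b_def ring_morphism.zero[OF mpol_eval_morphism])
    finally have "leval t x u * t powi (- int l * int N) = mpol_eval x b * t ^ i0"
      using reduces_to_eval[OF red on] by simp
    hence eq: "leval t x u * (t powi (- int l * int N) * t powi (int l * int N)) = mpol_eval x b * (t powi (int i0) * t powi (int l * int N))"
      by (simp add: mult.assoc[symmetric])
    have one: "t powi (- int l * int N) * t powi (int l * int N) = 1"
      using t by (simp add: power_int_minus)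
    show ?thesis using eq[unfolded one] t by (simp add: power_int_add)
  qed
  thus ?thesis by blast
qed

lemma weight_component_form:
  assumes "l \<ge> 1" "coprime l m" "weight_components l u q"
  obtains b e where "\<And>t x. on_hypersurface f l t x \<Longrightarrow> leval t x (lookup q k) = mpol_eval x b * t powi e"
proof -
  have "\<exists>b e. \<forall>t x. on_hypersurface f l t x \<longrightarrow> leval t x (lookup q k) = mpol_eval x b * t powi e"
    by (rule homogeneous_form[OF assms(1,2), where k = k])
      (simp add: weight_component_homogeneous[OF assms(3)] on_hypersurface_def)
  thus ?thesis using that by blast
qed

text \<open>
  By their special form, the nonvanishing of homogeneous functions is a condition on \<open>x\<close> alone,
  given by nonzero polynomials. The product of two of them with \<open>f\<close> is still nonzero.
\<close>
lemma weight_components_common_nonzero: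
  assumes l: "l \<ge> 1" "coprime l m"
    and q: "weight_components l u q" "on_hypersurface f l t1 x1" "leval t1 x1 (lookup q k) \<noteq> 0"
    and r: "weight_components l v r" "on_hypersurface f l t2 x2" "leval t2 x2 (lookup r j) \<noteq> 0"
  obtains t x where "on_hypersurface f l t x" "leval t x (lookup q k) \<noteq> 0" "leval t x (lookup r j) \<noteq> 0"
proof -
  obtain b e where b: "\<And>t x. on_hypersurface f l t x \<Longrightarrow> leval t x (lookup q k) = mpol_eval x b * t powi e"
    by (rule weight_component_form[OF l q(1)]) (rule that)
  obtain c d where c: "\<And>t x. on_hypersurface f l t x \<Longrightarrow> leval t x (lookup r j) = mpol_eval x c * t powi d"
    by (rule weight_component_form[OF l r(1)]) (rule that)
  have "mpol_eval x1 b \<noteq> 0" "mpol_eval x2 c \<noteq> 0" using b[OF q(2)] q(3) c[OF r(2)] r(3) by auto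
  hence "b \<noteq> 0" "c \<noteq> 0" by (auto simp: ring_morphism.zero[OF mpol_eval_morphism])
  hence "b * c * f \<noteq> 0" using f_nonzero mpol_no_zero_divisors by blast
  then obtain x where "mpol_eval x (b * c * f) \<noteq> 0" by (rule mpol_eval_nonzero)
  hence x: "mpol_eval x b \<noteq> 0" "mpol_eval x c \<noteq> 0" "mpol_eval x f \<noteq> 0"
    by (auto simp: ring_morphism.mult[OF mpol_eval_morphism])
  obtain t where t: "on_hypersurface f l t x" using on_hypersurface_exists[OF l(1) x(3)] by metis
  hence "t \<noteq> 0" by (simp add: on_hypersurface_def)
  thus ?thesis using that[OF t] b[OF t] c[OF t] x by simp
qed

text \<open>
  A graded ring is a domain as soon as products of nonzero homogeneous elements are nonzero.
\<close>
theorem vanishing_ideal_prime: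
  assumes l: "l \<ge> 1" "coprime l m"
    and uv: "\<And>t x. on_hypersurface f l t x \<Longrightarrow> leval t x u * leval t x v = 0"
  shows "(\<forall>t x. on_hypersurface f l t x \<longrightarrow> leval t x u = 0) \<or>
    (\<forall>t x. on_hypersurface f l t x \<longrightarrow> leval t x v = 0)"
proof (rule ccontr)
  assume "\<not> ?thesis"
  then obtain t1 x1 t2 x2 where 1: "on_hypersurface f l t1 x1" "leval t1 x1 u \<noteq> 0"
    and 2: "on_hypersurface f l t2 x2" "leval t2 x2 v \<noteq> 0" by blast
  have t12: "t1 \<noteq> 0" "t2 \<noteq> 0" using 1 2 by (auto simp: on_hypersurface_def)
  obtain q where q: "weight_components l u q" using weight_components_exist by blast
  obtain r where r: "weight_components l v r" using weight_components_exist by blast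
  obtain k where k: "k \<in> keys q" "leval t1 x1 (lookup q k) \<noteq> 0"
    using 1(2) weight_components_sum[OF q t12(1)] by (metis (no_types, lifting) sum.neutral)
  obtain j where j: "j \<in> keys r" "leval t2 x2 (lookup r j) \<noteq> 0"
    using 2(2) weight_components_sum[OF r t12(2)] by (metis (no_types, lifting) sum.neutral)
  obtain t x where tx: "on_hypersurface f l t x" "leval t x (lookup q k) \<noteq> 0" "leval t x (lookup r j) \<noteq> 0"
    by (rule weight_components_common_nonzero[OF l q 1(1) k(2) r 2(1) j(2)])
  have t: "t \<noteq> 0" using tx by (simp add: on_hypersurface_def)
  \<comment> \<open>Along the orbit of this point both functions are nonzero Laurent polynomials in the parameter.\<close>
  show False
  proof (rule laurent_product_zero[where a = "\<lambda>k. leval t x (lookup q k)"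
        and b = "\<lambda>k. leval t x (lookup r k)", OF _ _ _ k(1) tx(2) j(1) tx(3)])
    fix s :: complex assume s: "s \<noteq> 0"
    show "(\<Sum>k\<in>keys q. leval t x (lookup q k) * s powi k) * (\<Sum>k\<in>keys r. leval t x (lookup r k) * s powi k) = 0"
      using uv[OF on_hypersurface_translate[OF s tx(1)]]
      by (simp only: weight_components_translate[OF q s t] weight_components_translate[OF r s t])
  qed auto
qed

text \<open>
  The action rescales \<open>f\<close> by all nonzero numbers, since \<open>m\<close> is positive.
\<close>
lemma hypersurface_nonempty_over:
  assumes "t \<noteq> 0"
  obtains x where "on_hypersurface f l t x"
proof -
  obtain y where y: "mpol_eval y f \<noteq> 0" using mpol_eval_nonzero[OF f_nonzero] .
  obtain s where s: "s ^ m = inverse (t ^ l * mpol_eval y f)" "s \<noteq> 0"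
    using complex_root_exists[OF m, of "inverse (t ^ l * mpol_eval y f)"] y assms by auto
  have "on_hypersurface f l t (\<mu> s y)" using s y assms by (simp add: on_hypersurface_def eval_action field_simps)
  thus ?thesis by (rule that)
qed

text \<open>
  Units of a graded domain are homogeneous.
\<close>
lemma unit_homogeneous_form:
  assumes l: "l \<ge> 1" "coprime l m"
    and uv: "\<And>t x. on_hypersurface f l t x \<Longrightarrow> leval t x u * leval t x v = 1"
  shows "\<exists>b e. \<forall>t x. on_hypersurface f l t x \<longrightarrow> leval t x u = mpol_eval x b * t powi e"
proof -
  obtain q where q: "weight_components l u q" using weight_components_exist by blast
  obtain r where r: "weight_components l v r" using weight_components_exist by blast
  \<comment> \<open>Along an orbit a unit becomes a unit of the ring of Laurent polynomials, hence a monomial.\<close>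
  have uniq: "k = k'"
    if k: "k \<in> keys q" "on_hypersurface f l t1 x1" "leval t1 x1 (lookup q k) \<noteq> 0"
      and k': "k' \<in> keys q" "on_hypersurface f l t2 x2" "leval t2 x2 (lookup q k') \<noteq> 0"
    for k k' t1 x1 t2 x2
  proof -
    obtain t x where tx: "on_hypersurface f l t x" "leval t x (lookup q k) \<noteq> 0" "leval t x (lookup q k') \<noteq> 0"
      by (rule weight_components_common_nonzero[OF l q k(2,3) q k'(2,3)])
    have t: "t \<noteq> 0" using tx by (simp add: on_hypersurface_def)
    show ?thesis
    proof (rule laurent_product_one[where a = "\<lambda>k. leval t x (lookup q k)"
          and b = "\<lambda>k. leval t x (lookup r k)", OF _ _ _ k(1) k'(1) tx(2,3)])
      fix s :: complex assume s: "s \<noteq> 0"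
      show "(\<Sum>k\<in>keys q. leval t x (lookup q k) * s powi k) * (\<Sum>k\<in>keys r. leval t x (lookup r k) * s powi k) = 1"
        using uv[OF on_hypersurface_translate[OF s tx(1)]]
        by (simp only: weight_components_translate[OF q s t] weight_components_translate[OF r s t])
    qed auto
  qed
  obtain x1 where x1: "on_hypersurface f l 1 x1" using hypersurface_nonempty_over[of 1] by auto
  have "leval 1 x1 u \<noteq> 0" using uv[OF x1] by auto
  then obtain k where k: "k \<in> keys q" "leval 1 x1 (lookup q k) \<noteq> 0"
    using weight_components_sum[OF q, of 1 x1] by (metis (no_types, lifting) sum.neutral zero_neq_one)
  have "leval t x u = leval t x (lookup q k)" if on: "on_hypersurface f l t x" for t x
  proof -
    have t: "t \<noteq> 0" using on by (simp add: on_hypersurface_def)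
    have "leval t x u = (\<Sum>j\<in>keys q. if j = k then leval t x (lookup q k) else 0)"
      unfolding weight_components_sum[OF q t] by (rule sum.cong) (use uniq[OF _ on _ k(1) x1 k(2)] in auto)
    thus ?thesis using k(1) by simp
  qed
  moreover obtain b e where "\<And>t x. on_hypersurface f l t x \<Longrightarrow> leval t x (lookup q k) = mpol_eval x b * t powi e"
    by (rule weight_component_form[OF l q]) (rule that)
  ultimately show ?thesis by metis
qed

text \<open>
  The polynomial \<open>b\<close> in a unit \<open>b(x) t\<^sup>e\<close> divides a power of \<open>f\<close>, hence is itself a constant
  times a power of \<open>f\<close>, and \<open>f\<close> is \<open>t\<^sup>-\<^sup>l\<close> on the hypersurface.
\<close>
theorem units_on_hypersurface:
  assumes l: "l \<ge> 1" "coprime l m"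
    and uv: "\<And>t x. on_hypersurface f l t x \<Longrightarrow> leval t x u * leval t x v = 1"
  shows "\<exists>c j. \<forall>t x. on_hypersurface f l t x \<longrightarrow> leval t x u = c * t powi j"
proof -
  obtain b e where b: "\<And>t x. on_hypersurface f l t x \<Longrightarrow> leval t x u = mpol_eval x b * t powi e"
    using unit_homogeneous_form[OF l uv] by blast
  have vu: "leval t x v * leval t x u = 1" if "on_hypersurface f l t x" for t x
    using uv[OF that] by (simp add: mult.commute)
  obtain b' e' where b': "\<And>t x. on_hypersurface f l t x \<Longrightarrow> leval t x v = mpol_eval x b' * t powi e'"
    using unit_homogeneous_form[OF l vu] by blast
  \<comment> \<open>The \<open>l\<close>-th power of \<open>b b' t\<^sup>g = 1\<close> involves only \<open>t\<^sup>l = 1/f\<close>; \<open>A\<close> and \<open>C\<close> clear the possible denominators.\<close>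
  define g where "g = e + e'"
  define A where "A = nat (- g)"
  define C where "C = nat g"
  have key: "mpol_eval x ((b * b') ^ l * f ^ A) = mpol_eval x (f ^ C)" if x: "mpol_eval x f \<noteq> 0" for x
  proof -
    obtain t where t: "on_hypersurface f l t x" using on_hypersurface_exists[OF l(1) x] by metis
    have t0: "t \<noteq> 0" using t by (simp add: on_hypersurface_def)
    have "mpol_eval x b * mpol_eval x b' * t powi g = 1"
      using uv[OF t] b[OF t] b'[OF t] t0 by (simp add: g_def power_int_add mult_ac)
    hence "(mpol_eval x b * mpol_eval x b') ^ l * (t powi g) ^ l = 1" by (metis power_mult_distrib power_one)
    moreover have "(t powi g) ^ l = (t ^ l) powi g"
      using power_int_mult[of t g "int l"] power_int_mult[of t "int l" g] by (simp add: mult.commute)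
    moreover have "t ^ l = inverse (mpol_eval x f)" using t on_hypersurface_root[OF l(1)] by blast
    ultimately have 1: "(mpol_eval x b * mpol_eval x b') ^ l * mpol_eval x f powi (- g) = 1"
      by (simp add: power_int_inverse power_int_minus)
    have "mpol_eval x f powi (- g) * mpol_eval x f ^ C = mpol_eval x f ^ A"
      using x by (cases "g \<ge> 0") (auto simp: A_def C_def power_int_def field_simps)
    hence "(mpol_eval x b * mpol_eval x b') ^ l * mpol_eval x f ^ A =
      ((mpol_eval x b * mpol_eval x b') ^ l * mpol_eval x f powi (- g)) * mpol_eval x f ^ C" by simp
    hence "(mpol_eval x b * mpol_eval x b') ^ l * mpol_eval x f ^ A = mpol_eval x f ^ C" by (simp only: 1 mult_1)
    thus ?thesis by (simp add: ring_morphism.mult[OF mpol_eval_morphism] ring_morphism.power[OF mpol_eval_morphism])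
  qed
  have "(b * b') ^ l * f ^ A - f ^ C = 0"
    by (rule mpol_eq_0_if_vanishes_off[OF f_nonzero]) (simp add: ring_morphism.diff[OF mpol_eval_morphism] key)
  hence "(b * b') ^ l * f ^ A = f ^ C" by simp
  moreover have "(b * b') ^ l = b * (b ^ (l - 1) * b' ^ l)"
    using l(1) by (cases l) (simp_all add: power_mult_distrib mult.assoc)
  ultimately have "b * (b ^ (l - 1) * b' ^ l * f ^ A) = f ^ C" by (simp add: mult.assoc)
  from divisor_of_irreducible_power[OF irreducible this] obtain c k where
    ck: "\<And>x. mpol_eval x b = c * mpol_eval x f ^ k" by blast
  have "leval t x u = c * t powi (e - int l * int k)" if on: "on_hypersurface f l t x" for t x
  proof -
    have t: "t \<noteq> 0" using on by (simp add: on_hypersurface_def)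
    have "mpol_eval x f = inverse (t ^ l)" using on on_hypersurface_root[OF l(1), of f t x] by simp
    hence "mpol_eval x f ^ k = t powi (- (int l * int k))"
      by (simp add: power_int_minus power_int_mult power_inverse)
    thus ?thesis using t by (simp add: b[OF on] ck power_int_diff power_int_minus field_simps)
  qed
  thus ?thesis by blast
qed

end

section \<open>Isomorphic rings have isomorphic spectra\<close>

lemma primeideal_subset: "primeideal P R \<Longrightarrow> P \<subseteq> carrier R"
  by (meson additive_subgroup.a_subset ideal.axioms(1) primeideal.axioms(1))

text \<open>
  By Zorn's lemma a proper ideal lies in a maximal one, which is prime.
\<close>
lemma (in cring) ideal_eq_carrier_if_no_prime:
  assumes I: "ideal I R" and no: "\<And>P. primeideal P R \<Longrightarrow> \<not> I \<subseteq> P"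
  shows "I = carrier R"
proof (rule ccontr)
  assume ne: "I \<noteq> carrier R"
  have sub: "J \<subseteq> carrier R" if "ideal J R" for J
    using that by (meson additive_subgroup.a_subset ideal.axioms(1))
  have one: "J = carrier R \<longleftrightarrow> \<one> \<in> J" if "ideal J R" for J
    using ideal.one_imp_carrier[OF that] by auto
  define A where "A = {J. ideal J R \<and> I \<subseteq> J \<and> J \<noteq> carrier R}"
  have "\<exists>M\<in>A. \<forall>J\<in>A. M \<subseteq> J \<longrightarrow> J = M"
  proof (rule subset_Zorn_nonempty)
    show "A \<noteq> {}" using I ne by (auto simp: A_def)
    fix C assume C: "C \<noteq> {}" "subset.chain A C"
    have CA: "C \<subseteq> A" using C(2) by (simp add: subset.chain_def)
    have "subset.chain {I. ideal I R} C" using C(2) by (auto simp: subset.chain_def A_def)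
    hence id: "ideal (\<Union>C) R" using chain_Union_is_ideal[of C] C(1) by simp
    moreover have "\<one> \<notin> \<Union>C" using CA one by (auto simp: A_def)
    moreover have "I \<subseteq> \<Union>C" using CA C(1) by (auto simp: A_def)
    ultimately show "\<Union>C \<in> A" using one by (auto simp: A_def)
  qed
  then obtain M where M: "M \<in> A" "\<And>J. J \<in> A \<Longrightarrow> M \<subseteq> J \<Longrightarrow> J = M" by blast
  have "maximalideal M R"
  proof (rule maximalidealI)
    fix J assume J: "ideal J R" "M \<subseteq> J" "J \<subseteq> carrier R"
    show "J = M \<or> J = carrier R" using M J by (auto simp: A_def)
  qed (use M in \<open>auto simp: A_def\<close>)
  hence "primeideal M R" by (rule maximalideal_prime)
  thus False using no M by (auto simp: A_def)
qed

lemma topspace_zariski: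
  fixes R (structure)
  assumes "cring R"
  shows "topspace (zariski_topology R) = prime_spectrum R"
proof -
  interpret cring R by fact
  have "\<one> \<notin> P" if "primeideal P R" for P
    using that by (metis ideal.one_imp_carrier primeideal.I_notcarr primeideal.axioms(1))
  hence "basic_open R \<one> = prime_spectrum R" by (auto simp: basic_open_def prime_spectrum_def)
  hence "prime_spectrum R \<subseteq> \<Union> (basic_open R ` carrier R)" using one_closed by blast
  moreover have "\<Union> (basic_open R ` carrier R) \<subseteq> prime_spectrum R" unfolding basic_open_def by blast
  ultimately show ?thesis unfolding zariski_topology_def topology_generated_by_topspace by (rule equalityI[rotated])
qed

lemma openin_zariski_subset: "cring R \<Longrightarrow> openin (zariski_topology R) V \<Longrightarrow> V \<subseteq> prime_spectrum R"
  using openin_subset topspace_zariski by metis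

lemma section_locally_fraction:
  assumes "\<sigma> \<in> carrier (structure_sheaf R V)" "P \<in> V"
  shows "\<exists>W a s. openin (zariski_topology R) W \<and> P \<in> W \<and> W \<subseteq> V \<and> a \<in> carrier R \<and> s \<in> carrier R \<and>
    (\<forall>Q\<in>W. s \<notin> Q \<and> \<sigma> Q = fraction R Q a s)"
proof -
  have "\<forall>P\<in>V. \<exists>W a s. openin (zariski_topology R) W \<and> P \<in> W \<and> W \<subseteq> V \<and> a \<in> carrier R \<and> s \<in> carrier R \<and>
    (\<forall>Q\<in>W. s \<notin> Q \<and> \<sigma> Q = fraction R Q a s)"
    using assms(1) by (simp add: structure_sheaf_def)
  thus ?thesis using assms(2) by (rule bspec)
qed

lemma Spec_fields:
  "underlying (Spec R \<iota>) = zariski_topology R"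
  "sections (Spec R \<iota>) = structure_sheaf R"
  "scalar (Spec R \<iota>) V c = (\<lambda>P\<in>V. fraction R P (\<iota> c) \<one>\<^bsub>R\<^esub>)"
  "restriction (Spec R \<iota>) V W \<sigma> = restrict \<sigma> W"
  by (simp_all add: Spec_def)

text \<open>
  Transport of structure: an isomorphism of rings carries primes, germs and sections from one
  spectrum to the other. The map of spectra goes in the opposite direction to the ring map.
\<close>
locale ring_isomorphism =
  fixes R :: "'a ring" (structure) and S :: "'b ring" and \<phi> :: "'a \<Rightarrow> 'b"
  assumes cR: "cring R" and cS: "cring S" and iso: "\<phi> \<in> ring_iso R S"
begin

definition pull :: "'b set \<Rightarrow> 'a set"
  where "pull Q = {r \<in> carrier R. \<phi> r \<in> Q}"

definition push_germ :: "('a \<times> 'a) set \<Rightarrow> ('b \<times> 'b) set"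
  where "push_germ A = map_prod \<phi> \<phi> ` A"

definition pull_open :: "'a set set \<Rightarrow> 'b set set"
  where "pull_open V = {Q \<in> prime_spectrum S. pull Q \<in> V}"

definition push_section :: "'a set set \<Rightarrow> ('a set \<Rightarrow> ('a \<times> 'a) set) \<Rightarrow> 'b set \<Rightarrow> ('b \<times> 'b) set"
  where "push_section V \<sigma> = (\<lambda>Q\<in>pull_open V. push_germ (\<sigma> (pull Q)))"

lemmas \<phi>_closed = ring_iso_memE(1)[OF iso]
lemmas \<phi>_mult = ring_iso_memE(2)[OF iso]
lemmas \<phi>_add = ring_iso_memE(3)[OF iso]
lemmas \<phi>_one = ring_iso_memE(4)[OF iso]
lemmas \<phi>_bij = ring_iso_memE(5)[OF iso]

lemma \<phi>_eq: "a \<in> carrier R \<Longrightarrow> b \<in> carrier R \<Longrightarrow> \<phi> a = \<phi> b \<longleftrightarrow> a = b"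
  using \<phi>_bij by (auto simp: bij_betw_def inj_on_def)

lemma \<phi>_surj: assumes "b \<in> carrier S" obtains a where "a \<in> carrier R" "\<phi> a = b"
proof -
  have "b \<in> \<phi> ` carrier R" using \<phi>_bij assms by (simp add: bij_betw_def)
  thus ?thesis using that by blast
qed

lemma pull_prime: "Q \<in> prime_spectrum S \<Longrightarrow> pull Q \<in> prime_spectrum R"
proof -
  assume Q: "Q \<in> prime_spectrum S"
  have "ring_hom_ring R S \<phi>"
    using iso cring.axioms(1)[OF cR] cring.axioms(1)[OF cS] by (intro ring_hom_ringI2) (auto simp: ring_iso_def)
  from ring_hom_ring.primeideal_vimage[OF this cR, of Q] Q show ?thesis by (simp add: prime_spectrum_def pull_def)
qed

lemma push_germ_fraction:
  assumes Q: "Q \<in> prime_spectrum S" and as: "a \<in> carrier R" "s \<in> carrier R"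
  shows "push_germ (fraction R (pull Q) a s) = fraction S Q (\<phi> a) (\<phi> s)"
proof -
  interpret R: cring R by (rule cR)
  interpret S: cring S by (rule cS)
  have e: "(\<exists>u\<in>carrier R - pull Q. u \<otimes> (a \<otimes> v) = u \<otimes> (b \<otimes> s)) \<longleftrightarrow>
    (\<exists>u\<in>carrier S - Q. u \<otimes>\<^bsub>S\<^esub> (\<phi> a \<otimes>\<^bsub>S\<^esub> \<phi> v) = u \<otimes>\<^bsub>S\<^esub> (\<phi> b \<otimes>\<^bsub>S\<^esub> \<phi> s))"
    if bv: "b \<in> carrier R" "v \<in> carrier R" for b v
  proof
    assume "\<exists>u\<in>carrier R - pull Q. u \<otimes> (a \<otimes> v) = u \<otimes> (b \<otimes> s)"
    then obtain u where u: "u \<in> carrier R - pull Q" "u \<otimes> (a \<otimes> v) = u \<otimes> (b \<otimes> s)" by blast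
    have "\<phi> u \<in> carrier S - Q" using u by (auto simp: pull_def \<phi>_closed)
    moreover have "\<phi> u \<otimes>\<^bsub>S\<^esub> (\<phi> a \<otimes>\<^bsub>S\<^esub> \<phi> v) = \<phi> u \<otimes>\<^bsub>S\<^esub> (\<phi> b \<otimes>\<^bsub>S\<^esub> \<phi> s)"
      using arg_cong[OF u(2), of \<phi>] u(1) as bv by (simp add: \<phi>_mult)
    ultimately show "\<exists>u\<in>carrier S - Q. u \<otimes>\<^bsub>S\<^esub> (\<phi> a \<otimes>\<^bsub>S\<^esub> \<phi> v) = u \<otimes>\<^bsub>S\<^esub> (\<phi> b \<otimes>\<^bsub>S\<^esub> \<phi> s)" by blast
  next
    assume "\<exists>u\<in>carrier S - Q. u \<otimes>\<^bsub>S\<^esub> (\<phi> a \<otimes>\<^bsub>S\<^esub> \<phi> v) = u \<otimes>\<^bsub>S\<^esub> (\<phi> b \<otimes>\<^bsub>S\<^esub> \<phi> s)"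
    then obtain u' where u': "u' \<in> carrier S - Q" "u' \<otimes>\<^bsub>S\<^esub> (\<phi> a \<otimes>\<^bsub>S\<^esub> \<phi> v) = u' \<otimes>\<^bsub>S\<^esub> (\<phi> b \<otimes>\<^bsub>S\<^esub> \<phi> s)" by blast
    obtain u where u: "u \<in> carrier R" "\<phi> u = u'" using u' \<phi>_surj by blast
    have "\<phi> (u \<otimes> (a \<otimes> v)) = \<phi> (u \<otimes> (b \<otimes> s))"
      using u' u as bv by (simp add: \<phi>_mult)
    hence "u \<otimes> (a \<otimes> v) = u \<otimes> (b \<otimes> s)" using u as bv by (subst (asm) \<phi>_eq) auto
    moreover have "u \<in> carrier R - pull Q" using u u' by (auto simp: pull_def)
    ultimately show "\<exists>u\<in>carrier R - pull Q. u \<otimes> (a \<otimes> v) = u \<otimes> (b \<otimes> s)" by blast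
  qed
  have mem: "(\<phi> b, \<phi> v) \<in> fraction S Q (\<phi> a) (\<phi> s) \<longleftrightarrow> (b, v) \<in> fraction R (pull Q) a s"
    if bv: "b \<in> carrier R" "v \<in> carrier R" for b v
    using e[OF bv] bv by (auto simp: fraction_def \<phi>_closed pull_def)
  show ?thesis
  proof (intro equalityI subsetI)
    fix z assume "z \<in> push_germ (fraction R (pull Q) a s)"
    then obtain b v where bv: "z = (\<phi> b, \<phi> v)" "(b, v) \<in> fraction R (pull Q) a s" by (auto simp: push_germ_def)
    moreover have "b \<in> carrier R" "v \<in> carrier R" using bv by (auto simp: fraction_def)
    ultimately show "z \<in> fraction S Q (\<phi> a) (\<phi> s)" using mem by blast
  next
    fix z assume z: "z \<in> fraction S Q (\<phi> a) (\<phi> s)"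
    then obtain b' v' where z': "z = (b', v')" "b' \<in> carrier S" "v' \<in> carrier S" by (auto simp: fraction_def)
    obtain b v where bv: "b \<in> carrier R" "v \<in> carrier R" "b' = \<phi> b" "v' = \<phi> v"
      using z' \<phi>_surj by metis
    hence "(b, v) \<in> fraction R (pull Q) a s" using z z' mem by blast
    thus "z \<in> push_germ (fraction R (pull Q) a s)" using z' bv by (force simp: push_germ_def)
  qed
qed

lemma germ_subset: "A \<in> carrier (localization_at R P) \<Longrightarrow> A \<subseteq> carrier R \<times> carrier R"
  by (auto simp: localization_at_def fraction_def)

lemma push_germ_mult:
  assumes Q: "Q \<in> prime_spectrum S" and A: "A \<subseteq> carrier R \<times> carrier R" and B: "B \<subseteq> carrier R \<times> carrier R"
  shows "push_germ (A \<otimes>\<^bsub>localization_at R (pull Q)\<^esub> B) = push_germ A \<otimes>\<^bsub>localization_at S Q\<^esub> push_germ B"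
    and "push_germ (A \<oplus>\<^bsub>localization_at R (pull Q)\<^esub> B) = push_germ A \<oplus>\<^bsub>localization_at S Q\<^esub> push_germ B"
proof -
  interpret R: cring R by (rule cR)
  have U: "push_germ (\<Union>x\<in>A. \<Union>y\<in>B. F x y) = (\<Union>x\<in>A. \<Union>y\<in>B. push_germ (F x y))" for F
    by (auto simp: push_germ_def)
  have m: "push_germ (fraction R (pull Q) (a \<otimes> b) (s \<otimes> v)) = fraction S Q (\<phi> a \<otimes>\<^bsub>S\<^esub> \<phi> b) (\<phi> s \<otimes>\<^bsub>S\<^esub> \<phi> v)"
    and p: "push_germ (fraction R (pull Q) ((a \<otimes> v) \<oplus> (b \<otimes> s)) (s \<otimes> v))
      = fraction S Q ((\<phi> a \<otimes>\<^bsub>S\<^esub> \<phi> v) \<oplus>\<^bsub>S\<^esub> (\<phi> b \<otimes>\<^bsub>S\<^esub> \<phi> s)) (\<phi> s \<otimes>\<^bsub>S\<^esub> \<phi> v)"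
    if "(a, s) \<in> A" "(b, v) \<in> B" for a s b v
  proof -
    have "a \<in> carrier R" "s \<in> carrier R" "b \<in> carrier R" "v \<in> carrier R" using that A B by auto
    thus "push_germ (fraction R (pull Q) (a \<otimes> b) (s \<otimes> v)) = fraction S Q (\<phi> a \<otimes>\<^bsub>S\<^esub> \<phi> b) (\<phi> s \<otimes>\<^bsub>S\<^esub> \<phi> v)"
      "push_germ (fraction R (pull Q) ((a \<otimes> v) \<oplus> (b \<otimes> s)) (s \<otimes> v))
      = fraction S Q ((\<phi> a \<otimes>\<^bsub>S\<^esub> \<phi> v) \<oplus>\<^bsub>S\<^esub> (\<phi> b \<otimes>\<^bsub>S\<^esub> \<phi> s)) (\<phi> s \<otimes>\<^bsub>S\<^esub> \<phi> v)"
      by (simp_all add: push_germ_fraction[OF Q] \<phi>_mult \<phi>_add)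
  qed
  show "push_germ (A \<otimes>\<^bsub>localization_at R (pull Q)\<^esub> B) = push_germ A \<otimes>\<^bsub>localization_at S Q\<^esub> push_germ B"
  proof -
    have "push_germ (A \<otimes>\<^bsub>localization_at R (pull Q)\<^esub> B) =
      (\<Union>x\<in>A. \<Union>y\<in>B. push_germ (fraction R (pull Q) (fst x \<otimes> fst y) (snd x \<otimes> snd y)))"
      by (simp add: localization_at_def split_beta U)
    also have "\<dots> = (\<Union>x\<in>A. \<Union>y\<in>B. fraction S Q (\<phi> (fst x) \<otimes>\<^bsub>S\<^esub> \<phi> (fst y)) (\<phi> (snd x) \<otimes>\<^bsub>S\<^esub> \<phi> (snd y)))"
      by (intro SUP_cong refl m) simp_all
    also have "\<dots> = push_germ A \<otimes>\<^bsub>localization_at S Q\<^esub> push_germ B"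
      by (simp add: localization_at_def split_beta push_germ_def)
    finally show ?thesis .
  qed
  show "push_germ (A \<oplus>\<^bsub>localization_at R (pull Q)\<^esub> B) = push_germ A \<oplus>\<^bsub>localization_at S Q\<^esub> push_germ B"
  proof -
    have "push_germ (A \<oplus>\<^bsub>localization_at R (pull Q)\<^esub> B) =
      (\<Union>x\<in>A. \<Union>y\<in>B. push_germ (fraction R (pull Q)
        ((fst x \<otimes> snd y) \<oplus> (fst y \<otimes> snd x)) (snd x \<otimes> snd y)))"
      by (simp add: localization_at_def split_beta U)
    also have "\<dots> = (\<Union>x\<in>A. \<Union>y\<in>B. fraction S Q
        ((\<phi> (fst x) \<otimes>\<^bsub>S\<^esub> \<phi> (snd y)) \<oplus>\<^bsub>S\<^esub> (\<phi> (fst y) \<otimes>\<^bsub>S\<^esub> \<phi> (snd x))) (\<phi> (snd x) \<otimes>\<^bsub>S\<^esub> \<phi> (snd y)))"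
      by (intro SUP_cong refl p) simp_all
    also have "\<dots> = push_germ A \<oplus>\<^bsub>localization_at S Q\<^esub> push_germ B"
      by (simp add: localization_at_def split_beta push_germ_def)
    finally show ?thesis .
  qed
qed

lemma push_germ_one: "Q \<in> prime_spectrum S \<Longrightarrow> push_germ \<one>\<^bsub>localization_at R (pull Q)\<^esub> = \<one>\<^bsub>localization_at S Q\<^esub>"
  by (simp add: localization_at_def push_germ_fraction \<phi>_one cring.axioms[OF cR] ring.ring_simprules(6) cR cring.cring_simprules)

lemma pull_basic_open: "a \<in> carrier R \<Longrightarrow> pull_open (basic_open R a) = basic_open S (\<phi> a)"
  by (auto simp: pull_open_def basic_open_def pull_prime) (auto simp: pull_def)

lemma continuous_pull: "continuous_map (zariski_topology S) (zariski_topology R) pull"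
  unfolding zariski_topology_def[of R]
proof (rule continuous_on_generated_topo)
  fix U assume "U \<in> basic_open R ` carrier R"
  then obtain a where a: "a \<in> carrier R" "U = basic_open R a" by blast
  have "pull -` U \<inter> topspace (zariski_topology S) = basic_open S (\<phi> a)"
    using pull_basic_open[OF a(1)] by (auto simp: a topspace_zariski[OF cS] pull_open_def)
  thus "openin (zariski_topology S) (pull -` U \<inter> topspace (zariski_topology S))"
    using \<phi>_closed[OF a(1)] by (simp add: zariski_topology_def topology_generated_by_Basis)
next
  have "pull ` prime_spectrum S \<subseteq> prime_spectrum R" using pull_prime by blast
  thus "pull ` topspace (zariski_topology S) \<subseteq> \<Union> (basic_open R ` carrier R)"
    using topspace_zariski[OF cR] unfolding topspace_zariski[OF cS] zariski_topology_def[of R] by simp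
qed

lemma openin_pull_open: "openin (zariski_topology R) V \<Longrightarrow> openin (zariski_topology S) (pull_open V)"
  using openin_continuous_map_preimage[OF continuous_pull] by (simp add: pull_open_def topspace_zariski[OF cS])

lemma push_section_closed:
  assumes V: "openin (zariski_topology R) V" and \<sigma>: "\<sigma> \<in> carrier (structure_sheaf R V)"
  shows "push_section V \<sigma> \<in> carrier (structure_sheaf S (pull_open V))"
proof -
  have \<sigma>1: "\<sigma> P \<in> carrier (localization_at R P)" if "P \<in> V" for P
    using \<sigma> that by (auto simp: structure_sheaf_def)
  have 1: "push_germ (\<sigma> (pull Q)) \<in> carrier (localization_at S Q)" if Q: "Q \<in> pull_open V" for Q
  proof -
    have Q': "Q \<in> prime_spectrum S" "pull Q \<in> V" using Q by (auto simp: pull_open_def)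
    obtain a s where as: "\<sigma> (pull Q) = fraction R (pull Q) a s" "a \<in> carrier R" "s \<in> carrier R - pull Q"
      using \<sigma>1[OF Q'(2)] by (auto simp: localization_at_def)
    hence "push_germ (\<sigma> (pull Q)) = fraction S Q (\<phi> a) (\<phi> s)" using push_germ_fraction[OF Q'(1)] by simp
    moreover have "\<phi> a \<in> carrier S" "\<phi> s \<in> carrier S - Q" using as by (auto simp: \<phi>_closed pull_def)
    ultimately show ?thesis by (auto simp: localization_at_def)
  qed
  have 2: "\<exists>W a s. openin (zariski_topology S) W \<and> Q \<in> W \<and> W \<subseteq> pull_open V \<and>
         a \<in> carrier S \<and> s \<in> carrier S \<and> (\<forall>Q'\<in>W. s \<notin> Q' \<and> push_section V \<sigma> Q' = fraction S Q' a s)"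
    if Q: "Q \<in> pull_open V" for Q
  proof -
    have Q': "Q \<in> prime_spectrum S" "pull Q \<in> V" using Q by (auto simp: pull_open_def)
    then obtain W a s where W: "openin (zariski_topology R) W" "pull Q \<in> W" "W \<subseteq> V" "a \<in> carrier R" "s \<in> carrier R"
      "\<forall>P\<in>W. s \<notin> P \<and> \<sigma> P = fraction R P a s" using section_locally_fraction[OF \<sigma> Q'(2)] by metis
    have "\<phi> s \<notin> Q' \<and> push_section V \<sigma> Q' = fraction S Q' (\<phi> a) (\<phi> s)" if "Q' \<in> pull_open W" for Q'
    proof -
      have q: "Q' \<in> prime_spectrum S" "pull Q' \<in> W" "Q' \<in> pull_open V" using that W(3) by (auto simp: pull_open_def)
      thus ?thesis using W by (simp add: push_section_def push_germ_fraction) (auto simp: pull_def)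
    qed
    moreover have "Q \<in> pull_open W" "pull_open W \<subseteq> pull_open V" using Q' W by (auto simp: pull_open_def)
    ultimately show ?thesis using openin_pull_open[OF W(1)] \<phi>_closed W(4,5) by blast
  qed
  show ?thesis unfolding structure_sheaf_def using 1 2 by (auto simp: push_section_def)
qed

lemma section_germ: "\<sigma> \<in> carrier (structure_sheaf R V) \<Longrightarrow> P \<in> V \<Longrightarrow> \<sigma> P \<subseteq> carrier R \<times> carrier R"
  using germ_subset[of "\<sigma> P" P] by (auto simp: structure_sheaf_def)

lemma push_section_hom:
  assumes V: "openin (zariski_topology R) V"
  shows "push_section V \<in> ring_hom (structure_sheaf R V) (structure_sheaf S (pull_open V))"
proof (rule ring_hom_memI)
  fix \<sigma> \<tau> assume s: "\<sigma> \<in> carrier (structure_sheaf R V)" "\<tau> \<in> carrier (structure_sheaf R V)"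
  show "push_section V (\<sigma> \<otimes>\<^bsub>structure_sheaf R V\<^esub> \<tau>) =
     push_section V \<sigma> \<otimes>\<^bsub>structure_sheaf S (pull_open V)\<^esub> push_section V \<tau>"
    using section_germ[OF s(1)] section_germ[OF s(2)]
    by (auto simp: structure_sheaf_def push_section_def pull_open_def push_germ_mult intro!: restrict_ext)
  show "push_section V (\<sigma> \<oplus>\<^bsub>structure_sheaf R V\<^esub> \<tau>) =
     push_section V \<sigma> \<oplus>\<^bsub>structure_sheaf S (pull_open V)\<^esub> push_section V \<tau>"
    using section_germ[OF s(1)] section_germ[OF s(2)]
    by (auto simp: structure_sheaf_def push_section_def pull_open_def push_germ_mult intro!: restrict_ext)
next
  show "push_section V \<one>\<^bsub>structure_sheaf R V\<^esub> = \<one>\<^bsub>structure_sheaf S (pull_open V)\<^esub>"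
    by (auto simp: structure_sheaf_def push_section_def pull_open_def push_germ_one intro!: restrict_ext)
qed (rule push_section_closed[OF V])

end

context ring_isomorphism
begin

interpretation inverse: ring_isomorphism S R "inv_into (carrier R) \<phi>"
  by (intro ring_isomorphism.intro cS cR ring_iso_set_sym[OF cring.axioms(1)[OF cR] iso])

lemma inv_\<phi> [simp]: "r \<in> carrier R \<Longrightarrow> inv_into (carrier R) \<phi> (\<phi> r) = r"
  using \<phi>_bij by (simp add: bij_betw_def)

lemma \<phi>_inv [simp]: "s \<in> carrier S \<Longrightarrow> \<phi> (inv_into (carrier R) \<phi> s) = s"
  using \<phi>_bij by (auto simp: bij_betw_def f_inv_into_f)

lemma pull_pull: "Q \<in> prime_spectrum S \<Longrightarrow> inverse.pull (pull Q) = Q"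
  using primeideal_subset[of Q S]
  by (auto simp: inverse.pull_def pull_def prime_spectrum_def inverse.\<phi>_closed)

lemma pull_pull': "P \<in> prime_spectrum R \<Longrightarrow> pull (inverse.pull P) = P"
  using primeideal_subset[of P R]
  by (auto simp: inverse.pull_def pull_def prime_spectrum_def \<phi>_closed)

lemma push_push: "A \<subseteq> carrier R \<times> carrier R \<Longrightarrow> inverse.push_germ (push_germ A) = A"
  unfolding inverse.push_germ_def push_germ_def image_image by (rule trans[OF image_cong image_ident]) auto

lemma push_push': "A \<subseteq> carrier S \<times> carrier S \<Longrightarrow> push_germ (inverse.push_germ A) = A"
  unfolding inverse.push_germ_def push_germ_def image_image by (rule trans[OF image_cong image_ident]) auto

lemma pull_open_pull_open: "V \<subseteq> prime_spectrum R \<Longrightarrow> inverse.pull_open (pull_open V) = V"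
  by (auto simp: inverse.pull_open_def pull_open_def pull_pull' inverse.pull_prime)

lemma homeomorphic_pull: "homeomorphic_map (zariski_topology S) (zariski_topology R) pull"
proof (rule homeomorphic_maps_imp_map)
  show "homeomorphic_maps (zariski_topology S) (zariski_topology R) pull inverse.pull"
    unfolding homeomorphic_maps_def
    using continuous_pull inverse.continuous_pull
    by (auto simp: topspace_zariski[OF cR] topspace_zariski[OF cS] pull_pull pull_pull')
qed

lemma push_section_iso:
  assumes V: "openin (zariski_topology R) V"
  shows "push_section V \<in> ring_iso (structure_sheaf R V) (structure_sheaf S (pull_open V))"
proof -
  have VR: "V \<subseteq> prime_spectrum R" using openin_zariski_subset[OF cR V] .
  have W: "openin (zariski_topology S) (pull_open V)" by (rule openin_pull_open[OF V])
  have "bij_betw (push_section V) (carrier (structure_sheaf R V)) (carrier (structure_sheaf S (pull_open V)))"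
  proof (rule bij_betw_byWitness[where f' = "inverse.push_section (pull_open V)"])
    show "\<forall>\<sigma>\<in>carrier (structure_sheaf R V). inverse.push_section (pull_open V) (push_section V \<sigma>) = \<sigma>"
    proof
      fix \<sigma> assume \<sigma>: "\<sigma> \<in> carrier (structure_sheaf R V)"
      show "inverse.push_section (pull_open V) (push_section V \<sigma>) = \<sigma>"
      proof
        fix P
        show "inverse.push_section (pull_open V) (push_section V \<sigma>) P = \<sigma> P"
        proof (cases "P \<in> V")
          case True
          hence "P \<in> prime_spectrum R" "inverse.pull P \<in> pull_open V"
            using VR by (auto simp: pull_open_def inverse.pull_prime pull_pull')
          thus ?thesis using True \<sigma> VR section_germ[OF \<sigma> True]
            by (simp add: inverse.push_section_def push_section_def pull_open_pull_open pull_pull' push_push)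
        next
          case False
          thus ?thesis using \<sigma> VR
            by (auto simp: inverse.push_section_def pull_open_pull_open structure_sheaf_def PiE_def extensional_def)
        qed
      qed
    qed
    show "\<forall>\<tau>\<in>carrier (structure_sheaf S (pull_open V)). push_section V (inverse.push_section (pull_open V) \<tau>) = \<tau>"
    proof
      fix \<tau> assume \<tau>: "\<tau> \<in> carrier (structure_sheaf S (pull_open V))"
      show "push_section V (inverse.push_section (pull_open V) \<tau>) = \<tau>"
      proof
        fix Q
        show "push_section V (inverse.push_section (pull_open V) \<tau>) Q = \<tau> Q"
        proof (cases "Q \<in> pull_open V")
          case True
          hence "Q \<in> prime_spectrum S" "pull Q \<in> V" by (auto simp: pull_open_def)
          thus ?thesis using True \<tau> VR inverse.section_germ[OF \<tau> True]
            by (simp add: inverse.push_section_def push_section_def pull_open_pull_open pull_pull push_push')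
        next
          case False
          thus ?thesis using \<tau>
            by (auto simp: push_section_def structure_sheaf_def PiE_def extensional_def)
        qed
      qed
    qed
    show "push_section V ` carrier (structure_sheaf R V) \<subseteq> carrier (structure_sheaf S (pull_open V))"
      using push_section_closed[OF V] by blast
    show "inverse.push_section (pull_open V) ` carrier (structure_sheaf S (pull_open V)) \<subseteq> carrier (structure_sheaf R V)"
      using inverse.push_section_closed[OF W] by (auto simp: pull_open_pull_open[OF VR])
  qed
  thus ?thesis using push_section_hom[OF V] by (simp add: ring_iso_def)
qed

theorem Spec_isomorphic:
  assumes \<iota>: "\<And>c. \<iota> c \<in> carrier R" "\<And>c. \<phi> (\<iota> c) = \<kappa> c"
  shows "isomorphic_over_field (Spec S \<kappa>) (Spec R \<iota>)"
proof -
  interpret R: cring R by (rule cR)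
  have pre: "preimage (Spec S \<kappa>) pull V = pull_open V" for V
    by (simp add: preimage_def Spec_def topspace_zariski[OF cS] pull_open_def)
  have r: "push_section W (restrict s W) = restrict (push_section V s) (pull_open W)" if "W \<subseteq> V" for V W s
    using that by (intro ext) (auto simp: push_section_def pull_open_def restrict_def)
  have c: "push_section V (\<lambda>P\<in>V. fraction R P (\<iota> c) \<one>\<^bsub>R\<^esub>) = (\<lambda>Q\<in>pull_open V. fraction S Q (\<kappa> c) \<one>\<^bsub>S\<^esub>)" for V c
    by (intro ext) (auto simp: push_section_def pull_open_def restrict_def push_germ_fraction \<iota> \<phi>_one)
  show ?thesis unfolding isomorphic_over_field_def
    by (intro exI[of _ pull] exI[of _ push_section]) (simp add: pre Spec_fields homeomorphic_pull push_section_iso r c)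
qed

end

section \<open>Global sections on the spectrum of an integral domain\<close>

context "domain"
begin

text \<open>
  In a domain the auxiliary factor in the definition of the localization can be cancelled, which
  leaves the cross product rule, the same for all primes.
\<close>
lemma fraction_eq:
  assumes P: "P \<in> prime_spectrum R" and "a \<in> carrier R" "s \<in> carrier R"
  shows "fraction R P a s = {(b, v). b \<in> carrier R \<and> v \<in> carrier R - P \<and> a \<otimes> v = b \<otimes> s}"
proof -
  have z: "\<zero> \<in> P" using P
    by (simp add: prime_spectrum_def additive_subgroup.zero_closed ideal.axioms(1) primeideal.axioms(1))
  have one: "\<one> \<notin> P" using P
    by (metis (no_types) ideal.one_imp_carrier mem_Collect_eq prime_spectrum_def primeideal.I_notcarr primeideal.axioms(1))
  have "(\<exists>u\<in>carrier R - P. u \<otimes> (a \<otimes> v) = u \<otimes> (b \<otimes> s)) \<longleftrightarrow> a \<otimes> v = b \<otimes> s"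
    if "b \<in> carrier R" "v \<in> carrier R" for b v
  proof
    assume "\<exists>u\<in>carrier R - P. u \<otimes> (a \<otimes> v) = u \<otimes> (b \<otimes> s)"
    then obtain u where u: "u \<in> carrier R" "u \<notin> P" "u \<otimes> (a \<otimes> v) = u \<otimes> (b \<otimes> s)" by blast
    hence "u \<noteq> \<zero>" using z by blast
    thus "a \<otimes> v = b \<otimes> s" using u m_lcancel[of u "a \<otimes> v" "b \<otimes> s"] that assms by simp
  next
    assume "a \<otimes> v = b \<otimes> s"
    thus "\<exists>u\<in>carrier R - P. u \<otimes> (a \<otimes> v) = u \<otimes> (b \<otimes> s)" using one by (intro bexI[of _ \<one>]) auto
  qed
  thus ?thesis by (auto simp: fraction_def)
qed

lemma fraction_eq_iff:
  assumes P: "P \<in> prime_spectrum R"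
    and as: "a \<in> carrier R" "s \<in> carrier R - P" and bv: "b \<in> carrier R" "v \<in> carrier R - P"
  shows "fraction R P a s = fraction R P b v \<longleftrightarrow> a \<otimes> v = b \<otimes> s"
proof
  have sv: "s \<in> carrier R" "v \<in> carrier R" using as bv by auto
  have z: "\<zero> \<in> P" using P
    by (simp add: prime_spectrum_def additive_subgroup.zero_closed ideal.axioms(1) primeideal.axioms(1))
  have nz: "s \<noteq> \<zero>" "v \<noteq> \<zero>" using z as bv by auto
  assume "fraction R P a s = fraction R P b v"
  moreover have "(b, v) \<in> fraction R P b v" using bv sv fraction_eq[OF P] by simp
  ultimately show "a \<otimes> v = b \<otimes> s" using fraction_eq[OF P as(1) sv(1)] by auto
next
  have sv: "s \<in> carrier R" "v \<in> carrier R" using as bv by auto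
  have z: "\<zero> \<in> P" using P
    by (simp add: prime_spectrum_def additive_subgroup.zero_closed ideal.axioms(1) primeideal.axioms(1))
  have nz: "s \<noteq> \<zero>" "v \<noteq> \<zero>" using z as bv by auto
  assume e: "a \<otimes> v = b \<otimes> s"
  have "a \<otimes> w = c \<otimes> s \<longleftrightarrow> b \<otimes> w = c \<otimes> v" if c: "c \<in> carrier R" "w \<in> carrier R" for c w
  proof -
    have "a \<otimes> w = c \<otimes> s \<longleftrightarrow> v \<otimes> (a \<otimes> w) = v \<otimes> (c \<otimes> s)"
      using m_lcancel[of v "a \<otimes> w" "c \<otimes> s"] nz sv as c by auto
    also have "v \<otimes> (a \<otimes> w) = w \<otimes> (a \<otimes> v)" using sv as c by (simp add: m_ac)
    also have "\<dots> = s \<otimes> (b \<otimes> w)" unfolding e using sv bv c by (simp add: m_ac)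
    also have "v \<otimes> (c \<otimes> s) = s \<otimes> (c \<otimes> v)" using sv c by (simp add: m_ac)
    also have "s \<otimes> (b \<otimes> w) = s \<otimes> (c \<otimes> v) \<longleftrightarrow> b \<otimes> w = c \<otimes> v"
      using m_lcancel[of s "b \<otimes> w" "c \<otimes> v"] nz sv bv c by auto
    finally show ?thesis .
  qed
  thus "fraction R P a s = fraction R P b v"
    unfolding fraction_eq[OF P as(1) sv(1)] fraction_eq[OF P bv(1) sv(2)] by auto
qed

lemma one_notin_prime: "P \<in> prime_spectrum R \<Longrightarrow> \<one> \<in> carrier R - P"
  by (metis DiffI ideal.one_imp_carrier mem_Collect_eq one_closed prime_spectrum_def primeideal.I_notcarr primeideal.axioms(1))

lemma fraction_ops:
  assumes P: "P \<in> prime_spectrum R" and ab: "a \<in> carrier R" "b \<in> carrier R"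
  shows "fraction R P a \<one> \<otimes>\<^bsub>localization_at R P\<^esub> fraction R P b \<one> = fraction R P (a \<otimes> b) \<one>"
    and "fraction R P a \<one> \<oplus>\<^bsub>localization_at R P\<^esub> fraction R P b \<one> = fraction R P (a \<oplus> b) \<one>"
proof -
  have Pp: "primeideal P R" using P by (simp add: prime_spectrum_def)
  have 1: "\<one> \<in> carrier R - P" by (rule one_notin_prime[OF P])
  have memA: "(a, \<one>) \<in> fraction R P a \<one>" "(b, \<one>) \<in> fraction R P b \<one>" using fraction_eq[OF P] ab 1 by auto
  have m: "fraction R P (c \<otimes> d) (s \<otimes> v) = fraction R P (a \<otimes> b) \<one>"
    and p: "fraction R P ((c \<otimes> v) \<oplus> (d \<otimes> s)) (s \<otimes> v) = fraction R P (a \<oplus> b) \<one>"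
    if "(c, s) \<in> fraction R P a \<one>" "(d, v) \<in> fraction R P b \<one>" for c s d v
  proof -
    have cs: "c \<in> carrier R" "s \<in> carrier R" "s \<notin> P" "c = a \<otimes> s" and dv: "d \<in> carrier R" "v \<in> carrier R" "v \<notin> P" "d = b \<otimes> v"
      using that fraction_eq[OF P] ab by auto
    have sv: "s \<otimes> v \<in> carrier R - P" using cs dv primeideal.I_prime[OF Pp, of s v] by auto
    show "fraction R P (c \<otimes> d) (s \<otimes> v) = fraction R P (a \<otimes> b) \<one>"
      using cs dv sv ab 1 by (subst fraction_eq_iff[OF P]) (auto simp: m_ac)
    show "fraction R P ((c \<otimes> v) \<oplus> (d \<otimes> s)) (s \<otimes> v) = fraction R P (a \<oplus> b) \<one>"
      using cs dv sv ab 1 by (subst fraction_eq_iff[OF P]) (auto simp: m_ac l_distr r_distr)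
  qed
  have U: "(\<Union>(c, s)\<in>A. \<Union>(d, v)\<in>B. F c s d v) = T"
    if T: "\<And>c s d v. (c, s) \<in> A \<Longrightarrow> (d, v) \<in> B \<Longrightarrow> F c s d v = T" and ne: "x \<in> A" "y \<in> B"
    for A B F and T :: "('a \<times> 'a) set" and x y
  proof (rule SUP_eq_const)
    fix z assume z: "z \<in> A"
    have "(\<Union>(d, v)\<in>B. F (fst z) (snd z) d v) = T"
    proof (rule SUP_eq_const)
      fix w assume "w \<in> B"
      thus "(case w of (d, v) \<Rightarrow> F (fst z) (snd z) d v) = T" using T[of "fst z" "snd z" "fst w" "snd w"] z
        by (simp add: split_beta)
    qed (use ne in blast)
    thus "(case z of (c, s) \<Rightarrow> \<Union>(d, v)\<in>B. F c s d v) = T" by (simp add: split_beta)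
  qed (use ne in blast)
  show "fraction R P a \<one> \<otimes>\<^bsub>localization_at R P\<^esub> fraction R P b \<one> = fraction R P (a \<otimes> b) \<one>"
    unfolding localization_at_def monoid.simps using m memA by (intro U) auto
  show "fraction R P a \<one> \<oplus>\<^bsub>localization_at R P\<^esub> fraction R P b \<one> = fraction R P (a \<oplus> b) \<one>"
    unfolding localization_at_def ring.simps using p memA by (intro U) auto
qed

lemma generic_point: "{\<zero>} \<in> prime_spectrum R"
  using zeroprimeideal by (simp add: prime_spectrum_def)

text \<open>
  All nonempty open sets contain the generic point, so that a section is determined by its germ
  there.
\<close>
lemma generic_point_in_open:
  assumes "openin (zariski_topology R) V" "V \<noteq> {}"
  shows "{\<zero>} \<in> V"
proof -
  have "generate_topology_on (basic_open R ` carrier R) V"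
    using assms(1) by (simp add: zariski_topology_def openin_topology_generated_by)
  hence "V = {} \<or> {\<zero>} \<in> V"
  proof induction
    case (Basis s)
    then obtain a where a: "a \<in> carrier R" "s = basic_open R a" by blast
    have "\<zero> \<in> P" if "P \<in> prime_spectrum R" for P using that
      by (simp add: prime_spectrum_def additive_subgroup.zero_closed ideal.axioms(1) primeideal.axioms(1))
    thus ?case using a generic_point by (auto simp: basic_open_def)
  qed auto
  thus ?thesis using assms(2) by blast
qed

definition global_section :: "'a \<Rightarrow> 'a set \<Rightarrow> ('a \<times> 'a) set"
  where "global_section a = (\<lambda>P\<in>prime_spectrum R. fraction R P a \<one>)"

lemma openin_spectrum: "openin (zariski_topology R) (prime_spectrum R)"
  using openin_topspace[of "zariski_topology R"] topspace_zariski[OF is_cring] by simp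

text \<open>
  Let the germ of a section at the generic point be \<open>a\<^sub>0 / s\<^sub>0\<close>. The denominators of this element
  of the fraction field form an ideal. Near any prime \<open>P\<close> the section is a single fraction with
  denominator outside \<open>P\<close>, and this fraction equals \<open>a\<^sub>0 / s\<^sub>0\<close>; so the ideal lies in no
  prime and contains \<open>1\<close>.
\<close>
theorem global_section_iso: "global_section \<in> ring_iso R (structure_sheaf R (prime_spectrum R))"
proof (rule ring_iso_memI)
  fix a b assume ab: "a \<in> carrier R" "b \<in> carrier R"
  show "global_section (a \<otimes> b) = global_section a \<otimes>\<^bsub>structure_sheaf R (prime_spectrum R)\<^esub> global_section b"
    "global_section (a \<oplus> b) = global_section a \<oplus>\<^bsub>structure_sheaf R (prime_spectrum R)\<^esub> global_section b"
    using ab by (auto simp: structure_sheaf_def global_section_def fraction_ops intro!: restrict_ext)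
next
  show "global_section \<one> = \<one>\<^bsub>structure_sheaf R (prime_spectrum R)\<^esub>"
    by (simp add: structure_sheaf_def global_section_def localization_at_def)
next
  have closed: "global_section a \<in> carrier (structure_sheaf R (prime_spectrum R))" if a: "a \<in> carrier R" for a
  proof -
    have "fraction R P a \<one> \<in> carrier (localization_at R P)" if "P \<in> prime_spectrum R" for P
      using a one_notin_prime[OF that] by (auto simp: localization_at_def)
    moreover have "\<forall>P\<in>prime_spectrum R. \<exists>V c s. openin (zariski_topology R) V \<and> P \<in> V \<and> V \<subseteq> prime_spectrum R \<and>
      c \<in> carrier R \<and> s \<in> carrier R \<and> (\<forall>Q\<in>V. s \<notin> Q \<and> global_section a Q = fraction R Q c s)"
      using openin_spectrum a one_notin_prime
      by (intro ballI exI[of _ "prime_spectrum R"] exI[of _ a] exI[of _ \<one>]) (auto simp: global_section_def)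
    ultimately show ?thesis by (auto simp: structure_sheaf_def global_section_def)
  qed
  show "global_section a \<in> carrier (structure_sheaf R (prime_spectrum R))" if "a \<in> carrier R" for a
    by (rule closed[OF that])
  have "inj_on global_section (carrier R)"
  proof
    fix a b assume ab: "a \<in> carrier R" "b \<in> carrier R" "global_section a = global_section b"
    hence "fraction R {\<zero>} a \<one> = fraction R {\<zero>} b \<one>"
      using generic_point by (auto simp: global_section_def dest: fun_cong[of _ _ "{\<zero>}"])
    thus "a = b" using ab fraction_eq_iff[OF generic_point, of a \<one> b \<one>] by simp
  qed
  moreover have "\<exists>a\<in>carrier R. \<sigma> = global_section a" if \<sigma>: "\<sigma> \<in> carrier (structure_sheaf R (prime_spectrum R))" for \<sigma>
  proof -
    have loc: "\<exists>V a s. openin (zariski_topology R) V \<and> P \<in> V \<and> a \<in> carrier R \<and> s \<in> carrier R \<and>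
      (\<forall>Q\<in>V. s \<notin> Q \<and> \<sigma> Q = fraction R Q a s)" if "P \<in> prime_spectrum R" for P
      using section_locally_fraction[OF \<sigma> that] by metis
    obtain a0 s0 where 0: "a0 \<in> carrier R" "s0 \<in> carrier R" "s0 \<noteq> \<zero>" "\<sigma> {\<zero>} = fraction R {\<zero>} a0 s0"
      using loc[OF generic_point] by blast
    have germ: "\<exists>a\<in>carrier R. \<exists>s\<in>carrier R. s \<notin> P \<and> \<sigma> P = fraction R P a s \<and> a0 \<otimes> s = a \<otimes> s0"
      if P: "P \<in> prime_spectrum R" for P
    proof -
      obtain V a s where V: "openin (zariski_topology R) V" "P \<in> V" "a \<in> carrier R" "s \<in> carrier R"
        "\<And>Q. Q \<in> V \<Longrightarrow> s \<notin> Q \<and> \<sigma> Q = fraction R Q a s" using loc[OF P] by blast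
      have g: "{\<zero>} \<in> V" using generic_point_in_open V by blast
      hence "fraction R {\<zero>} a0 s0 = fraction R {\<zero>} a s" "s \<noteq> \<zero>" using V(5) 0 by auto
      hence "a0 \<otimes> s = a \<otimes> s0" using fraction_eq_iff[OF generic_point, of a0 s0 a s] 0 V by auto
      thus ?thesis using V by blast
    qed
    \<comment> \<open>The ideal of denominators of the germ at the generic point.\<close>
    define I where "I = {s \<in> carrier R. \<exists>a\<in>carrier R. a0 \<otimes> s = a \<otimes> s0}"
    have "ideal I R"
    proof (rule idealI[OF ring_axioms])
      show "subgroup I (add_monoid R)"
      proof
        show "I \<subseteq> carrier (add_monoid R)" by (auto simp: I_def)
        show "\<one>\<^bsub>add_monoid R\<^esub> \<in> I" using 0 by (auto simp: I_def intro!: bexI[of _ \<zero>])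
        show "x \<otimes>\<^bsub>add_monoid R\<^esub> y \<in> I" if xy: "x \<in> I" "y \<in> I" for x y
        proof -
          obtain c d where "x \<in> carrier R" "y \<in> carrier R" "c \<in> carrier R" "d \<in> carrier R"
            "a0 \<otimes> x = c \<otimes> s0" "a0 \<otimes> y = d \<otimes> s0" using xy by (auto simp: I_def)
          hence "a0 \<otimes> (x \<oplus> y) = (c \<oplus> d) \<otimes> s0" "x \<oplus> y \<in> carrier R" "c \<oplus> d \<in> carrier R"
            using 0 by (auto simp: r_distr l_distr)
          thus ?thesis by (auto simp: I_def)
        qed
        show "inv\<^bsub>add_monoid R\<^esub> x \<in> I" if x: "x \<in> I" for x
        proof -
          obtain c where "x \<in> carrier R" "c \<in> carrier R" "a0 \<otimes> x = c \<otimes> s0" using x by (auto simp: I_def)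
          hence "a0 \<otimes> (\<ominus> x) = (\<ominus> c) \<otimes> s0" "\<ominus> x \<in> carrier R" "\<ominus> c \<in> carrier R"
            using 0 by (auto simp: r_minus l_minus)
          thus ?thesis by (auto simp: I_def a_inv_def[symmetric])
        qed
      qed
      show mem: "x \<otimes> s \<in> I" if sx: "s \<in> I" "x \<in> carrier R" for s x
      proof -
        obtain c where c: "s \<in> carrier R" "c \<in> carrier R" "a0 \<otimes> s = c \<otimes> s0" using sx by (auto simp: I_def)
        have "a0 \<otimes> (x \<otimes> s) = x \<otimes> (a0 \<otimes> s)" using c(1) 0(1,2) sx(2) by (simp add: m_ac)
        also have "\<dots> = (x \<otimes> c) \<otimes> s0" unfolding c(3) using c(1,2) 0(1,2) sx(2) by (simp add: m_ac)
        finally show ?thesis using c(1,2) sx(2) by (auto simp: I_def)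
      qed
      show "s \<otimes> x \<in> I" if "s \<in> I" "x \<in> carrier R" for s x
      proof -
        have "s \<otimes> x = x \<otimes> s" using that m_comm[of s x] by (simp add: I_def)
        thus ?thesis using mem[OF that] by simp
      qed
    qed
    moreover have "\<not> I \<subseteq> P" if "primeideal P R" for P
      using germ[of P] that by (auto simp: I_def prime_spectrum_def)
    ultimately have "I = carrier R" by (rule ideal_eq_carrier_if_no_prime)
    hence "\<one> \<in> I" by simp
    then obtain c where c: "c \<in> carrier R" "a0 = c \<otimes> s0" using 0 by (auto simp: I_def)
    have "\<sigma> = global_section c"
    proof
      fix P show "\<sigma> P = global_section c P"
      proof (cases "P \<in> prime_spectrum R")
        case True
        obtain a s where as: "a \<in> carrier R" "s \<in> carrier R" "s \<notin> P" "\<sigma> P = fraction R P a s" "a0 \<otimes> s = a \<otimes> s0"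
          using germ[OF True] by blast
        have "s0 \<otimes> (c \<otimes> s) = s0 \<otimes> a" using as c 0 by (simp add: m_ac)
        hence "c \<otimes> s = a" using m_lcancel[of s0 "c \<otimes> s" a] 0 as c by auto
        thus ?thesis using True as c one_notin_prime[OF True]
          by (simp add: global_section_def fraction_eq_iff)
      next
        case False
        thus ?thesis using \<sigma> by (auto simp: global_section_def structure_sheaf_def PiE_def extensional_def)
      qed
    qed
    thus ?thesis using c by blast
  qed
  ultimately show "bij_betw global_section (carrier R) (carrier (structure_sheaf R (prime_spectrum R)))"
    using closed by (auto simp: bij_betw_def)
qed

end

theorem isomorphic_Spec_imp_ring_iso:
  fixes R S :: "_ ring"
  assumes R: "domain R" and S: "domain S" and iso: "isomorphic_over_field (Spec S \<kappa>) (Spec R \<iota>)"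
    and \<iota>: "\<And>c. \<iota> c \<in> carrier R" "\<And>c. \<kappa> c \<in> carrier S"
  obtains \<phi> where "\<phi> \<in> ring_iso R S" "\<And>c. \<phi> (\<iota> c) = \<kappa> c"
proof -
  interpret R: "domain" R by (rule R)
  interpret S: "domain" S by (rule S)
  obtain h \<theta> where h: "homeomorphic_map (zariski_topology S) (zariski_topology R) h"
    and \<theta>: "\<And>V. openin (zariski_topology R) V \<Longrightarrow>
      \<theta> V \<in> ring_iso (structure_sheaf R V) (structure_sheaf S (preimage (Spec S \<kappa>) h V))"
    and sc: "\<And>V c. openin (zariski_topology R) V \<Longrightarrow>
      \<theta> V (\<lambda>P\<in>V. fraction R P (\<iota> c) \<one>\<^bsub>R\<^esub>) = (\<lambda>P\<in>preimage (Spec S \<kappa>) h V. fraction S P (\<kappa> c) \<one>\<^bsub>S\<^esub>)"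
    using iso unfolding isomorphic_over_field_def Spec_fields by metis
  have pre: "preimage (Spec S \<kappa>) h (prime_spectrum R) = prime_spectrum S"
    using homeomorphic_imp_continuous_map[OF h]
    by (auto simp: preimage_def Spec_def topspace_zariski[OF S.is_cring] topspace_zariski[OF R.is_cring] continuous_map_def Pi_def)
  define \<gamma> where "\<gamma> = inv_into (carrier S) S.global_section"
  have 1: "R.global_section \<in> ring_iso R (structure_sheaf R (prime_spectrum R))" by (rule R.global_section_iso)
  have 2: "\<theta> (prime_spectrum R) \<in> ring_iso (structure_sheaf R (prime_spectrum R)) (structure_sheaf S (prime_spectrum S))"
    using \<theta>[OF R.openin_spectrum] by (simp add: pre)
  have 3: "\<gamma> \<in> ring_iso (structure_sheaf S (prime_spectrum S)) S"
    unfolding \<gamma>_def by (rule ring_iso_set_sym[OF S.ring_axioms S.global_section_iso])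
  have "\<gamma> \<circ> (\<theta> (prime_spectrum R) \<circ> R.global_section) \<in> ring_iso R S"
    by (rule ring_iso_set_trans[OF ring_iso_set_trans[OF 1 2] 3])
  moreover have "(\<gamma> \<circ> (\<theta> (prime_spectrum R) \<circ> R.global_section)) (\<iota> c) = \<kappa> c" for c
  proof -
    have "\<theta> (prime_spectrum R) (R.global_section (\<iota> c)) = S.global_section (\<kappa> c)"
      using sc[OF R.openin_spectrum] by (simp add: pre R.global_section_def S.global_section_def)
    thus ?thesis using S.global_section_iso \<iota>(2)[of c] by (simp add: \<gamma>_def ring_iso_def bij_betw_def)
  qed
  ultimately show ?thesis by (rule that)
qed

section \<open>Quotients by principal ideals\<close>

definition quotient_ring :: "'a::comm_ring_1 \<Rightarrow> 'a set ring"
  where "quotient_ring g = ring_of_type_algebra Quot (PIdl\<^bsub>ring_of_type_algebra\<^esub> g)"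

definition residue_class :: "'a::comm_ring_1 \<Rightarrow> 'a \<Rightarrow> 'a set"
  where "residue_class g a = PIdl\<^bsub>ring_of_type_algebra\<^esub> g +>\<^bsub>ring_of_type_algebra\<^esub> a"

lemma zero_locus_eq: "zero_locus \<iota> g = Spec (quotient_ring g) (\<lambda>c. residue_class g (\<iota> c))"
  by (simp add: zero_locus_def quotient_ring_def residue_class_def Let_def)

lemma type_algebra_simps:
  "carrier ring_of_type_algebra = UNIV" "x \<otimes>\<^bsub>ring_of_type_algebra\<^esub> y = x * y"
  "x \<oplus>\<^bsub>ring_of_type_algebra\<^esub> y = x + y" "\<one>\<^bsub>ring_of_type_algebra\<^esub> = 1" "\<zero>\<^bsub>ring_of_type_algebra\<^esub> = 0"
  by (simp_all add: ring_of_type_algebra_def)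

lemma PIdl_type_algebra: "PIdl\<^bsub>ring_of_type_algebra\<^esub> g = {a. g dvd a}" for g :: "'a::comm_ring_1"
  by (auto simp: cgenideal_def type_algebra_simps dvd_def mult.commute)

lemma ideal_PIdl: "ideal (PIdl\<^bsub>ring_of_type_algebra\<^esub> g) ring_of_type_algebra" for g :: "'a::comm_ring_1"
  by (rule cring.cgenideal_ideal[OF cring_from_type_algebra]) (simp add: type_algebra_simps)

lemma residue_class_eq: "residue_class g a = {a + g * b | b. True}"
  unfolding residue_class_def PIdl_type_algebra a_r_coset_def'
  by (auto simp: type_algebra_simps dvd_def add.commute)

lemma residue_class_eq_iff: "residue_class g a = residue_class g b \<longleftrightarrow> g dvd a - b"
proof
  assume "residue_class g a = residue_class g b"
  moreover have "a \<in> residue_class g a" unfolding residue_class_eq by (auto intro: exI[of _ 0])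
  ultimately obtain c where "a = b + g * c" by (auto simp: residue_class_eq)
  thus "g dvd a - b" by simp
next
  assume "g dvd a - b"
  then obtain c where c: "a = b + g * c" by (auto simp: dvd_def algebra_simps)
  have "a + g * d = b + g * (c + d)" "b + g * d = a + g * (d - c)" for d by (simp_all add: c algebra_simps)
  thus "residue_class g a = residue_class g b" unfolding residue_class_eq by blast
qed

lemma cring_quotient_ring: "cring (quotient_ring g)" for g :: "'a::comm_ring_1"
  unfolding quotient_ring_def by (rule ideal.quotient_is_cring[OF ideal_PIdl cring_from_type_algebra])

lemma carrier_quotient_ring: "carrier (quotient_ring g) = range (residue_class g)"
  by (auto simp: quotient_ring_def FactRing_def A_RCOSETS_def' residue_class_def type_algebra_simps)

lemma residue_class_in [simp]: "residue_class g a \<in> carrier (quotient_ring g)"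
  by (simp add: carrier_quotient_ring)

lemma residue_class_ops:
  fixes g :: "'a::comm_ring_1"
  shows "residue_class g (a * b) = residue_class g a \<otimes>\<^bsub>quotient_ring g\<^esub> residue_class g b"
    and "residue_class g (a + b) = residue_class g a \<oplus>\<^bsub>quotient_ring g\<^esub> residue_class g b"
    and "residue_class g 1 = \<one>\<^bsub>quotient_ring g\<^esub>"
    and "residue_class g 0 = \<zero>\<^bsub>quotient_ring g\<^esub>"
proof -
  interpret ring_hom_ring "ring_of_type_algebra :: 'a ring" "quotient_ring g" "residue_class g"
    unfolding quotient_ring_def residue_class_def[abs_def]
    by (rule ideal.rcos_ring_hom_ring[OF ideal_PIdl])
  show "residue_class g (a * b) = residue_class g a \<otimes>\<^bsub>quotient_ring g\<^esub> residue_class g b"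
    "residue_class g (a + b) = residue_class g a \<oplus>\<^bsub>quotient_ring g\<^esub> residue_class g b"
    "residue_class g 1 = \<one>\<^bsub>quotient_ring g\<^esub>" "residue_class g 0 = \<zero>\<^bsub>quotient_ring g\<^esub>"
    using hom_mult[of a b] hom_add[of a b] hom_one hom_zero by (simp_all add: type_algebra_simps)
qed

lemma domain_quotient_ring:
  fixes g :: "'a::comm_ring_1"
  assumes "\<not> g dvd 1" "\<And>a b. g dvd a * b \<Longrightarrow> g dvd a \<or> g dvd b"
  shows "domain (quotient_ring g)"
  unfolding quotient_ring_def
proof (rule primeideal.quotient_is_domain[OF primeidealI])
  show "carrier ring_of_type_algebra \<noteq> PIdl\<^bsub>ring_of_type_algebra\<^esub> g"
    using assms(1) by (auto simp: PIdl_type_algebra type_algebra_simps)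
  show "a \<in> PIdl\<^bsub>ring_of_type_algebra\<^esub> g \<or> b \<in> PIdl\<^bsub>ring_of_type_algebra\<^esub> g"
    if "a \<otimes>\<^bsub>ring_of_type_algebra\<^esub> b \<in> PIdl\<^bsub>ring_of_type_algebra\<^esub> g" for a b
    using assms(2)[of a b] that by (simp add: PIdl_type_algebra type_algebra_simps)
qed (rule ideal_PIdl cring_from_type_algebra)+

text \<open>
  Homomorphisms that are inverse to each other modulo the two equations induce an isomorphism
  of the quotient rings.
\<close>
theorem zero_locus_isomorphic:
  fixes g :: "'a::comm_ring_1" and d :: "'b::comm_ring_1"
  assumes \<Gamma>: "ring_morphism \<Gamma>" and H: "ring_morphism H"
    and \<Gamma>g: "d dvd \<Gamma> g" and Hd: "g dvd H d"
    and \<Gamma>H: "\<And>p. d dvd \<Gamma> (H p) - p" and H\<Gamma>: "\<And>p. g dvd H (\<Gamma> p) - p"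
    and c: "\<And>c. \<Gamma> (\<iota> c) = \<kappa> c"
  shows "isomorphic_over_field (zero_locus \<kappa> d) (zero_locus \<iota> g)"
proof -
  interpret \<Gamma>: ring_morphism \<Gamma> by fact
  interpret H: ring_morphism H by fact
  define \<phi> where "\<phi> C = residue_class d (\<Gamma> (SOME a. C = residue_class g a))" for C
  define \<psi> where "\<psi> C = residue_class g (H (SOME a. C = residue_class d a))" for C
  have \<phi>: "\<phi> (residue_class g a) = residue_class d (\<Gamma> a)" for a
  proof -
    have "residue_class g a = residue_class g (SOME b. residue_class g a = residue_class g b)" by (rule someI) simp
    hence "g dvd a - (SOME b. residue_class g a = residue_class g b)" by (simp only: residue_class_eq_iff)
    hence "d dvd \<Gamma> a - \<Gamma> (SOME b. residue_class g a = residue_class g b)"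
      using \<Gamma>.dvd \<Gamma>g by (metis \<Gamma>.diff dvd_trans)
    thus ?thesis unfolding \<phi>_def by (metis residue_class_eq_iff)
  qed
  have \<psi>: "\<psi> (residue_class d a) = residue_class g (H a)" for a
  proof -
    have "residue_class d a = residue_class d (SOME b. residue_class d a = residue_class d b)" by (rule someI) simp
    hence "d dvd a - (SOME b. residue_class d a = residue_class d b)" by (simp only: residue_class_eq_iff)
    hence "g dvd H a - H (SOME b. residue_class d a = residue_class d b)"
      using H.dvd Hd by (metis H.diff dvd_trans)
    thus ?thesis unfolding \<psi>_def by (metis residue_class_eq_iff)
  qed
  have "\<phi> \<in> ring_iso (quotient_ring g) (quotient_ring d)"
  proof (rule ring_iso_memI)
    show "bij_betw \<phi> (carrier (quotient_ring g)) (carrier (quotient_ring d))"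
      by (rule bij_betw_byWitness[where f' = \<psi>])
        (auto simp: carrier_quotient_ring \<phi> \<psi> residue_class_eq_iff \<Gamma>H H\<Gamma>)
  qed (auto simp: carrier_quotient_ring \<phi> residue_class_ops[symmetric] \<Gamma>.add \<Gamma>.mult \<Gamma>.one)
  then interpret ring_isomorphism "quotient_ring g" "quotient_ring d" \<phi>
    by (intro ring_isomorphism.intro cring_quotient_ring)
  show ?thesis unfolding zero_locus_eq by (rule Spec_isomorphic) (simp_all add: \<phi> c)
qed

section \<open>Families over the punctured line and their generic fibre\<close>

lemma laurent_mpol_morphism_eqI:
  assumes "ring_morphism h1" "ring_morphism (h2 :: ('n::finite, 'a::comm_ring_1) mpol laurent \<Rightarrow> 'b::comm_ring_1)"
    and "\<And>c. h1 (laurent_const (mpol_const c)) = h2 (laurent_const (mpol_const c))"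
    and "\<And>i. h1 (laurent_const (mvar i)) = h2 (laurent_const (mvar i))"
    and "\<And>k. h1 (laurent_var_power k) = h2 (laurent_var_power k)"
  shows "h1 u = h2 u"
proof -
  have "h1 (laurent_const p) = h2 (laurent_const p)" for p
    using ring_morphism_eq_msubst[OF ring_morphism_comp[OF laurent_const_morphism assms(1)], of p]
      ring_morphism_eq_msubst[OF ring_morphism_comp[OF laurent_const_morphism assms(2)], of p] assms(3,4) by simp
  thus ?thesis
    using ring_morphism_eq_pm_eval[OF assms(1), of u] ring_morphism_eq_pm_eval[OF assms(2), of u] assms(5)
    by (simp add: laurent_const_def laurent_var_power_def)
qed

text \<open>
  \<open>G\<close> is a family of polynomial maps \<open>x \<mapsto> G(t, x)\<close> parametrized by \<open>t \<noteq> 0\<close>, and this is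
  the pullback of functions along \<open>(t, x) \<mapsto> (t, G(t, x))\<close>.
\<close>
definition family_subst :: "('n::finite \<Rightarrow> ('n, complex) mpol laurent) \<Rightarrow> ('n, complex) mpol laurent \<Rightarrow> ('n, complex) mpol laurent"
  where "family_subst G = pm_eval (msubst (\<lambda>c. laurent_const (mpol_const c)) G) laurent_var_power"

lemma laurent_scalar_morphism: "ring_morphism (\<lambda>c::'a::comm_ring_1. laurent_const (mpol_const c) :: ('n, 'a) mpol laurent)"
  by (rule ring_morphism_comp[OF mpol_const_morphism laurent_const_morphism])

lemma family_subst_morphism: "ring_morphism (family_subst G)"
  unfolding family_subst_def
  by (intro pm_eval_morphism msubst_morphism laurent_scalar_morphism) (simp_all add: laurent_var_power_0 laurent_var_power_add)

lemma family_subst_const: "family_subst G (laurent_const p) = msubst (\<lambda>c. laurent_const (mpol_const c)) G p"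
  by (simp add: family_subst_def laurent_const_def pm_eval_single laurent_var_power_0[unfolded laurent_var_power_def]
      ring_morphism.zero[OF msubst_morphism[OF laurent_scalar_morphism[unfolded laurent_const_def]]] laurent_var_power_0)

lemma family_subst_mvar: "family_subst G (laurent_const (mvar i)) = G i"
  by (simp add: family_subst_const msubst_mvar[OF laurent_scalar_morphism])

lemma family_subst_scalar: "family_subst G (laurent_const (mpol_const c)) = laurent_const (mpol_const c)"
  by (simp add: family_subst_const msubst_const[OF laurent_scalar_morphism])

lemma family_subst_var_power: "family_subst G (laurent_var_power k) = laurent_var_power k"
proof -
  interpret m: ring_morphism "msubst (\<lambda>c. laurent_const (mpol_const c)) G" by (rule msubst_morphism[OF laurent_scalar_morphism])
  have "family_subst G (single k 1) = laurent_var_power k"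
    unfolding family_subst_def by (subst pm_eval_single) (simp_all add: m.zero m.one)
  thus ?thesis by (simp add: laurent_var_power_def)
qed

lemma family_subst_eval:
  assumes t: "t \<noteq> 0"
  shows "leval t x (family_subst G u) = leval t (\<chi> i. leval t x (G i)) u"
  by (rule laurent_mpol_morphism_eqI[OF ring_morphism_comp[OF family_subst_morphism leval_morphism[OF t]]
        leval_morphism[OF t]])
    (simp_all add: family_subst_scalar family_subst_mvar family_subst_var_power)

lemma rf_const_morphism: "ring_morphism rf_const"
  by unfold_locales (simp_all add: rf_const_def One_fract_def one_pCons mult.commute)

lemma rf_var_nonzero: "rf_var \<noteq> 0"
  by (simp add: rf_var_def Zero_fract_def eq_fract)

definition generic_base :: "('n::finite, complex) mpol \<Rightarrow> ('n, rational_function) mpol"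
  where "generic_base = msubst (\<lambda>c. mpol_const (rf_const c)) mvar"

lemma rf_scalar_morphism: "ring_morphism (\<lambda>c. mpol_const (rf_const c) :: ('n, rational_function) mpol)"
  by (rule ring_morphism_comp[OF rf_const_morphism mpol_const_morphism])

lemma generic_base_morphism: "ring_morphism generic_base"
  unfolding generic_base_def by (rule msubst_morphism[OF rf_scalar_morphism])

lemma generic_base_eq_map:
  fixes f :: "('n::finite, complex) mpol"
  shows "generic_base f = Poly_Mapping.map rf_const f"
proof -
  have z: "rf_const 0 = 0" by (rule ring_morphism.zero[OF rf_const_morphism])
  have mono: "monomial_at mvar \<alpha> = (single \<alpha> 1 :: ('n, rational_function) mpol)" for \<alpha>
    unfolding mvar_def by (rule eq_monomial_at[symmetric]) (simp_all add: mult_single)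
  have "generic_base f = (\<Sum>\<alpha>\<in>keys f. single \<alpha> (rf_const (lookup f \<alpha>)))"
    by (simp add: generic_base_def msubst_def pm_eval_def mono mpol_const_def mult_single)
  also have "\<dots> = Poly_Mapping.map rf_const f"
  proof (rule poly_mapping_eqI)
    fix \<beta>
    have "lookup (\<Sum>\<alpha>\<in>keys f. single \<alpha> (rf_const (lookup f \<alpha>))) \<beta>
      = (\<Sum>\<alpha>\<in>keys f. if \<beta> = \<alpha> then rf_const (lookup f \<alpha>) else 0)"
      unfolding lookup_sum by (rule sum.cong) (auto simp: lookup_single when_def)
    also have "\<dots> = rf_const (lookup f \<beta>)" by (auto simp: in_keys_iff z)
    also have "\<dots> = lookup (Poly_Mapping.map rf_const f) \<beta>"
      by (simp add: Poly_Mapping.map.rep_eq when_def z)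
    finally show "lookup (\<Sum>\<alpha>\<in>keys f. single \<alpha> (rf_const (lookup f \<alpha>))) \<beta>
      = lookup (Poly_Mapping.map rf_const f) \<beta>" .
  qed
  finally show ?thesis .
qed

text \<open>
  The inclusion of \<open>\<complex>[x][t, t\<inverse>]\<close> into \<open>\<complex>(t)[x]\<close>, that is, restriction to the generic
  fibre of the projection to \<open>t\<close>.
\<close>
definition to_generic :: "('n::finite, complex) mpol laurent \<Rightarrow> ('n, rational_function) mpol"
  where "to_generic = pm_eval generic_base (\<lambda>k. mpol_const (rf_var powi k))"

lemma to_generic_morphism: "ring_morphism to_generic"
  unfolding to_generic_def using rf_var_nonzero
  by (intro pm_eval_morphism generic_base_morphism)
    (simp_all add: power_int_add ring_morphism.mult[OF mpol_const_morphism] ring_morphism.one[OF mpol_const_morphism])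

lemma to_generic_const: "to_generic (laurent_const p) = generic_base p"
proof -
  interpret b: ring_morphism generic_base by (rule generic_base_morphism)
  show ?thesis unfolding to_generic_def laurent_const_def
    by (subst pm_eval_single) (simp_all add: b.zero ring_morphism.one[OF mpol_const_morphism])
qed

lemma to_generic_var_power: "to_generic (laurent_var_power k) = mpol_const (rf_var powi k)"
proof -
  interpret b: ring_morphism generic_base by (rule generic_base_morphism)
  show ?thesis unfolding to_generic_def laurent_var_power_def
    by (subst pm_eval_single) (simp_all add: b.zero b.one)
qed

lemma to_generic_scalar: "to_generic (laurent_const (mpol_const c)) = mpol_const (rf_const c)"
  by (simp add: to_generic_const generic_base_def msubst_const[OF rf_scalar_morphism])

lemma to_generic_mvar: "to_generic (laurent_const (mvar i)) = mvar i"
  by (simp add: to_generic_const generic_base_def msubst_mvar[OF rf_scalar_morphism])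

definition generic_fibre_eq :: "('n, complex) mpol \<Rightarrow> nat \<Rightarrow> ('n, rational_function) mpol"
  where "generic_fibre_eq f l = Poly_Mapping.map rf_const f - mpol_const (inverse rf_var ^ l)"

text \<open>
  The two equations differ by the factor \<open>t\<^sup>l\<close>, a unit of \<open>\<complex>(t)\<close>: the variety \<open>f = t\<^sup>-\<^sup>l\<close> over
  \<open>\<complex>(t)\<close> is the generic fibre of the hypersurface \<open>t\<^sup>l f = 1\<close>.
\<close>
lemma to_generic_hypersurface_eq:
  fixes f :: "('n::finite, complex) mpol"
  shows "to_generic (hypersurface_eq f l) = mpol_const (rf_var ^ l) * generic_fibre_eq f l"
    and "generic_fibre_eq f l = mpol_const (inverse rf_var ^ l) * to_generic (hypersurface_eq f l)"
proof -
  interpret g: ring_morphism "to_generic :: ('n, complex) mpol laurent \<Rightarrow> _" by (rule to_generic_morphism)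
  interpret c: ring_morphism "mpol_const :: _ \<Rightarrow> ('n, rational_function) mpol" by (rule mpol_const_morphism)
  have 1: "mpol_const (rf_var ^ l) * mpol_const (inverse rf_var ^ l) = (1 :: ('n, rational_function) mpol)"
    using rf_var_nonzero by (simp add: c.mult[symmetric] c.one power_mult_distrib[symmetric])
  show *: "to_generic (hypersurface_eq f l) = mpol_const (rf_var ^ l) * generic_fibre_eq f l"
    by (simp add: hypersurface_eq_def g.diff g.mult g.one to_generic_const to_generic_var_power generic_base_eq_map
        generic_fibre_eq_def right_diff_distrib 1)
  show "generic_fibre_eq f l = mpol_const (inverse rf_var ^ l) * to_generic (hypersurface_eq f l)"
    unfolding * by (simp add: mult.assoc[symmetric] 1[unfolded mult.commute[of "mpol_const (rf_var ^ l)"]])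
qed

definition generic_subst :: "('n::finite \<Rightarrow> ('n, complex) mpol laurent) \<Rightarrow> ('n, rational_function) mpol \<Rightarrow> ('n, rational_function) mpol"
  where "generic_subst G = msubst mpol_const (\<lambda>i. to_generic (G i))"

lemma generic_subst_morphism: "ring_morphism (generic_subst G)"
  unfolding generic_subst_def by (rule msubst_morphism[OF mpol_const_morphism])

lemma generic_subst_const: "generic_subst G (mpol_const c) = mpol_const c"
  unfolding generic_subst_def by (rule msubst_const[OF mpol_const_morphism])

lemma generic_subst_mvar: "generic_subst G (mvar i) = to_generic (G i)"
  unfolding generic_subst_def by (rule msubst_mvar[OF mpol_const_morphism])

lemma generic_subst_generic: "generic_subst G (to_generic u) = to_generic (family_subst G u)"
  by (rule laurent_mpol_morphism_eqI[OF ring_morphism_comp[OF to_generic_morphism generic_subst_morphism]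
        ring_morphism_comp[OF family_subst_morphism to_generic_morphism]])
    (simp_all add: to_generic_scalar to_generic_mvar to_generic_var_power generic_subst_const generic_subst_mvar
      family_subst_scalar family_subst_mvar family_subst_var_power)

lemma dvd_mult_diff:
  assumes "d dvd a - b" "d dvd a' - b'" shows "(d :: 'a::comm_ring_1) dvd a * a' - b * b'"
proof -
  have "a * a' - b * b' = (a - b) * a' + b * (a' - b')" by (simp add: algebra_simps)
  thus ?thesis using assms by (metis dvd_add dvd_mult dvd_mult2)
qed

lemma dvd_prod_diff:
  "(\<And>i. i \<in> I \<Longrightarrow> (d :: 'a::comm_ring_1) dvd F i - G i) \<Longrightarrow> d dvd (\<Prod>i\<in>I. F i) - (\<Prod>i\<in>I. G i)"
  by (induction I rule: infinite_finite_induct) (simp_all add: dvd_mult_diff)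

lemma mpol_morphism_congI:
  assumes "ring_morphism h1" "ring_morphism (h2 :: ('n::finite, 'a::comm_ring_1) mpol \<Rightarrow> 'b::comm_ring_1)"
    and c: "\<And>c. h1 (mpol_const c) = h2 (mpol_const c)" and i: "\<And>i. d dvd h1 (mvar i) - h2 (mvar i)"
  shows "d dvd h1 p - h2 p"
proof -
  have "h1 p - h2 p = (\<Sum>\<alpha>\<in>keys p. h2 (mpol_const (lookup p \<alpha>)) *
     (monomial_at (\<lambda>i. h1 (mvar i)) \<alpha> - monomial_at (\<lambda>i. h2 (mvar i)) \<alpha>))"
    unfolding ring_morphism_eq_msubst[OF assms(1), of p] ring_morphism_eq_msubst[OF assms(2), of p] msubst_def pm_eval_def
    by (simp add: c right_diff_distrib sum_subtractf)
  thus ?thesis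
    by (simp only:) (intro dvd_sum dvd_mult, simp only: monomial_at_def, intro dvd_prod_diff dvd_power_diff i)
qed

lemma family_subst_dvd:
  assumes "l \<ge> 1" "f \<noteq> 0"
    and G: "\<And>t x. on_hypersurface f l t x \<Longrightarrow> on_hypersurface f k t (\<chi> i. leval t x (G i))"
  shows "generic_fibre_eq f l dvd generic_subst G (generic_fibre_eq f k)"
proof -
  have "hypersurface_eq f l dvd family_subst G (hypersurface_eq f k)"
  proof (unfold vanishes_iff_dvd[OF assms(1,2)], intro allI impI)
    fix t x assume on: "on_hypersurface f l t x"
    hence t: "t \<noteq> 0" by (simp add: on_hypersurface_def)
    show "leval t x (family_subst G (hypersurface_eq f k)) = 0"
      unfolding family_subst_eval[OF t] by (rule dvd_imp_vanishes[OF dvd_refl G[OF on]])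
  qed
  from ring_morphism.dvd[OF to_generic_morphism this] have "generic_fibre_eq f l dvd generic_subst G (to_generic (hypersurface_eq f k))"
    unfolding generic_subst_generic to_generic_hypersurface_eq(1)[of f l] by (rule dvd_mult_right)
  thus ?thesis unfolding to_generic_hypersurface_eq(2)[of f k] ring_morphism.mult[OF generic_subst_morphism] by simp
qed

lemma family_subst_inverse:
  assumes "l \<ge> 1" "f \<noteq> 0"
    and GH: "\<And>t x i. on_hypersurface f l t x \<Longrightarrow>
      leval t (\<chi> i. leval t x (G i)) (H i) = x $ i"
  shows "generic_fibre_eq f l dvd generic_subst G (generic_subst H p) - p"
proof (rule mpol_morphism_congI[OF ring_morphism_comp[OF generic_subst_morphism generic_subst_morphism] ring_morphism_id])
  fix i
  have "hypersurface_eq f l dvd family_subst G (H i) - laurent_const (mvar i)"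
  proof (unfold vanishes_iff_dvd[OF assms(1,2)], intro allI impI)
    fix t x assume on: "on_hypersurface f l t x"
    hence t: "t \<noteq> 0" by (simp add: on_hypersurface_def)
    show "leval t x (family_subst G (H i) - laurent_const (mvar i)) = 0"
      using GH[OF on] by (simp add: ring_morphism.diff[OF leval_morphism[OF t]] family_subst_eval[OF t])
  qed
  from ring_morphism.dvd[OF to_generic_morphism this]
  have "generic_fibre_eq f l dvd to_generic (family_subst G (H i)) - mvar i"
    unfolding ring_morphism.diff[OF to_generic_morphism] to_generic_mvar to_generic_hypersurface_eq(1)[of f l] by (rule dvd_mult_right)
  thus "generic_fibre_eq f l dvd generic_subst G (generic_subst H (mvar i)) - mvar i"
    by (simp add: generic_subst_mvar generic_subst_generic)
qed (simp add: generic_subst_const)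

text \<open>
  The families have coefficients in \<open>\<complex>[t, t\<inverse>]\<close>, so the assumptions on complex points are
  congruences modulo the equations, and these survive the passage to the generic fibre.
\<close>
theorem Y_isomorphic_if_families:
  assumes l: "l \<ge> 1" "k \<ge> 1" and f: "f \<noteq> 0"
    and G: "\<And>t x. on_hypersurface f l t x \<Longrightarrow> on_hypersurface f k t (\<chi> i. leval t x (G i))"
    and H: "\<And>t x. on_hypersurface f k t x \<Longrightarrow> on_hypersurface f l t (\<chi> i. leval t x (H i))"
    and GH: "\<And>t x i. on_hypersurface f l t x \<Longrightarrow> leval t (\<chi> i. leval t x (G i)) (H i) = x $ i"
    and HG: "\<And>t x i. on_hypersurface f k t x \<Longrightarrow> leval t (\<chi> i. leval t x (H i)) (G i) = x $ i"
  shows "isomorphic_over_field (Y_variety f l) (Y_variety f k)"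
proof -
  have "isomorphic_over_field (zero_locus mpol_const (generic_fibre_eq f l)) (zero_locus mpol_const (generic_fibre_eq f k))"
    by (rule zero_locus_isomorphic[of "generic_subst G" "generic_subst H"])
      (intro generic_subst_morphism family_subst_dvd family_subst_inverse assms generic_subst_const | assumption)+
  thus ?thesis by (simp add: Y_variety_def generic_fibre_eq_def)
qed

section \<open>Isomorphisms between the hypersurfaces\<close>

lemma X_tilde_eq: "X_tilde f l = zero_locus (\<lambda>c. laurent_const (mpol_const c)) (hypersurface_eq f l)"
  by (simp add: X_tilde_def hypersurface_eq_def)

text \<open>
  The points of affine space times the punctured line are the algebra homomorphisms from its
  coordinate ring to the field.
\<close>
lemma laurent_morphism_is_eval:
  assumes "ring_morphism (h :: ('n::finite, 'a::field) mpol laurent \<Rightarrow> 'a)"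
    and c: "\<And>c. h (laurent_const (mpol_const c)) = c"
  shows "h (laurent_var_power 1) \<noteq> 0"
    and "h u = leval (h (laurent_var_power 1)) (\<chi> i. h (laurent_const (mvar i))) u"
proof -
  interpret ring_morphism h by fact
  have m: "h (laurent_var_power a) * h (laurent_var_power b) = h (laurent_var_power (a + b))" for a b
    by (simp add: mult[symmetric] laurent_var_power_add)
  have 0: "h (laurent_var_power 0) = 1" by (simp add: laurent_var_power_0 one)
  have "h (laurent_var_power 1) * h (laurent_var_power (-1)) = 1" using m[of 1 "-1"] 0 by simp
  thus nz: "h (laurent_var_power 1) \<noteq> 0" by auto
  have nat: "h (laurent_var_power (int n)) = h (laurent_var_power 1) ^ n" for n
    by (induction n) (simp_all add: 0 m[symmetric])
  have pw: "h (laurent_var_power k) = h (laurent_var_power 1) powi k" for k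
  proof (cases "k \<ge> 0")
    case True
    thus ?thesis using nat[of "nat k"] by (simp add: power_int_def)
  next
    case False
    have "h (laurent_var_power 1) ^ nat (- k) * h (laurent_var_power k) = 1"
      using m[of "- k" k] 0 nat[of "nat (- k)"] False by simp
    hence "h (laurent_var_power k) = inverse (h (laurent_var_power 1) ^ nat (- k))" by (metis inverse_unique)
    thus ?thesis using False by (simp add: power_int_def power_inverse)
  qed
  show "h u = leval (h (laurent_var_power 1)) (\<chi> i. h (laurent_const (mvar i))) u"
  proof (rule laurent_mpol_morphism_eqI[OF assms(1) leval_morphism[OF nz]])
    show "h (laurent_var_power k) = leval (h (laurent_var_power 1)) (\<chi> i. h (laurent_const (mvar i))) (laurent_var_power k)" for k
      unfolding leval_var by (rule pw)
  qed (simp_all add: c)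
qed

text \<open>
  Composing a homomorphism of coordinate rings with evaluation at a point gives evaluation at the
  image point.
\<close>
lemma quotient_hom_on_points:
  assumes \<phi>: "\<phi> \<in> ring_hom (quotient_ring (hypersurface_eq f l')) (quotient_ring (hypersurface_eq f l))"
    and c: "\<And>c. \<phi> (residue_class (hypersurface_eq f l') (laurent_const (mpol_const c))) =
      residue_class (hypersurface_eq f l) (laurent_const (mpol_const c))"
    and P: "\<And>i. \<phi> (residue_class (hypersurface_eq f l') (laurent_const (mvar i))) = residue_class (hypersurface_eq f l) (P i)"
    and T: "\<phi> (residue_class (hypersurface_eq f l') (laurent_var_power 1)) = residue_class (hypersurface_eq f l) T"
    and on: "on_hypersurface f l t x"
  shows "on_hypersurface f l' (leval t x T) (\<chi> i. leval t x (P i))"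
    and "\<phi> (residue_class (hypersurface_eq f l') u) = residue_class (hypersurface_eq f l) w \<Longrightarrow>
      leval t x w = leval (leval t x T) (\<chi> i. leval t x (P i)) u"
proof -
  let ?g = "hypersurface_eq f l" and ?g' = "hypersurface_eq f l'"
  have t: "t \<noteq> 0" using on by (simp add: on_hypersurface_def)
  interpret ev: ring_morphism "leval t x" by (rule leval_morphism[OF t])
  have well: "leval t x w = leval t x v" if "residue_class ?g w = residue_class ?g v" for w v
    using dvd_imp_vanishes[OF that[unfolded residue_class_eq_iff] on] by (simp add: ev.diff)
  have ex: "\<exists>w. \<phi> (residue_class ?g' u) = residue_class ?g w" for u
    using ring_hom_closed[OF \<phi>, of "residue_class ?g' u"] by (auto simp: carrier_quotient_ring)
  define h where "h u = leval t x (SOME w. \<phi> (residue_class ?g' u) = residue_class ?g w)" for u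
  have h: "h u = leval t x w" if "\<phi> (residue_class ?g' u) = residue_class ?g w" for u w
    using someI_ex[OF ex[of u]] that unfolding h_def by (intro well) simp
  have hm: "ring_morphism h"
  proof
    fix a b
    obtain v w where vw: "\<phi> (residue_class ?g' a) = residue_class ?g v" "\<phi> (residue_class ?g' b) = residue_class ?g w"
      using ex by metis
    have "\<phi> (residue_class ?g' (a + b)) = residue_class ?g (v + w)"
      using ring_hom_add[OF \<phi>, of "residue_class ?g' a" "residue_class ?g' b"] by (simp add: residue_class_ops vw)
    thus "h (a + b) = h a + h b" using h vw by (simp add: ev.add)
    have "\<phi> (residue_class ?g' (a * b)) = residue_class ?g (v * w)"
      using ring_hom_mult[OF \<phi>, of "residue_class ?g' a" "residue_class ?g' b"] by (simp add: residue_class_ops vw)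
    thus "h (a * b) = h a * h b" using h vw by (simp add: ev.mult)
    have "\<phi> (residue_class ?g' 1) = residue_class ?g 1"
      using ring_hom_one[OF \<phi>] by (simp add: residue_class_ops)
    thus "h 1 = 1" using h by (simp add: ev.one)
  qed
  have hc: "h (laurent_const (mpol_const c)) = c" for c using h[OF c] by simp
  have e: "h u = leval (leval t x T) (\<chi> i. leval t x (P i)) u" for u
    using laurent_morphism_is_eval(2)[OF hm hc, of u] h[OF T] h[OF P] by simp
  have T0: "leval t x T \<noteq> 0" using laurent_morphism_is_eval(1)[OF hm hc] h[OF T] by simp
  show "\<phi> (residue_class ?g' u) = residue_class ?g w \<Longrightarrow>
      leval t x w = leval (leval t x T) (\<chi> i. leval t x (P i)) u"
    using h e by metis
  have "residue_class ?g' ?g' = residue_class ?g' 0" by (simp add: residue_class_eq_iff)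
  moreover have "h 0 = 0" by (rule ring_morphism.zero[OF hm])
  ultimately have "h ?g' = 0" unfolding h_def by simp
  hence "leval (leval t x T) (\<chi> i. leval t x (P i)) ?g' = 0" using e by simp
  thus "on_hypersurface f l' (leval t x T) (\<chi> i. leval t x (P i))"
    using T0 by (simp add: hypersurface_eq_eval on_hypersurface_def)
qed

lemma laurent_expandable_imp_regular:
  assumes "laurent_expandable (\<lambda>s. F)"
  shows "\<exists>p. \<forall>t x. t \<noteq> 0 \<longrightarrow> F t x = leval t x p"
proof -
  obtain q where q: "\<And>s t x. s \<noteq> 0 \<Longrightarrow> t \<noteq> 0 \<Longrightarrow> F t x = pm_eval (leval t x) (\<lambda>k. s powi k) q"
    using assms unfolding laurent_expandable_def by metis
  have "F t x = leval t x (\<Sum>k\<in>keys q. lookup q k)" if t: "t \<noteq> 0" for t x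
    using q[of 1 t x] t by (simp add: pm_eval_def ring_morphism.sum[OF leval_morphism])
  thus ?thesis by blast
qed

lemma laurent_expandable_subst:
  assumes F: "\<And>i. laurent_expandable (\<lambda>s t x. F i t x)"
  shows "laurent_expandable (\<lambda>s t x. leval (c * t powi n) (\<chi> i. F i t x) p)"
proof -
  have "laurent_expandable (\<lambda>s t x. \<Sum>k\<in>keys p.
     (\<Sum>\<alpha>\<in>keys (lookup p k). lookup (lookup p k) \<alpha> *
       (\<Prod>i\<in>UNIV. F i t x ^ lookup \<alpha> i)) * (c powi k * t powi (n * k)))"
    by (intro laurent_expandable_sum laurent_expandable_mult laurent_expandable_prod laurent_expandable_power
        laurent_expandable_scalar laurent_expandable_t F)
  thus ?thesis by (simp add: laurent_mpol_eval_def mpol_eval_def power_int_mult_distrib power_int_mult)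
qed

lemma power_int_2_inject: "(2::complex) powi k = 2 powi j \<Longrightarrow> k = j"
proof -
  assume a: "(2::complex) powi k = 2 powi j"
  have "(2::real) powi k = 2 powi j"
    using arg_cong[OF a, of norm] by (simp add: norm_power_int)
  thus ?thesis
    by (metis less_irrefl linorder_neqE_linordered_idom one_less_numeral_iff power_int_strict_increasing semiring_norm(76))
qed

context semi_invariant_polynomial
begin

lemma domain_coordinate_ring:
  assumes l: "l \<ge> 1" "coprime l m"
  shows "domain (quotient_ring (hypersurface_eq f l))"
proof (rule domain_quotient_ring)
  obtain x where x: "on_hypersurface f l 1 x" using hypersurface_nonempty_over[of 1] by auto
  show "\<not> hypersurface_eq f l dvd 1"
    using dvd_imp_vanishes[OF _ x, of 1] by (auto simp: ring_morphism.one[OF leval_morphism])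
next
  fix a b assume "hypersurface_eq f l dvd a * b"
  hence "leval t x a * leval t x b = 0" if "on_hypersurface f l t x" for t x
    using dvd_imp_vanishes[OF _ that] that
    by (simp add: on_hypersurface_def ring_morphism.mult[OF leval_morphism, symmetric])
  from vanishing_ideal_prime[OF l this] show "hypersurface_eq f l dvd a \<or> hypersurface_eq f l dvd b"
    by (simp add: vanishes_iff_dvd[OF l(1) f_nonzero])
qed

text \<open>
  The image of \<open>t\<close> is a unit.
\<close>
lemma variable_image_monomial:
  assumes l: "l \<ge> 1" "coprime l m"
    and \<phi>: "\<phi> \<in> ring_hom (quotient_ring (hypersurface_eq f l')) (quotient_ring (hypersurface_eq f l))"
    and T: "\<phi> (residue_class (hypersurface_eq f l') (laurent_var_power 1)) = residue_class (hypersurface_eq f l) T"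
  shows "\<exists>a j. \<forall>t x. on_hypersurface f l t x \<longrightarrow> leval t x T = a * t powi j"
proof -
  let ?g = "hypersurface_eq f l" and ?g' = "hypersurface_eq f l'"
  obtain T' where T': "\<phi> (residue_class ?g' (laurent_var_power (-1))) = residue_class ?g T'"
    using ring_hom_closed[OF \<phi>, of "residue_class ?g' (laurent_var_power (-1))"] by (auto simp: carrier_quotient_ring)
  have "residue_class ?g (T * T') = \<phi> (residue_class ?g' (laurent_var_power 1 * laurent_var_power (-1)))"
    using ring_hom_mult[OF \<phi>, of "residue_class ?g' (laurent_var_power 1)" "residue_class ?g' (laurent_var_power (-1))"]
    by (simp add: residue_class_ops T T')
  also have "\<dots> = residue_class ?g 1"
    using ring_hom_one[OF \<phi>] by (simp add: laurent_var_power_add[symmetric] laurent_var_power_0 residue_class_ops)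
  finally have d: "?g dvd T * T' - 1" by (simp add: residue_class_eq_iff)
  have "leval t x T * leval t x T' = 1" if on: "on_hypersurface f l t x" for t x
  proof -
    interpret ev: ring_morphism "leval t x"
      by (rule leval_morphism) (use on in \<open>simp add: on_hypersurface_def\<close>)
    show ?thesis using dvd_imp_vanishes[OF d on] by (simp add: ev.diff ev.mult ev.one)
  qed
  thus ?thesis by (rule units_on_hypersurface[OF l])
qed

text \<open>
  In coordinates, an isomorphism of the two hypersurfaces is \<open>(t, x) \<mapsto> (a t\<^sup>j, P(t, x))\<close>, and
  its inverse is of the same kind. Comparing the \<open>t\<close>-coordinates, which take all nonzero values,
  shows that \<open>j\<close> has an inverse in the integers.
\<close>
lemma coordinates_of_isomorphism:
  assumes l: "l \<ge> 1" "coprime l m" and l': "l' \<ge> 1" "coprime l' m"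
    and iso: "isomorphic_over_field (X_tilde f l) (X_tilde f l')"
  obtains P Q a j where "a \<noteq> 0" "j = 1 \<or> j = -1"
    "\<And>t x. on_hypersurface f l t x \<Longrightarrow> on_hypersurface f l' (a * t powi j) (\<chi> i. leval t x (P i))"
    "\<And>t y. t \<noteq> 0 \<Longrightarrow> on_hypersurface f l' (a * t powi j) y \<Longrightarrow>
      on_hypersurface f l t (\<chi> i. leval (a * t powi j) y (Q i))"
    "\<And>t x i. on_hypersurface f l t x \<Longrightarrow>
      leval (a * t powi j) (\<chi> i. leval t x (P i)) (Q i) = x $ i"
    "\<And>t y i. t \<noteq> 0 \<Longrightarrow> on_hypersurface f l' (a * t powi j) y \<Longrightarrow>
      leval t (\<chi> i. leval (a * t powi j) y (Q i)) (P i) = y $ i"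
proof -
  let ?g = "hypersurface_eq f l" and ?g' = "hypersurface_eq f l'"
  let ?R = "quotient_ring ?g" and ?R' = "quotient_ring ?g'"
  obtain \<phi> where \<phi>: "\<phi> \<in> ring_iso ?R' ?R"
    and c: "\<And>c. \<phi> (residue_class ?g' (laurent_const (mpol_const c))) = residue_class ?g (laurent_const (mpol_const c))"
    using isomorphic_Spec_imp_ring_iso[OF domain_coordinate_ring[OF l'] domain_coordinate_ring[OF l]
        iso[unfolded X_tilde_eq zero_locus_eq]] by auto
  define \<psi> where "\<psi> = inv_into (carrier ?R') \<phi>"
  have \<psi>: "\<psi> \<in> ring_iso ?R ?R'" unfolding \<psi>_def
    by (rule ring_iso_set_sym[OF cring.axioms(1)[OF cring_quotient_ring] \<phi>])
  have \<psi>\<phi>: "\<psi> (\<phi> z) = z" if "z \<in> carrier ?R'" for z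
    using ring_iso_memE(5)[OF \<phi>] that by (simp add: \<psi>_def bij_betw_def)
  have \<phi>\<psi>: "\<phi> (\<psi> z) = z" if "z \<in> carrier ?R" for z
    using ring_iso_memE(5)[OF \<phi>] that by (simp add: \<psi>_def bij_betw_def f_inv_into_f)
  have \<phi>h: "\<phi> \<in> ring_hom ?R' ?R" and \<psi>h: "\<psi> \<in> ring_hom ?R ?R'" using \<phi> \<psi> by (simp_all add: ring_iso_def)
  have c': "\<psi> (residue_class ?g (laurent_const (mpol_const c))) = residue_class ?g' (laurent_const (mpol_const c))" for c
    using \<psi>\<phi>[of "residue_class ?g' (laurent_const (mpol_const c))"] by (simp add: c)
  have exP: "\<exists>w. \<phi> (residue_class ?g' u) = residue_class ?g w" for u
    using ring_hom_closed[OF \<phi>h, of "residue_class ?g' u"] by (auto simp: carrier_quotient_ring)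
  have exQ: "\<exists>w. \<psi> (residue_class ?g u) = residue_class ?g' w" for u
    using ring_hom_closed[OF \<psi>h, of "residue_class ?g u"] by (auto simp: carrier_quotient_ring)
  define P where "P i = (SOME w. \<phi> (residue_class ?g' (laurent_const (mvar i))) = residue_class ?g w)" for i
  have P: "\<phi> (residue_class ?g' (laurent_const (mvar i))) = residue_class ?g (P i)" for i
    unfolding P_def by (rule someI_ex[OF exP])
  define Q where "Q i = (SOME w. \<psi> (residue_class ?g (laurent_const (mvar i))) = residue_class ?g' w)" for i
  have Q: "\<psi> (residue_class ?g (laurent_const (mvar i))) = residue_class ?g' (Q i)" for i
    unfolding Q_def by (rule someI_ex[OF exQ])
  obtain T where T: "\<phi> (residue_class ?g' (laurent_var_power 1)) = residue_class ?g T" using exP by metis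
  obtain U where U: "\<psi> (residue_class ?g (laurent_var_power 1)) = residue_class ?g' U" using exQ by metis
  have Q': "\<phi> (residue_class ?g' (Q i)) = residue_class ?g (laurent_const (mvar i))" for i
    using \<phi>\<psi>[of "residue_class ?g (laurent_const (mvar i))"] by (simp add: Q)
  have P': "\<psi> (residue_class ?g (P i)) = residue_class ?g' (laurent_const (mvar i))" for i
    using \<psi>\<phi>[of "residue_class ?g' (laurent_const (mvar i))"] by (simp add: P)
  have U': "\<phi> (residue_class ?g' U) = residue_class ?g (laurent_var_power 1)"
    using \<phi>\<psi>[of "residue_class ?g (laurent_var_power 1)"] by (simp add: U)
  obtain a j where a: "\<And>t x. on_hypersurface f l t x \<Longrightarrow> leval t x T = a * t powi j"
    using variable_image_monomial[OF l \<phi>h T] by blast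
  obtain b k where b: "\<And>t x. on_hypersurface f l' t x \<Longrightarrow> leval t x U = b * t powi k"
    using variable_image_monomial[OF l' \<psi>h U] by blast
  note onP = quotient_hom_on_points(1)[OF \<phi>h c P T]
  note onQ = quotient_hom_on_points(1)[OF \<psi>h c' Q U]
  note evP = quotient_hom_on_points(2)[OF \<phi>h c P T]
  note evQ = quotient_hom_on_points(2)[OF \<psi>h c' Q U]
  \<comment> \<open>The \<open>t\<close>-coordinate of the inverse map applied to the image of a point.\<close>
  have tt: "b * (a * t powi j) powi k = t" if t: "t \<noteq> 0" for t
  proof -
    obtain x where x: "on_hypersurface f l t x" using hypersurface_nonempty_over[OF t] .
    have "t = leval (leval t x T) (\<chi> i. leval t x (P i)) U"
      using evP[OF x U'] by simp
    thus ?thesis using b[OF onP[OF x]] a[OF x] by simp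
  qed
  have "b * a powi k = 1" using tt[of 1] by simp
  moreover have "b * a powi k * 2 powi (j * k) = 2 powi 1"
    using tt[of 2] by (simp add: power_int_mult_distrib power_int_mult mult.assoc)
  ultimately have "(2::complex) powi (j * k) = 2 powi 1" by simp
  hence "j * k = 1" by (rule power_int_2_inject)
  hence jk: "j = 1 \<or> j = -1" by (metis zmult_eq_1_iff)
  have a0: "a \<noteq> 0"
  proof
    assume "a = 0"
    obtain x where x: "on_hypersurface f l 1 x" using hypersurface_nonempty_over[of 1] by auto
    show False using onP[OF x] a[OF x] \<open>a = 0\<close> by (simp add: on_hypersurface_def)
  qed
  show thesis
  proof (rule that[OF a0 jk])
    fix t x assume x: "on_hypersurface f l t x"
    show "on_hypersurface f l' (a * t powi j) (\<chi> i. leval t x (P i))"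
      using onP[OF x] a[OF x] by simp
    show "leval (a * t powi j) (\<chi> i. leval t x (P i)) (Q i) = x $ i" for i
      using evP[OF x Q'[of i]] a[OF x] by simp
  next
    fix t y assume t: "t \<noteq> 0" and y: "on_hypersurface f l' (a * t powi j) y"
    have u: "leval (a * t powi j) y U = t" using b[OF y] tt[OF t] by simp
    show "on_hypersurface f l t (\<chi> i. leval (a * t powi j) y (Q i))"
      using onQ[OF y] u by simp
    show "leval t (\<chi> i. leval (a * t powi j) y (Q i)) (P i) = y $ i" for i
      using evQ[OF y P'[of i]] u by simp
  qed
qed

text \<open>
  \<open>P\<close> identifies the fibre \<open>f = t\<^sup>-\<^sup>l\<close> with the fibre \<open>f = (a t\<^sup>j)\<^sup>-\<^sup>l\<^sup>'\<close>, and the torus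
  element \<open>c t\<^sup>n\<close> moves the latter to \<open>f = t\<^sup>-\<^sup>k\<close>. The composite is a family of isomorphisms
  over the punctured line that fixes \<open>t\<close>.
\<close>
lemma Y_isomorphic_after_rescaling:
  assumes l: "l \<ge> 1" and k: "k \<ge> 1" and a: "a \<noteq> 0" and c: "c \<noteq> 0"
    and P: "\<And>t x. on_hypersurface f l t x \<Longrightarrow> on_hypersurface f l' (a * t powi j) (\<chi> i. leval t x (P i))"
    and Q: "\<And>t y. t \<noteq> 0 \<Longrightarrow> on_hypersurface f l' (a * t powi j) y \<Longrightarrow>
      on_hypersurface f l t (\<chi> i. leval (a * t powi j) y (Q i))"
    and PQ: "\<And>t x i. on_hypersurface f l t x \<Longrightarrow>
      leval (a * t powi j) (\<chi> i. leval t x (P i)) (Q i) = x $ i"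
    and QP: "\<And>t y i. t \<noteq> 0 \<Longrightarrow> on_hypersurface f l' (a * t powi j) y \<Longrightarrow>
      leval t (\<chi> i. leval (a * t powi j) y (Q i)) (P i) = y $ i"
    and scale: "\<And>t. t \<noteq> 0 \<Longrightarrow> (c * t powi n) ^ m * t ^ k = (a * t powi j) ^ l'"
  shows "isomorphic_over_field (Y_variety f l) (Y_variety f k)"
proof -
  obtain p :: "'n \<Rightarrow> ('n, complex) mpol laurent"
    where p: "\<And>s x i. s \<noteq> 0 \<Longrightarrow> \<mu> s x $ i = leval s x (p i)" using action_components by blast
  define \<rho> where "\<rho> t = c * t powi n" for t
  have \<rho>0: "\<rho> t \<noteq> 0" if "t \<noteq> 0" for t using that c by (simp add: \<rho>_def)
  have \<rho>i: "inverse (\<rho> t) = inverse c * t powi (- n)" for t by (simp add: \<rho>_def power_int_minus)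
  have \<mu>: "\<mu> s x = (\<chi> i. leval s x (p i))" if "s \<noteq> 0" for s x using p[OF that] by (simp add: vec_eq_iff)
  have "laurent_expandable (\<lambda>s t x. leval (c * t powi n) (\<chi> i. leval t x (P i)) (p i'))" for i'
    by (intro laurent_expandable_subst laurent_expandable_const)
  hence "\<exists>g. \<forall>t x. t \<noteq> 0 \<longrightarrow> leval (c * t powi n) (\<chi> i. leval t x (P i)) (p i') = leval t x g" for i'
    by (rule laurent_expandable_imp_regular)
  then obtain G where "\<And>i' t x. t \<noteq> 0 \<Longrightarrow> leval t x (G i') = leval (\<rho> t) (\<chi> i. leval t x (P i)) (p i')"
    unfolding \<rho>_def by metis
  hence G: "(\<chi> i. leval t x (G i)) = \<mu> (\<rho> t) (\<chi> i. leval t x (P i))" if "t \<noteq> 0" for t x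
    using that \<mu>[OF \<rho>0[OF that]] by (simp add: vec_eq_iff)
  have var: "laurent_expandable (\<lambda>s t x. x $ i)" for i
    using laurent_expandable_mpol[of "mvar i"] by simp
  have "laurent_expandable (\<lambda>s t x. leval (a * t powi j)
     (\<chi> i. leval (inverse c * t powi (- n)) (\<chi> i. x $ i) (p i)) (Q i'))" for i'
    by (intro laurent_expandable_subst var)
  hence "\<exists>g. \<forall>t x. t \<noteq> 0 \<longrightarrow> leval (a * t powi j)
     (\<chi> i. leval (inverse c * t powi (- n)) (\<chi> i. x $ i) (p i)) (Q i') = leval t x g" for i'
    by (rule laurent_expandable_imp_regular)
  then obtain H where "\<And>i' t x. t \<noteq> 0 \<Longrightarrow> leval t x (H i') = leval (a * t powi j)
     (\<chi> i. leval (inverse c * t powi (- n)) (\<chi> i. x $ i) (p i)) (Q i')" by metis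
  hence H: "leval t x (H i) = leval (a * t powi j) (\<mu> (inverse (\<rho> t)) x) (Q i)"
    if "t \<noteq> 0" for t x i
    using that c \<mu>[of "inverse (\<rho> t)" x] \<rho>0[OF that] by (simp add: \<rho>i)
  have preimage_on: "on_hypersurface f l' (a * t powi j) (\<mu> (inverse (\<rho> t)) y)" if y: "on_hypersurface f k t y" for t y
  proof -
    have t: "t \<noteq> 0" using y by (simp add: on_hypersurface_def)
    have "(a * t powi j) ^ l' * mpol_eval (\<mu> (inverse (\<rho> t)) y) f
      = ((\<rho> t) ^ m * inverse (\<rho> t) ^ m) * (t ^ k * mpol_eval y f)"
      using \<rho>0[OF t] by (simp add: eval_action scale[OF t, symmetric] \<rho>_def[symmetric])
    also have "(\<rho> t) ^ m * inverse (\<rho> t) ^ m = 1" using \<rho>0[OF t] by (simp add: power_mult_distrib[symmetric])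
    finally show ?thesis using y a by (simp add: on_hypersurface_def)
  qed
  show ?thesis
  proof (rule Y_isomorphic_if_families[OF l k f_nonzero, of G H])
    fix t x assume x: "on_hypersurface f l t x"
    have t: "t \<noteq> 0" using x by (simp add: on_hypersurface_def)
    have "t ^ k * mpol_eval (\<mu> (\<rho> t) (\<chi> i. leval t x (P i))) f
       = (a * t powi j) ^ l' * mpol_eval (\<chi> i. leval t x (P i)) f"
      using \<rho>0[OF t] by (simp add: eval_action scale[OF t, symmetric] \<rho>_def[symmetric])
    thus "on_hypersurface f k t (\<chi> i. leval t x (G i))"
      using P[OF x] t by (simp add: G[OF t] on_hypersurface_def)
    show "leval t (\<chi> i. leval t x (G i)) (H i) = x $ i" for i
      using PQ[OF x] \<rho>0[OF t] by (simp add: G[OF t] H[OF t] action_inverse)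
  next
    fix t y assume y: "on_hypersurface f k t y"
    have t: "t \<noteq> 0" using y by (simp add: on_hypersurface_def)
    show "on_hypersurface f l t (\<chi> i. leval t y (H i))"
      using Q[OF t preimage_on[OF y]] by (simp add: H[OF t])
    let ?w = "\<chi> i. leval (a * t powi j) (\<mu> (inverse (\<rho> t)) y) (Q i)"
    have "(\<chi> i. leval t ?w (P i)) = \<mu> (inverse (\<rho> t)) y"
      using QP[OF t preimage_on[OF y]] by (simp add: vec_eq_iff)
    hence "(\<chi> i. leval t ?w (G i)) = y"
      using \<rho>0[OF t] by (simp add: G[OF t] action_inverse)
    thus "leval t (\<chi> i. leval t y (H i)) (G i) = y $ i" for i
      by (simp add: H[OF t] vec_eq_iff)
  qed
qed

end

theorem proposition8:
  fixes f :: "('n::finite, complex) mpol"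
    and \<mu> :: "complex \<Rightarrow> complex^'n \<Rightarrow> complex^'n"
    and m l l' l'' :: nat
  assumes "Factorial_Ring.irreducible f"
    and "regular_Gm_action \<mu>"
    and "effective_Gm_action \<mu>"
    and "m \<ge> 1"
    and "semi_invariant \<mu> m f"
    and "l \<ge> 1" and "l' \<ge> 1"
    and "coprime l m" and "coprime l' m"
    and "isomorphic_over_field (X_tilde f l) (X_tilde f l')"
    and "l'' \<ge> 1"
    and "[int l'' = - int l'] (mod int m)"
  shows "isomorphic_over_field (Y_variety f l) (Y_variety f l') \<or>
         isomorphic_over_field (Y_variety f l) (Y_variety f l'')"
proof -
  interpret semi_invariant_polynomial f \<mu> m
    using assms by unfold_locales
  obtain P Q a j where a: "a \<noteq> 0" and j: "j = 1 \<or> j = -1" and PQ: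
    "\<And>t x. on_hypersurface f l t x \<Longrightarrow> on_hypersurface f l' (a * t powi j) (\<chi> i. leval t x (P i))"
    "\<And>t y. t \<noteq> 0 \<Longrightarrow> on_hypersurface f l' (a * t powi j) y \<Longrightarrow>
      on_hypersurface f l t (\<chi> i. leval (a * t powi j) y (Q i))"
    "\<And>t x i. on_hypersurface f l t x \<Longrightarrow>
      leval (a * t powi j) (\<chi> i. leval t x (P i)) (Q i) = x $ i"
    "\<And>t y i. t \<noteq> 0 \<Longrightarrow> on_hypersurface f l' (a * t powi j) y \<Longrightarrow>
      leval t (\<chi> i. leval (a * t powi j) y (Q i)) (P i) = y $ i"
    by (rule coordinates_of_isomorphism[OF assms(6,8,7,9,10)]) (rule that)
  have "a ^ l' \<noteq> 0" using a by simp
  \<comment> \<open>The constant \<open>c\<close> compensates the factor \<open>a\<close> in either case.\<close>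
  then obtain c where c: "c ^ m = a ^ l'" "c \<noteq> 0" using complex_root_exists[OF assms(4)] by metis
  from j show ?thesis
  proof
    assume j: "j = 1"
    have "(c * t powi 0) ^ m * t ^ l' = (a * t powi j) ^ l'" for t
      by (simp add: j c power_mult_distrib)
    thus ?thesis using Y_isomorphic_after_rescaling[OF assms(6,7) a c(2) PQ] by blast
  next
    assume j: "j = -1"
    have "int m dvd int l'' - (- int l')" using assms(12) by (simp add: cong_iff_dvd_diff)
    \<comment> \<open>The torus element \<open>c t\<^sup>-\<^sup>n\<close> multiplies \<open>f\<close> by \<open>c\<^sup>m\<close> times the power of \<open>t\<close> with exponent \<open>- (l' + l'')\<close>.\<close>
    then obtain n where n: "int l'' + int l' = int m * n" by (auto simp: dvd_def)
    have "(c * t powi (- n)) ^ m * t ^ l'' = (a * t powi j) ^ l'" if t: "t \<noteq> 0" for t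
    proof -
      have "(c * t powi (- n)) ^ m * t ^ l'' = a ^ l' * (t powi (- n * int m) * t powi int l'')"
        using power_int_mult[of t "- n" "int m"] by (simp add: power_mult_distrib c)
      also have "t powi (- n * int m) * t powi int l'' = t powi (- int l')"
      proof -
        have "- n * int m + int l'' = - int l'" using n by (simp add: algebra_simps)
        thus ?thesis using power_int_add[of t "- n * int m" "int l''"] t by simp
      qed
      finally show ?thesis by (simp add: j power_mult_distrib power_int_minus power_inverse)
    qed
    thus ?thesis using Y_isomorphic_after_rescaling[OF assms(6,11) a c(2) PQ] by blast
  qed
qed

end
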